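(* Let $\{\xi_t\}_{t\ge0}$ be a stationary Markov process with invariant measure $\pi$ and normal infinitesimal generator $L$, let $g\in\mathbb{L}_0^2(\pi)$, let $\nu=\nu_g$ be the transition spectral measure associated with $L$ and $g$ on $\mathbb{H}^-=\{z\in\mathbb{C}:\Re(z)\le0\}$, and let $S_T(g)=\int_0^Tg(\xi_s)\,\mathrm{d}s$. For $x>0$ let $$U_x:=\{a+\mathrm{i}b:0\le-a\le|b|\le x\},\qquad \varsigma^2:=-2\int_{\mathbb{H}^-}\Re(1/z)\,\nu(\mathrm{d}z).$$ For $K>0$ the following are equivalent: (i) $\mathrm{var}(S_T(g))/T$ converges as $T\to\infty$ to the finite limit $\varsigma^2+K$; (ii) $\varsigma^2<\infty$ and $\nu(U_x)/x\to K/\pi$ as $x\to0^+$. In addition, if $\varsigma^2<\infty$ and $\liminf_{T\to\infty}\mathrm{var}(S_T(g))/T=\infty$, then for $1\le\alpha<2$ and $h$ slowly varying at infinity, $\mathrm{var}(S_T(g))\sim T^\alpha h(T)$ as $T\to\infty$ if and only if $\nu(U_x)\sim C(\alpha)x^{2-\alpha}h(1/x)$ as $x\to0^+$.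
   Context: $\{\xi_t\}_{t\ge0}$ is a stationary Markov process with values in a measurable space $(S,\mathcal{A})$ and stationary law $\pi$, progressively measurable with respect to a filtration $\{\mathcal{F}_t\}$ for which it satisfies the Markov property. The contraction semigroup $T_tg(x)=\mathbb{E}[g(\xi_t)\mid\xi_0=x]$ is assumed strongly continuous on $L^2(\pi)$; $T_t=e^{Lt}$ with $L$ the (possibly unbounded) infinitesimal generator, assumed normal, so its spectrum lies in $\{\Re(z)\le0\}$. $\mathbb{L}_0^2(\pi)$ is the set of real measurable $g$ with $\int g^2\mathrm{d}\pi<\infty$ and $\int g\,\mathrm{d}\pi=0$. The transition spectral measure $\nu=\nu_g$ is the finite measure on $\mathbb{H}^-$ given by the spectral theorem for $L$ and $g$; it satisfies $\mathrm{cov}(g(\xi_0),g(\xi_t))=\langle g,T_tg\rangle=\int_{\Re(z)\le0}e^{zt}\nu(\mathrm{d}z)$, $t\ge0$. The integrand $-\Re(1/z)=-\Re(z)/|z|^2\ge0$ is read as $0$ on the imaginary axis, including $z=0$. $C(\alpha):=\Gamma(1+\alpha)\sin(\alpha\pi/2)/[\pi(2-\alpha)]$. A continuous function $h:(0,\infty)\to(0,\infty)$ is slowly varying at infinity if $h(st)/h(t)\to1$ as $t\to\infty$ for every $s>0$. $a\sim b$ means that the ratio tends to $1$. *)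

theory Defs
  imports "HOL-Probability.Probability" "HOL-Library.Landau_Symbols"
begin

section \<open>Operators on the complex Hilbert space of square-integrable functions\<close>

text \<open>
  The space \<open>L\<^sup>2(\<pi>)\<close> is represented by the square-integrable functions themselves; equality of
  elements is equality almost everywhere. Everywhere defined operators are functions on
  functions. Unbounded operators are graphs, that is, relations. The measurable space \<open>(S, \<A>)\<close>
  is the one underlying the measure \<open>\<pi>\<close>.
\<close>

definition L2 :: "'s measure \<Rightarrow> ('s \<Rightarrow> complex) set" where
  "L2 \<pi> = {f \<in> borel_measurable \<pi>. integrable \<pi> (\<lambda>x. (cmod (f x))\<^sup>2)}"

definition L2_inner :: "'s measure \<Rightarrow> ('s \<Rightarrow> complex) \<Rightarrow> ('s \<Rightarrow> complex) \<Rightarrow> complex" where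
  "L2_inner \<pi> f h = (\<integral>x. f x * cnj (h x) \<partial>\<pi>)"

definition L2_norm :: "'s measure \<Rightarrow> ('s \<Rightarrow> complex) \<Rightarrow> real" where
  "L2_norm \<pi> f = sqrt (\<integral>x. (cmod (f x))\<^sup>2 \<partial>\<pi>)"

type_synonym 's operator_graph = "(('s \<Rightarrow> complex) \<times> ('s \<Rightarrow> complex)) set"

definition densely_defined :: "'s measure \<Rightarrow> 's operator_graph \<Rightarrow> bool" where
  "densely_defined \<pi> A \<longleftrightarrow>
     (\<forall>f\<in>L2 \<pi>. \<forall>e>0. \<exists>h\<in>Domain A. L2_norm \<pi> (\<lambda>x. f x - h x) < e)"

definition closed_operator :: "'s measure \<Rightarrow> 's operator_graph \<Rightarrow> bool" where
  "closed_operator \<pi> A \<longleftrightarrow>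
     (\<forall>fs us. \<forall>f\<in>L2 \<pi>. \<forall>u\<in>L2 \<pi>.
        (\<forall>n::nat. (fs n, us n) \<in> A) \<and>
        (\<lambda>n. L2_norm \<pi> (\<lambda>x. fs n x - f x)) \<longlonglongrightarrow> 0 \<and>
        (\<lambda>n. L2_norm \<pi> (\<lambda>x. us n x - u x)) \<longlonglongrightarrow> 0
        \<longrightarrow> (f, u) \<in> A)"

definition adjoint_operator :: "'s measure \<Rightarrow> 's operator_graph \<Rightarrow> 's operator_graph" where
  "adjoint_operator \<pi> A =
     {(h, k). h \<in> L2 \<pi> \<and> k \<in> L2 \<pi> \<and> (\<forall>(f, u)\<in>A. L2_inner \<pi> u h = L2_inner \<pi> f k)}"

text \<open>
  \<open>A O B\<close> applies \<open>A\<close> first, so the last condition is \<open>A\<^sup>* A = A A\<^sup>*\<close> including domains.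
\<close>

definition normal_operator :: "'s measure \<Rightarrow> 's operator_graph \<Rightarrow> bool" where
  "normal_operator \<pi> A \<longleftrightarrow>
     A \<subseteq> L2 \<pi> \<times> L2 \<pi> \<and> densely_defined \<pi> A \<and> closed_operator \<pi> A \<and>
     A O adjoint_operator \<pi> A = adjoint_operator \<pi> A O A"

text \<open>
  Linearity and boundedness are not listed: an everywhere defined symmetric map on a Hilbert
  space is linear and bounded, and in particular respects equality almost everywhere.
\<close>

definition orthogonal_projection ::
    "'s measure \<Rightarrow> (('s \<Rightarrow> complex) \<Rightarrow> ('s \<Rightarrow> complex)) \<Rightarrow> bool" where
  "orthogonal_projection \<pi> P \<longleftrightarrow>
     (\<forall>f\<in>L2 \<pi>. P f \<in> L2 \<pi>) \<and>
     (\<forall>f\<in>L2 \<pi>. \<forall>h\<in>L2 \<pi>. L2_inner \<pi> (P f) h = L2_inner \<pi> f (P h)) \<and>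
     (\<forall>f\<in>L2 \<pi>. AE x in \<pi>. P (P f) x = P f x)"

definition projection_valued_measure ::
    "'s measure \<Rightarrow> (complex set \<Rightarrow> ('s \<Rightarrow> complex) \<Rightarrow> ('s \<Rightarrow> complex)) \<Rightarrow> bool" where
  "projection_valued_measure \<pi> E \<longleftrightarrow>
     (\<forall>B\<in>sets borel. orthogonal_projection \<pi> (E B)) \<and>
     (\<forall>f\<in>L2 \<pi>. AE x in \<pi>. E {} f x = 0) \<and>
     (\<forall>f\<in>L2 \<pi>. AE x in \<pi>. E UNIV f x = f x) \<and>
     (\<forall>B\<in>sets borel. \<forall>C\<in>sets borel. \<forall>f\<in>L2 \<pi>. AE x in \<pi>. E (B \<inter> C) f x = E B (E C f) x) \<and>
     (\<forall>B. range B \<subseteq> sets borel \<and> disjoint_family B \<longrightarrow>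
        (\<forall>f\<in>L2 \<pi>. (\<lambda>n. L2_norm \<pi> (\<lambda>x. (\<Sum>i<n. E (B i) f x) - E (\<Union>i. B i) f x)) \<longlonglongrightarrow> 0))"

text \<open>
  The measure \<open>B \<mapsto> \<langle>E(B) f, f\<rangle>\<close>; the inner product is real and nonnegative for a projection.
\<close>

definition pvm_measure ::
    "'s measure \<Rightarrow> (complex set \<Rightarrow> ('s \<Rightarrow> complex) \<Rightarrow> ('s \<Rightarrow> complex)) \<Rightarrow> ('s \<Rightarrow> complex)
     \<Rightarrow> complex measure" where
  "pvm_measure \<pi> E f =
     measure_of UNIV (sets borel) (\<lambda>B. ennreal (Re (L2_inner \<pi> (E B f) f)))"

text \<open>
  \<open>A = \<integral> z dE(z)\<close>, in the usual sense for unbounded operators: the domain consists of all \<open>f\<close>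
  with \<open>\<integral> |z|\<^sup>2 d\<langle>E(z) f, f\<rangle> < \<infinity>\<close>, and \<open>\<langle>A f, f\<rangle> = \<integral> z d\<langle>E(z) f, f\<rangle>\<close> there, which determines
  \<open>A\<close> by polarization. The spectral theorem asserts that every normal operator has exactly one
  spectral resolution.
\<close>

definition spectral_resolution ::
    "'s measure \<Rightarrow> 's operator_graph \<Rightarrow> (complex set \<Rightarrow> ('s \<Rightarrow> complex) \<Rightarrow> ('s \<Rightarrow> complex))
     \<Rightarrow> bool" where
  "spectral_resolution \<pi> A E \<longleftrightarrow>
     projection_valued_measure \<pi> E \<and>
     Domain A = {f \<in> L2 \<pi>. integrable (pvm_measure \<pi> E f) (\<lambda>z. (cmod z)\<^sup>2)} \<and>
     (\<forall>(f, u)\<in>A. L2_inner \<pi> u f = (\<integral>z. z \<partial>pvm_measure \<pi> E f))"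


section \<open>Stationary Markov processes\<close>

text \<open>
  Only times \<open>t \<ge> 0\<close> are relevant; values of \<open>F\<close> and \<open>\<xi>\<close> at negative times are unconstrained.
\<close>

locale stationary_markov_process = prob_space M
  for M :: "'w measure" +
  fixes F :: "real \<Rightarrow> 'w measure"
    and \<pi> :: "'s measure"
    and \<xi> :: "real \<Rightarrow> 'w \<Rightarrow> 's"
  assumes subalgebra_F: "0 \<le> t \<Longrightarrow> subalgebra M (F t)"
    and F_mono: "0 \<le> s \<Longrightarrow> s \<le> t \<Longrightarrow> sets (F s) \<subseteq> sets (F t)"
    and progressively_measurable:
      "0 \<le> t \<Longrightarrow> (\<lambda>(s, \<omega>). \<xi> s \<omega>) \<in> restrict_space borel {0..t} \<Otimes>\<^sub>M F t \<rightarrow>\<^sub>M \<pi>"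
    and law: "distr M \<pi> (\<xi> 0) = \<pi>"
    and stationary:
      "0 \<le> s \<Longrightarrow>
         distr M (\<Pi>\<^sub>M t\<in>{0..}. \<pi>) (\<lambda>\<omega>. \<lambda>t\<in>{0..}. \<xi> (s + t) \<omega>) =
         distr M (\<Pi>\<^sub>M t\<in>{0..}. \<pi>) (\<lambda>\<omega>. \<lambda>t\<in>{0..}. \<xi> t \<omega>)"
    and markov:
      "0 \<le> s \<Longrightarrow> 0 \<le> t \<Longrightarrow> A \<in> sets \<pi> \<Longrightarrow>
         AE \<omega> in M.
           real_cond_exp M (F s) (\<lambda>\<omega>'. indicator A (\<xi> (s + t) \<omega>')) \<omega> =
           real_cond_exp M (vimage_algebra (space M) (\<xi> s) \<pi>)
             (\<lambda>\<omega>'. indicator A (\<xi> (s + t) \<omega>')) \<omega>"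

definition complex_cond_exp ::
    "'w measure \<Rightarrow> 'w measure \<Rightarrow> ('w \<Rightarrow> complex) \<Rightarrow> ('w \<Rightarrow> complex)" where
  "complex_cond_exp M G X =
     (\<lambda>\<omega>. Complex (real_cond_exp M G (\<lambda>\<omega>'. Re (X \<omega>')) \<omega>) (real_cond_exp M G (\<lambda>\<omega>'. Im (X \<omega>')) \<omega>))"

text \<open>
  \<open>T\<^sub>t f(x) = E[f(\<xi>\<^sub>t) | \<xi>\<^sub>0 = x]\<close>: a version of the factorization of \<open>E[f(\<xi>\<^sub>t) | \<sigma>(\<xi>\<^sub>0)]\<close> through
  \<open>\<xi>\<^sub>0\<close>, which is unique up to equality almost everywhere under the law of \<open>\<xi>\<^sub>0\<close>.
\<close>

definition transition_op ::
    "'w measure \<Rightarrow> 's measure \<Rightarrow> (real \<Rightarrow> 'w \<Rightarrow> 's) \<Rightarrow> real \<Rightarrow> ('s \<Rightarrow> complex) \<Rightarrow> ('s \<Rightarrow> complex)" where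
  "transition_op M \<pi> \<xi> t f =
     (SOME u. u \<in> L2 \<pi> \<and>
        (AE \<omega> in M. u (\<xi> 0 \<omega>) =
           complex_cond_exp M (vimage_algebra (space M) (\<xi> 0) \<pi>) (\<lambda>\<omega>'. f (\<xi> t \<omega>')) \<omega>))"

definition strongly_continuous ::
    "'s measure \<Rightarrow> (real \<Rightarrow> ('s \<Rightarrow> complex) \<Rightarrow> ('s \<Rightarrow> complex)) \<Rightarrow> bool" where
  "strongly_continuous \<pi> P \<longleftrightarrow>
     (\<forall>f\<in>L2 \<pi>. ((\<lambda>t. L2_norm \<pi> (\<lambda>x. P t f x - f x)) \<longlongrightarrow> 0) (at_right 0))"

definition generator ::
    "'s measure \<Rightarrow> (real \<Rightarrow> ('s \<Rightarrow> complex) \<Rightarrow> ('s \<Rightarrow> complex)) \<Rightarrow> 's operator_graph" where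
  "generator \<pi> P =
     {(f, u). f \<in> L2 \<pi> \<and> u \<in> L2 \<pi> \<and>
        ((\<lambda>t. L2_norm \<pi> (\<lambda>x. (P t f x - f x) / of_real t - u x)) \<longlongrightarrow> 0) (at_right 0)}"

definition L2_0 :: "'s measure \<Rightarrow> ('s \<Rightarrow> real) set" where
  "L2_0 \<pi> = {g \<in> borel_measurable \<pi>. integrable \<pi> (\<lambda>x. (g x)\<^sup>2) \<and> (\<integral>x. g x \<partial>\<pi>) = 0}"

text \<open>
  \<open>\<nu>\<close> is a measure on all of \<open>\<complex>\<close>; it is concentrated on the spectrum of \<open>A\<close>, which for the
  generator of a contraction semigroup is contained in the closed left half-plane.
\<close>

definition is_spectral_measure ::
    "'s measure \<Rightarrow> 's operator_graph \<Rightarrow> ('s \<Rightarrow> real) \<Rightarrow> complex measure \<Rightarrow> bool" where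
  "is_spectral_measure \<pi> A g \<nu> \<longleftrightarrow>
     (\<exists>E. spectral_resolution \<pi> A E \<and> \<nu> = pvm_measure \<pi> E (\<lambda>x. complex_of_real (g x)))"


section \<open>Integrated process, asymptotic variance and slow variation\<close>

definition integrated_process ::
    "(real \<Rightarrow> 'w \<Rightarrow> 's) \<Rightarrow> ('s \<Rightarrow> real) \<Rightarrow> real \<Rightarrow> 'w \<Rightarrow> real" where
  "integrated_process \<xi> g T \<omega> = (LBINT s:{0..T}. g (\<xi> s \<omega>))"

definition var_S :: "'w measure \<Rightarrow> (real \<Rightarrow> 'w \<Rightarrow> 's) \<Rightarrow> ('s \<Rightarrow> real) \<Rightarrow> real \<Rightarrow> real" where
  "var_S M \<xi> g T = prob_space.variance M (integrated_process \<xi> g T)"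

definition left_half_plane :: "complex set" where
  "left_half_plane = {z. Re z \<le> 0}"

text \<open>
  The integrand \<open>- Re (1 / z)\<close> vanishes on the whole imaginary axis because \<open>1 / 0 = 0\<close>.
\<close>

definition sigma_sq :: "complex measure \<Rightarrow> ennreal" where
  "sigma_sq \<nu> = 2 * (\<integral>\<^sup>+z\<in>left_half_plane. ennreal (- Re (1 / z)) \<partial>\<nu>)"

definition U :: "real \<Rightarrow> complex set" where
  "U x = {z. 0 \<le> - Re z \<and> - Re z \<le> \<bar>Im z\<bar> \<and> \<bar>Im z\<bar> \<le> x}"

definition C_const :: "real \<Rightarrow> real" where
  "C_const \<alpha> = Gamma (1 + \<alpha>) * sin (\<alpha> * pi / 2) / (pi * (2 - \<alpha>))"

definition slowly_varying :: "(real \<Rightarrow> real) \<Rightarrow> bool" where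
  "slowly_varying h \<longleftrightarrow>
     continuous_on {0<..} h \<and> (\<forall>x>0. 0 < h x) \<and>
     (\<forall>s>0. ((\<lambda>t. h (s * t) / h t) \<longlongrightarrow> 1) at_top)"

end

theory Submission
  imports Defs
begin

text \<open>
  The variance of \<open>S\<^sub>T\<close> is an integral of an explicit kernel against the spectral measure \<open>\<nu>\<close>. Its
  singular part near the imaginary axis is a Fejer kernel, and a Tauberian theorem for that kernel
  relates the growth of the variance to the mass of \<open>\<nu>\<close> near \<open>0\<close>.

  \<^bold>\<open>Reduction to a Fejer transform.\<close> By stationarity, \<open>var(S\<^sub>T)\<close> is the double integral over \<open>[0, T]\<^sup>2\<close> of the
  covariances \<open>\<langle>T\<^sub>|\<^sub>s\<^sub>-\<^sub>u\<^sub>| g, g\<rangle>\<close>, and these are the exponential moments \<open>\<integral> e\<^sup>z\<^sup>|\<^sup>s\<^sup>-\<^sup>u\<^sup>| \<nu>(dz)\<close>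
  (\<open>inner_T_spectral\<close>, \<open>covariance_spectral\<close>). Hence \<open>var(S\<^sub>T)\<close> is the \<open>\<nu>\<close>-integral of
  \<open>2 Re ((e\<^sup>z\<^sup>T - 1) / z\<^sup>2) - 2 T Re (1 / z)\<close> (\<open>var_S_spectral\<close>, \<open>time_kernel_eq\<close>). Divided by \<open>T\<close>, the second
  summand contributes \<open>\<varsigma>\<^sup>2\<close>. In the sector \<open>|Re z| \<le> |Im z|\<close> the first summand is compared with its value at
  \<open>i Im z\<close>, which is \<open>T fejer (T Im z)\<close> with \<open>fejer y = 2 (1 - cos y) / y\<^sup>2\<close>. The error of this
  replacement, and the whole summand outside the sector, are bounded by \<open>- 12 Re (1 / z)\<close> and tend to \<open>0\<close>
  pointwise. If \<open>\<varsigma>\<^sup>2\<close> is finite, dominated convergence yields \<open>var(S\<^sub>T) / T = \<varsigma>\<^sup>2 + T W(T) + o(1)\<close>, where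
  \<open>W(T) = \<integral> fejer (T b) \<mu>(db)\<close> and \<open>\<mu>\<close> is the symmetrised image of \<open>\<nu>\<close>, restricted to the sector, under
  the imaginary part (\<open>variance_asymptotics\<close>). By construction \<open>\<mu>[-x, x] = \<nu>(U\<^sub>x)\<close>.

  \<^bold>\<open>Asymptotics of the Fejer transform.\<close> It remains to see that \<open>W(T)\<close> behaves like \<open>T\<^sup>\<alpha>\<^sup>-\<^sup>2 h(T)\<close> if and
  only if \<open>\<mu>[-x, x]\<close> behaves like \<open>C(\<alpha>) x\<^sup>2\<^sup>-\<^sup>\<alpha> h(1/x)\<close> (\<open>fejer_transform_asymp_iff\<close>). For the
  Tauberian direction, consider the probability law proportional to \<open>fejer (T b) \<mu>(db)\<close>, rescaled by \<open>T\<close>.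
  The identity \<open>cos_mult_fejer\<close> expresses its characteristic function through the ratios
  \<open>W(c T) / W(T)\<close>; these converge for each \<open>c\<close> when \<open>W\<close> varies regularly, and the limit is the characteristic
  function of the law with density proportional to \<open>fejer y \<cdot> |y|\<^sup>1\<^sup>-\<^sup>\<alpha>\<close>. Levy's continuity theorem gives weak
  convergence, and testing against \<open>1\<^bsub>[-1, 1]\<^esub> / fejer\<close> recovers the mass of \<open>[-1/T, 1/T]\<close>
  (\<open>tauberian_fejer\<close>). Conversely, if \<open>\<mu>[-x, x]\<close> varies regularly, then \<open>\<mu>\<close> truncated at \<open>R / T\<close> and
  rescaled converges weakly to a power law, and the quadratic decay of the kernel makes the
  contribution of \<open>|b| > R / T\<close> uniformly small for large \<open>R\<close> (\<open>abelian_fejer\<close>). The constant \<open>C(\<alpha>)\<close> is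
  the integral of \<open>|y|\<^sup>1\<^sup>-\<^sup>\<alpha>\<close> over \<open>[-1, 1]\<close> divided by that of \<open>fejer y \<cdot> |y|\<^sup>1\<^sup>-\<^sup>\<alpha>\<close> over the line.

  The equivalence of (i) and (ii) is the case \<open>\<alpha> = 1\<close>, \<open>h = K\<close>, as \<open>C(1) = 1 / \<pi>\<close>. In the superlinear case
  \<open>var(S\<^sub>T) / T\<close> diverges, so that \<open>\<varsigma>\<^sup>2\<close> is negligible and \<open>var(S\<^sub>T)\<close> is asymptotic to \<open>T\<^sup>2 W(T)\<close>.

  \<^bold>\<open>The exponential moments.\<close> A spectral resolution \<open>E\<close> of the generator \<open>L\<close> describes its domain and its
  quadratic form; the semigroup is recovered from these data as follows. For a set \<open>B\<close> of radius \<open>\<delta>\<close>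
  around \<open>z\<^sub>0\<close>, the range of \<open>E(B)\<close> lies in the domain of \<open>L\<close>, is invariant under \<open>L\<close>, and \<open>L - z\<^sub>0\<close> has norm
  at most \<open>2 \<delta>\<close> there, by polarisation (\<open>in_range_generator\<close>, \<open>generator_near_scalar\<close>). Therefore \<open>T\<^sub>t\<close> preserves
  this range and acts on it as \<open>e\<^sup>z\<^sup>0\<^sup>t\<close> up to an error of order \<open>\<delta> t\<close> (\<open>in_range_T\<close>, \<open>inner_T_near_exp\<close>).
  Dissipativity confines \<open>\<nu>\<close> to the left half-plane, and the sum over a partition of the half-plane
  into such sets converges to \<open>\<integral> e\<^sup>z\<^sup>t \<nu>(dz)\<close> as \<open>\<delta>\<close> tends to \<open>0\<close>. That the transition operators form a
  contraction semigroup follows from stationarity and the Markov property (\<open>markov_inner\<close>).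
\<close>

section \<open>Euler integrals\<close>

lemma nn_integral_square_substitution:
  fixes f :: "real \<Rightarrow> ennreal"
  assumes [measurable]: "f \<in> borel_measurable borel"
  shows "(\<integral>\<^sup>+y\<in>{0..}. f y \<partial>lborel) = (\<integral>\<^sup>+x\<in>{0..}. f (x\<^sup>2) * ennreal (2 * x) \<partial>lborel)"
proof -
  have cover: "(\<integral>\<^sup>+x\<in>{0..}. h x \<partial>lborel) = (SUP n. \<integral>\<^sup>+x\<in>{0..c n}. h x \<partial>lborel)"
    if [measurable]: "h \<in> borel_measurable borel" and c: "incseq c" "\<And>n. real n \<le> c n"
    for h :: "real \<Rightarrow> ennreal" and c :: "nat \<Rightarrow> real"
  proof -
    have eq: "(SUP n. h x * indicator {0..c n} x) = h x * indicator {0..} x" for x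
    proof -
      obtain n :: nat where "x \<le> n" using real_arch_simple by blast
      then have "x \<le> c n" using c(2)[of n] by linarith
      then have "h x * indicator {0..c n} x = h x * indicator {0..} x"
        by (auto simp: indicator_def)
      then show ?thesis
        by (intro antisym SUP_least SUP_upper2[of n]) (auto simp: indicator_def)
    qed
    have "(\<integral>\<^sup>+x. (SUP n. h x * indicator {0..c n} x) \<partial>lborel) = (SUP n. \<integral>\<^sup>+x\<in>{0..c n}. h x \<partial>lborel)"
      using c(1) by (intro nn_integral_monotone_convergence_SUP)
        (auto simp: incseq_def le_fun_def indicator_def intro: order_trans)
    then show ?thesis by (simp add: eq)
  qed
  have sub: "(\<integral>\<^sup>+y\<in>{0..(real (Suc n))\<^sup>2}. f y \<partial>lborel) = (\<integral>\<^sup>+x\<in>{0..real (Suc n)}. f (x\<^sup>2) * ennreal (2 * x) \<partial>lborel)" for n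
  proof -
    have "((\<lambda>x. x\<^sup>2) has_real_derivative 2 * x) (at x)" for x :: real
      by (auto intro!: derivative_eq_intros)
    then show ?thesis
      using nn_integral_substitution_aux[of f 0 "real (Suc n)" "\<lambda>x. x\<^sup>2" "\<lambda>x. 2 * x"]
      by (auto intro!: continuous_intros)
  qed
  have "real n \<le> (1 + real n)\<^sup>2" for n :: nat
    by (simp add: power2_eq_square algebra_simps)
  then have "(\<integral>\<^sup>+y\<in>{0..}. f y \<partial>lborel) = (SUP n. \<integral>\<^sup>+y\<in>{0..(real (Suc n))\<^sup>2}. f y \<partial>lborel)"
    by (intro cover) (auto simp: incseq_def power_mono)
  also have "\<dots> = (SUP n. \<integral>\<^sup>+x\<in>{0..real (Suc n)}. f (x\<^sup>2) * ennreal (2 * x) \<partial>lborel)"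
    by (simp only: sub)
  also have "\<dots> = (\<integral>\<^sup>+x\<in>{0..}. f (x\<^sup>2) * ennreal (2 * x) \<partial>lborel)"
    by (intro cover[symmetric]) (auto simp: incseq_def)
  finally show ?thesis .
qed

lemma nn_integral_Gamma_scaled:
  fixes s u :: real
  assumes s: "s > 0" and u: "u > 0"
  shows "(\<integral>\<^sup>+t\<in>{0..}. ennreal (t powr (s - 1) * exp (- u * t)) \<partial>lborel) = ennreal (Gamma s * u powr (- s))"
proof -
  have "ennreal (Gamma s) = (\<integral>\<^sup>+t. ennreal (indicator {0..} t * t powr (s - 1) / exp t) \<partial>lborel)"
    by (rule Gamma_conv_nn_integral_real[OF s])
  also have "\<dots> = ennreal u * (\<integral>\<^sup>+t. ennreal (indicator {0..} (u * t) * (u * t) powr (s - 1) / exp (u * t)) \<partial>lborel)"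
    using u by (subst nn_integral_real_affine[where c=u and t=0]) auto
  also have "\<dots> = (\<integral>\<^sup>+t. ennreal (u powr s) * (ennreal (t powr (s - 1) * exp (- u * t)) * indicator {0..} t) \<partial>lborel)"
    using u by (subst nn_integral_cmult[symmetric])
      (auto intro!: nn_integral_cong simp: indicator_def powr_mult zero_le_mult_iff powr_diff exp_minus
         field_simps ennreal_mult'[symmetric] powr_minus split: if_splits)
  also have "\<dots> = ennreal (u powr s) * (\<integral>\<^sup>+t\<in>{0..}. ennreal (t powr (s - 1) * exp (- u * t)) \<partial>lborel)"
    by (subst nn_integral_cmult) auto
  finally have "ennreal (u powr (-s)) * ennreal (Gamma s) = ennreal (u powr (-s)) * ennreal (u powr s) * (\<integral>\<^sup>+t\<in>{0..}. ennreal (t powr (s - 1) * exp (- u * t)) \<partial>lborel)"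
    by (simp add: mult.assoc)
  moreover have "ennreal (u powr (-s)) * ennreal (u powr s) = 1"
    using u by (simp add: ennreal_mult'[symmetric] powr_add[symmetric])
  ultimately show ?thesis
    using s by (simp add: ennreal_mult'[symmetric] mult.commute Gamma_real_pos less_imp_le)
qed

lemma numeral_mult_ennreal: "numeral n * ennreal x = ennreal (numeral n * x)"
  using ennreal_mult'[of "numeral n" x] by simp

lemma Gamma_reflection_real:
  fixes x :: real
  assumes "0 < x" "x < 1"
  shows "Gamma x * Gamma (1 - x) = pi / sin (pi * x)"
proof -
  have "complex_of_real (Gamma x * Gamma (1 - x)) = Gamma (of_real x) * Gamma (1 - of_real x)"
    using Gamma_complex_of_real[of x] Gamma_complex_of_real[of "1 - x"] by simp
  also have "\<dots> = of_real pi / sin (of_real pi * of_real x)"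
    by (rule Gamma_reflection_complex)
  also have "\<dots> = complex_of_real (pi / sin (pi * x))"
    by (simp flip: sin_of_real)
  finally show ?thesis by (simp only: of_real_eq_iff)
qed

text \<open>
  After the substitution \<open>y = x\<^sup>2\<close> and the expansion of \<open>1 / (1 + y)\<close> as a Laplace integral, Tonelli's
  theorem leaves the product \<open>\<Gamma>(a/2) \<Gamma>(1 - a/2) / 2\<close>, which the reflection formula evaluates.
\<close>

lemma nn_integral_powr_over_one_plus_square:
  fixes a :: real
  assumes a: "0 < a" "a < 2"
  shows "(\<integral>\<^sup>+x\<in>{0..}. ennreal (x powr (a - 1) / (1 + x\<^sup>2)) \<partial>lborel) = ennreal (pi / (2 * sin (pi * a / 2)))"
proof -
  define I where "I = (\<integral>\<^sup>+x\<in>{0..}. ennreal (x powr (a - 1) / (1 + x\<^sup>2)) \<partial>lborel)"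
  have "2 * I = (\<integral>\<^sup>+x\<in>{0..}. ennreal ((x\<^sup>2) powr (a / 2 - 1) / (1 + x\<^sup>2)) * ennreal (2 * x) \<partial>lborel)"
    unfolding I_def
  proof (subst nn_integral_cmult[symmetric]; (intro nn_integral_cong)?)
    fix x :: real
    show "2 * (ennreal (x powr (a - 1) / (1 + x\<^sup>2)) * indicator {0..} x) =
         ennreal ((x\<^sup>2) powr (a / 2 - 1) / (1 + x\<^sup>2)) * ennreal (2 * x) * indicator {0..} x"
    proof (cases "x > 0")
      case True
      have "(x\<^sup>2) powr (a / 2 - 1) = (x powr 2) powr (a / 2 - 1)"
        using True by (simp add: powr_numeral)
      also have "\<dots> = x powr (a - 2)"
        by (simp add: powr_powr algebra_simps)
      finally have "(x\<^sup>2) powr (a / 2 - 1) * (2 * x) = 2 * x powr (a - 1)"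
        using True by (simp add: powr_diff powr_numeral field_simps power2_eq_square)
      then show ?thesis using True
        by (simp add: indicator_def ennreal_mult'[symmetric] mult.assoc flip: ennreal_numeral)
    qed (auto simp: indicator_def)
  qed auto
  also have "\<dots> = (\<integral>\<^sup>+y\<in>{0..}. ennreal (y powr (a / 2 - 1) / (1 + y)) \<partial>lborel)"
    by (rule nn_integral_square_substitution[symmetric]) auto
  \<comment> \<open>expand \<open>1 / (1 + y)\<close> as the Laplace integral \<open>\<integral>\<^sub>0\<^sup>\<infinity> e\<^sup>-\<^sup>(\<^sup>1\<^sup>+\<^sup>y\<^sup>)\<^sup>v dv\<close>\<close>
  also have "\<dots> = (\<integral>\<^sup>+y. \<integral>\<^sup>+v. ennreal (y powr (a/2 - 1) * exp (- (1 + y) * v)) * indicator {0..} y * indicator {0..} v \<partial>lborel \<partial>lborel)"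
  proof (intro nn_integral_cong)
    fix y :: real
    show "ennreal (y powr (a / 2 - 1) / (1 + y)) * indicator {0..} y
      = (\<integral>\<^sup>+v. ennreal (y powr (a/2 - 1) * exp (- (1 + y) * v)) * indicator {0..} y * indicator {0..} v \<partial>lborel)"
    proof (cases "y \<ge> 0")
      case True
      have "(\<integral>\<^sup>+v\<in>{0..}. ennreal (exp (- (1 + y) * v)) \<partial>lborel) = (\<integral>\<^sup>+v\<in>{0..}. ennreal (v powr (1 - 1) * exp (- (1 + y) * v)) \<partial>lborel)"
        by (intro nn_integral_cong_AE AE_I[of _ _ "{0}"]) auto
      also have "\<dots> = ennreal (1 / (1 + y))"
        using True by (subst nn_integral_Gamma_scaled) (auto simp: powr_minus divide_simps)
      finally have *: "(\<integral>\<^sup>+v\<in>{0..}. ennreal (exp (- (1 + y) * v)) \<partial>lborel) = ennreal (1 / (1 + y))" .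
      have "(\<integral>\<^sup>+v. ennreal (y powr (a/2 - 1) * exp (- (1 + y) * v)) * indicator {0..} y * indicator {0..} v \<partial>lborel)
        = ennreal (y powr (a/2 - 1)) * (\<integral>\<^sup>+v\<in>{0..}. ennreal (exp (- (1 + y) * v)) \<partial>lborel)"
        using True by (subst nn_integral_cmult[symmetric]) (auto simp: ennreal_mult mult.assoc)
      then show ?thesis using True by (simp only: *) (simp add: ennreal_mult'[symmetric])
    qed (auto simp: indicator_def)
  qed
  also have "\<dots> = (\<integral>\<^sup>+v. \<integral>\<^sup>+y. ennreal (y powr (a/2 - 1) * exp (- (1 + y) * v)) * indicator {0..} y * indicator {0..} v \<partial>lborel \<partial>lborel)"
    by (rule lborel_pair.Fubini') measurable
  also have "\<dots> = (\<integral>\<^sup>+v. ennreal (Gamma (a/2)) * (ennreal (v powr ((1 - a/2) - 1) * exp (- 1 * v)) * indicator {0..} v) \<partial>lborel)"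
  proof (intro nn_integral_cong_AE AE_I[of _ _ "{0}"] subsetI, rule ccontr)
    fix v :: real
    assume v: "v \<in> {v \<in> space lborel. (\<integral>\<^sup>+y. ennreal (y powr (a/2 - 1) * exp (- (1 + y) * v)) * indicator {0..} y * indicator {0..} v \<partial>lborel)
       \<noteq> ennreal (Gamma (a/2)) * (ennreal (v powr ((1 - a/2) - 1) * exp (- 1 * v)) * indicator {0..} v)}"
      and "v \<notin> {0}"
    moreover have "v < 0 \<Longrightarrow> False" using v by (simp add: indicator_def)
    ultimately have pos: "v > 0" by force
    have "(\<integral>\<^sup>+y. ennreal (y powr (a/2 - 1) * exp (- (1 + y) * v)) * indicator {0..} y * indicator {0..} v \<partial>lborel)
      = ennreal (exp (- v)) * (\<integral>\<^sup>+y\<in>{0..}. ennreal (y powr (a/2 - 1) * exp (- v * y)) \<partial>lborel)"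
      using pos by (subst nn_integral_cmult[symmetric])
        (auto intro!: nn_integral_cong simp: ennreal_mult'[symmetric] indicator_def algebra_simps exp_add[symmetric])
    also have "\<dots> = ennreal (exp (- v)) * ennreal (Gamma (a/2) * v powr (- (a/2)))"
      using a pos by (subst nn_integral_Gamma_scaled) auto
    finally show False using v pos a
      by (simp add: ennreal_mult'[symmetric] Gamma_real_pos mult_ac less_imp_le)
  qed auto
  also have "\<dots> = ennreal (Gamma (a/2)) * ennreal (Gamma (1 - a/2) * 1 powr (- (1 - a/2)))"
    using a by (subst nn_integral_cmult, simp, subst nn_integral_Gamma_scaled) auto
  also have "\<dots> = ennreal (pi / sin (pi * a / 2))"
    using a Gamma_reflection_real[of "a/2"]
    by (simp add: ennreal_mult'[symmetric] Gamma_real_pos less_imp_le)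
  finally have "2 * I = ennreal (pi / sin (pi * a / 2))" .
  also have "\<dots> = 2 * ennreal (pi / (2 * sin (pi * a / 2)))"
    by (simp add: numeral_mult_ennreal)
  finally show ?thesis unfolding I_def[symmetric] by (simp add: ennreal_mult_cancel_left)
qed

section \<open>The Fejer kernel\<close>

text \<open>
  The square of the sinc function, up to scaling the Fejer kernel of Fourier analysis. For the
  purely imaginary point \<open>z = i b\<close> the double time integral of \<open>Re e\<^sup>z\<^sup>|\<^sup>s\<^sup>-\<^sup>u\<^sup>|\<close> over \<open>[0, T]\<^sup>2\<close> is
  \<open>T\<^sup>2\<close> times its value at \<open>b T\<close>.
\<close>

definition fejer :: "real \<Rightarrow> real" where
  "fejer y = (if y = 0 then 1 else 2 * (1 - cos y) / y\<^sup>2)"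

lemma square_mult_fejer: "y\<^sup>2 * fejer y = 2 * (1 - cos y)"
  by (simp add: fejer_def)

lemma fejer_eq_sinc: "fejer y = (sinc (y / 2))\<^sup>2"
  using cos_double_sin[of "y / 2"] by (simp add: fejer_def power_divide)

lemma isCont_fejer [simp]: "isCont fejer y"
proof -
  have "isCont (\<lambda>y. (sinc (y / 2))\<^sup>2) y"
    by (intro continuous_intros isCont_o2[OF _ isCont_sinc]) auto
  then show ?thesis by (simp only: fejer_eq_sinc[abs_def])
qed

lemma borel_measurable_fejer [measurable]: "fejer \<in> borel_measurable borel"
  by (intro borel_measurable_continuous_onI continuous_at_imp_continuous_on ballI isCont_fejer)

lemma fejer_nonneg [simp]: "0 \<le> fejer y"
  by (simp add: fejer_def)

lemma fejer_le_1: "fejer y \<le> 1"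
proof -
  have "\<bar>sinc (y / 2)\<bar> \<le> 1"
    using abs_sin_le_one[of "y/2"] abs_sin_x_le_abs_x[of "y/2"] by (auto simp: field_simps)
  then show ?thesis unfolding fejer_eq_sinc by (simp add: abs_square_le_1)
qed

lemma fejer_le_inverse_square: "y \<noteq> 0 \<Longrightarrow> fejer y \<le> 4 / y\<^sup>2"
  using cos_ge_minus_one[of y] unfolding fejer_def by (simp add: divide_right_mono del: cos_ge_minus_one)

lemma fejer_minus [simp]: "fejer (- y) = fejer y"
  by (simp add: fejer_def)

lemma fejer_abs [simp]: "fejer \<bar>y\<bar> = fejer y"
  by (simp add: abs_if)

lemma fejer_pos: "\<bar>y\<bar> \<le> 1 \<Longrightarrow> 0 < fejer y"
proof -
  assume y: "\<bar>y\<bar> \<le> 1"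
  have "fejer y \<noteq> 0"
  proof
    assume "fejer y = 0"
    then have "y \<noteq> 0" and cos: "cos \<bar>y\<bar> = cos 0" by (auto simp: fejer_def split: if_splits)
    have "\<bar>y\<bar> \<le> pi" using y pi_gt3 by linarith
    then have "\<bar>y\<bar> = 0"
      by (rule cos_inj_pi[OF abs_ge_zero _ order_refl pi_ge_zero cos])
    with \<open>y \<noteq> 0\<close> show False by simp
  qed
  then show ?thesis using fejer_nonneg[of y] by linarith
qed

text \<open>
  The kernel is a second difference of the cosine, hence multiplying it by \<open>cos (s y)\<close> is the same as
  taking a second difference in the scaling parameter. Consequently Fourier transforms against the
  kernel are determined by integrals of rescaled copies of the kernel itself.
\<close>

lemma cos_mult_fejer:
  "2 * cos (s * y) * fejer y
    = (s + 1)\<^sup>2 * fejer ((s + 1) * y) + (s - 1)\<^sup>2 * fejer ((s - 1) * y) - 2 * (s\<^sup>2 * fejer (s * y))"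
proof (cases "y = 0")
  case True
  then show ?thesis by (simp add: fejer_def power2_eq_square algebra_simps)
next
  case False
  have *: "c\<^sup>2 * fejer (c * y) = 2 * (1 - cos (c * y)) / y\<^sup>2" for c
    using False square_mult_fejer[of "c * y"] by (simp add: power_mult_distrib field_simps)
  have "cos ((s + 1) * y) + cos ((s - 1) * y) = 2 * cos (s * y) * cos y"
    by (simp add: distrib_right left_diff_distrib cos_add cos_diff)
  then have "2 * (1 - cos ((s + 1) * y)) + 2 * (1 - cos ((s - 1) * y)) - 2 * (2 * (1 - cos (s * y)))
      = 2 * cos (s * y) * (2 * (1 - cos y))"
    by (simp add: algebra_simps)
  moreover have "2 * cos (s * y) * fejer y = 2 * cos (s * y) * (2 * (1 - cos y)) / y\<^sup>2"
    using False by (simp add: fejer_def)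
  ultimately have "2 * cos (s * y) * fejer y = (2 * (1 - cos ((s + 1) * y)) + 2 * (1 - cos ((s - 1) * y)) - 2 * (2 * (1 - cos (s * y)))) / y\<^sup>2"
    by simp
  then show ?thesis
    unfolding * by (simp only: add_divide_distrib diff_divide_distrib times_divide_eq_right)
qed

lemma Laplace_one_minus_cos:
  fixes u :: real
  assumes u: "u > 0"
  shows "(\<integral>\<^sup>+y\<in>{0..}. ennreal ((1 - cos y) * exp (- u * y)) \<partial>lborel) = ennreal (1 / (u * (1 + u\<^sup>2)))"
proof -
  \<comment> \<open>an antiderivative of \<open>(1 - cos y) e\<^sup>-\<^sup>u\<^sup>y\<close> that vanishes at infinity\<close>
  define F where "F = (\<lambda>y. - exp (- u * y) / u - exp (- u * y) * (sin y - u * cos y) / (1 + u\<^sup>2))"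
  have nz: "1 + u\<^sup>2 \<noteq> 0" by (smt (verit) zero_le_power2)
  have "(\<integral>\<^sup>+y. ennreal ((1 - cos y) * exp (- u * y)) * indicator {0..} y \<partial>lborel) = ennreal (0 - F 0)"
  proof (rule nn_integral_FTC_atLeast)
    fix y :: real
    have "((\<lambda>y. exp (- u * y) * (sin y - u * cos y)) has_real_derivative
        exp (- u * y) * (cos y + u * sin y) - u * exp (- u * y) * (sin y - u * cos y)) (at y)"
      by (auto intro!: derivative_eq_intros simp: algebra_simps)
    then have "((\<lambda>y. exp (- u * y) * (sin y - u * cos y) / (1 + u\<^sup>2)) has_real_derivative
        (exp (- u * y) * (cos y + u * sin y) - u * exp (- u * y) * (sin y - u * cos y)) / (1 + u\<^sup>2)) (at y)"
      by (rule DERIV_cdivide)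
    moreover have "((\<lambda>y. - exp (- u * y) / u) has_real_derivative exp (- u * y)) (at y)"
      using u by (auto intro!: derivative_eq_intros)
    ultimately have "(F has_real_derivative exp (- u * y)
        - (exp (- u * y) * (cos y + u * sin y) - u * exp (- u * y) * (sin y - u * cos y)) / (1 + u\<^sup>2)) (at y)"
      unfolding F_def by (rule DERIV_diff[rotated])
    also have "exp (- u * y) * (cos y + u * sin y) - u * exp (- u * y) * (sin y - u * cos y)
        = exp (- u * y) * cos y * (1 + u\<^sup>2)"
      by (simp add: algebra_simps power2_eq_square)
    finally show "(F has_real_derivative (1 - cos y) * exp (- u * y)) (at y)"
      unfolding nonzero_mult_div_cancel_right[OF nz] by (simp add: algebra_simps)
  next
    have e: "((\<lambda>y. exp (- u * y)) \<longlongrightarrow> 0) at_top"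
      using u by (intro filterlim_compose[OF exp_at_bot] filterlim_tendsto_neg_mult_at_bot[OF tendsto_const])
         (auto simp: filterlim_ident)
    show "(F \<longlongrightarrow> 0) at_top"
    proof (rule Lim_null_comparison[where g="\<lambda>y. (1 / u + (1 + u)) * exp (- u * y)"])
      show "((\<lambda>y. (1 / u + (1 + u)) * exp (- u * y)) \<longlongrightarrow> 0) at_top"
        by (rule tendsto_mult_right_zero[OF e])
      show "\<forall>\<^sub>F y in at_top. norm (F y) \<le> (1 / u + (1 + u)) * exp (- u * y)"
      proof (intro always_eventually allI)
        fix y
        have "\<bar>sin y - u * cos y\<bar> \<le> \<bar>sin y\<bar> + u * \<bar>cos y\<bar>"
          using u by (simp add: abs_mult order_trans[OF abs_triangle_ineq4])
        also have "\<dots> \<le> 1 + u * 1"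
          using u by (intro add_mono mult_left_mono) auto
        finally have 1: "\<bar>sin y - u * cos y\<bar> \<le> 1 + u" by simp
        have "norm (F y) \<le> exp (- u * y) / u + exp (- u * y) * \<bar>sin y - u * cos y\<bar> / (1 + u\<^sup>2)"
          unfolding F_def real_norm_def using u
          by (intro order_trans[OF abs_triangle_ineq4] add_mono) (auto simp: abs_mult)
        also have "\<dots> \<le> exp (- u * y) / u + exp (- u * y) * (1 + u) / 1"
          using 1 u by (intro add_mono frac_le mult_left_mono mult_nonneg_nonneg) auto
        finally show "norm (F y) \<le> (1 / u + (1 + u)) * exp (- u * y)"
          by (simp add: algebra_simps)
      qed
    qed
  qed auto
  also have "0 - F 0 = 1 / (u * (1 + u\<^sup>2))"
    using u nz by (simp add: F_def field_simps power2_eq_square)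
  finally show ?thesis .
qed

text \<open>
  This integral produces the constant \<open>C(\<alpha>)\<close>. The singular power \<open>y\<^sup>-\<^sup>(\<^sup>1\<^sup>+\<^sup>\<alpha>\<^sup>)\<close> is a Gamma integral of
  exponentials; exchanging the order of integration leaves the Laplace transform of \<open>1 - cos\<close>
  and then the integral of \<open>u\<^sup>\<alpha>\<^sup>-\<^sup>1 / (1 + u\<^sup>2)\<close>.
\<close>

lemma nn_integral_fejer_powr:
  fixes \<alpha> :: real
  assumes a: "0 < \<alpha>" "\<alpha> < 2"
  shows "(\<integral>\<^sup>+y\<in>{0..}. ennreal (fejer y * y powr (1 - \<alpha>)) \<partial>lborel)
     = ennreal (pi / (Gamma (1 + \<alpha>) * sin (\<alpha> * pi / 2)))"
proof -
  define G where "G = Gamma (1 + \<alpha>)"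
  have G: "G > 0" using a by (simp add: G_def Gamma_real_pos)
  have "ennreal G * (\<integral>\<^sup>+y\<in>{0..}. ennreal (fejer y * y powr (1 - \<alpha>)) \<partial>lborel)
     = (\<integral>\<^sup>+y. \<integral>\<^sup>+u. ennreal (2 * (1 - cos y) * exp (- u * y) * u powr \<alpha>) * indicator {0..} y * indicator {0..} u \<partial>lborel \<partial>lborel)"
  proof (subst nn_integral_cmult[symmetric])
    show "(\<integral>\<^sup>+y. ennreal G * (ennreal (fejer y * y powr (1 - \<alpha>)) * indicator {0..} y) \<partial>lborel)
      = (\<integral>\<^sup>+y. \<integral>\<^sup>+u. ennreal (2 * (1 - cos y) * exp (- u * y) * u powr \<alpha>) * indicator {0..} y * indicator {0..} u \<partial>lborel \<partial>lborel)"
    proof (intro nn_integral_cong_AE AE_I[of _ _ "{0}"] subsetI, rule ccontr)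
      fix y :: real
      assume y: "y \<in> {y \<in> space lborel. ennreal G * (ennreal (fejer y * y powr (1 - \<alpha>)) * indicator {0..} y)
         \<noteq> (\<integral>\<^sup>+u. ennreal (2 * (1 - cos y) * exp (- u * y) * u powr \<alpha>) * indicator {0..} y * indicator {0..} u \<partial>lborel)}"
        and "y \<notin> {0}"
      moreover have "y < 0 \<Longrightarrow> False" using y by (simp add: indicator_def)
      ultimately have pos: "y > 0" by force
      have "(\<integral>\<^sup>+u. ennreal (2 * (1 - cos y) * exp (- u * y) * u powr \<alpha>) * indicator {0..} y * indicator {0..} u \<partial>lborel)
        = (\<integral>\<^sup>+u. ennreal (2 * (1 - cos y)) * (ennreal (u powr ((1 + \<alpha>) - 1) * exp (- y * u)) * indicator {0..} u) \<partial>lborel)"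
        using pos by (intro nn_integral_cong) (auto simp: ennreal_mult'[symmetric] indicator_def mult_ac)
      also have "\<dots> = ennreal (2 * (1 - cos y)) * ennreal (G * y powr (- (1 + \<alpha>)))"
        unfolding G_def using a pos by (subst nn_integral_cmult, simp, subst nn_integral_Gamma_scaled) auto
      also have "\<dots> = ennreal G * ennreal (2 * (1 - cos y) * y powr (- (1 + \<alpha>)))"
        using G by (simp add: ennreal_mult'[symmetric] mult_ac)
      also have "2 * (1 - cos y) * y powr (- (1 + \<alpha>)) = fejer y * y powr (1 - \<alpha>)"
        using pos by (simp add: fejer_def powr_diff powr_minus powr_add field_simps power2_eq_square)
      finally show False using y pos by simp
    qed auto
  qed auto
  also have "\<dots> = (\<integral>\<^sup>+u. \<integral>\<^sup>+y. ennreal (2 * (1 - cos y) * exp (- u * y) * u powr \<alpha>) * indicator {0..} y * indicator {0..} u \<partial>lborel \<partial>lborel)"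
    by (rule lborel_pair.Fubini') measurable
  also have "\<dots> = (\<integral>\<^sup>+u. 2 * (ennreal (u powr (\<alpha> - 1) / (1 + u\<^sup>2)) * indicator {0..} u) \<partial>lborel)"
  proof (intro nn_integral_cong_AE AE_I[of _ _ "{0}"] subsetI, rule ccontr)
    fix u :: real
    assume u: "u \<in> {u \<in> space lborel. (\<integral>\<^sup>+y. ennreal (2 * (1 - cos y) * exp (- u * y) * u powr \<alpha>) * indicator {0..} y * indicator {0..} u \<partial>lborel)
       \<noteq> 2 * (ennreal (u powr (\<alpha> - 1) / (1 + u\<^sup>2)) * indicator {0..} u)}" and "u \<notin> {0}"
    moreover have "u < 0 \<Longrightarrow> False" using u by (simp add: indicator_def)
    ultimately have pos: "u > 0" by force
    have "(\<integral>\<^sup>+y. ennreal (2 * (1 - cos y) * exp (- u * y) * u powr \<alpha>) * indicator {0..} y * indicator {0..} u \<partial>lborel)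
      = (\<integral>\<^sup>+y. ennreal (2 * u powr \<alpha>) * (ennreal ((1 - cos y) * exp (- u * y)) * indicator {0..} y) \<partial>lborel)"
      using pos by (intro nn_integral_cong) (auto simp: ennreal_mult'[symmetric] indicator_def mult_ac)
    also have "\<dots> = ennreal (2 * u powr \<alpha>) * ennreal (1 / (u * (1 + u\<^sup>2)))"
      using pos by (subst nn_integral_cmult, simp, subst Laplace_one_minus_cos) auto
    also have "\<dots> = ennreal (2 * (u powr (\<alpha> - 1) / (1 + u\<^sup>2)))"
      using pos by (simp add: ennreal_mult'[symmetric] powr_diff)
    also have "\<dots> = 2 * ennreal (u powr (\<alpha> - 1) / (1 + u\<^sup>2))"
      by (simp only: numeral_mult_ennreal)
    finally show False using u pos by simp
  qed auto
  also have "\<dots> = 2 * ennreal (pi / (2 * sin (pi * \<alpha> / 2)))"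
    using a by (subst nn_integral_cmult, simp, subst nn_integral_powr_over_one_plus_square) auto
  also have "\<dots> = ennreal (pi / sin (\<alpha> * pi / 2))"
    by (simp add: numeral_mult_ennreal mult.commute[of \<alpha>])
  finally have "ennreal G * (\<integral>\<^sup>+y\<in>{0..}. ennreal (fejer y * y powr (1 - \<alpha>)) \<partial>lborel) = ennreal (pi / sin (\<alpha> * pi / 2))" .
  then have "ennreal (1 / G) * ennreal G * (\<integral>\<^sup>+y\<in>{0..}. ennreal (fejer y * y powr (1 - \<alpha>)) \<partial>lborel)
    = ennreal (1 / G) * ennreal (pi / sin (\<alpha> * pi / 2))"
    by (simp add: mult.assoc)
  moreover have "ennreal (1 / G) * ennreal G = 1"
    using G by (simp flip: ennreal_mult')
  ultimately show ?thesis
    using G by (simp add: ennreal_mult'[symmetric] G_def)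
qed

section \<open>The limit law with density proportional to the Fejer kernel and a power\<close>

lemma nn_integral_even:
  fixes f :: "real \<Rightarrow> ennreal"
  assumes [measurable]: "f \<in> borel_measurable borel" and even: "\<And>y. f (- y) = f y"
  shows "(\<integral>\<^sup>+y. f y \<partial>lborel) = 2 * (\<integral>\<^sup>+y\<in>{0..}. f y \<partial>lborel)"
proof -
  have "(\<integral>\<^sup>+y\<in>{..<0}. f y \<partial>lborel) = (\<integral>\<^sup>+y. f (- y) * indicator {..<0} (- y) \<partial>lborel)"
    by (subst nn_integral_real_affine[where c="-1" and t=0]) auto
  also have "\<dots> = (\<integral>\<^sup>+y\<in>{0..}. f y \<partial>lborel)"
    by (intro nn_integral_cong_AE AE_I[of _ _ "{0}"]) (auto simp: even indicator_def)
  finally have neg: "(\<integral>\<^sup>+y\<in>{..<0}. f y \<partial>lborel) = (\<integral>\<^sup>+y\<in>{0..}. f y \<partial>lborel)" .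
  have "(\<integral>\<^sup>+y. f y \<partial>lborel) = (\<integral>\<^sup>+y. f y * indicator {..<0} y + f y * indicator {0..} y \<partial>lborel)"
    by (intro nn_integral_cong) (auto simp: indicator_def)
  also have "\<dots> = (\<integral>\<^sup>+y\<in>{..<0}. f y \<partial>lborel) + (\<integral>\<^sup>+y\<in>{0..}. f y \<partial>lborel)"
    by (intro nn_integral_add) auto
  finally show ?thesis by (simp add: neg mult_2)
qed

definition fejer_mass :: "real \<Rightarrow> real" where
  "fejer_mass \<alpha> = 2 * pi / (Gamma (1 + \<alpha>) * sin (\<alpha> * pi / 2))"

lemma fejer_mass_pos:
  assumes "0 < \<alpha>" "\<alpha> < 2"
  shows "0 < fejer_mass \<alpha>"
proof -
  have "\<alpha> * pi < 2 * pi"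
    using assms by (intro mult_strict_right_mono) auto
  then have "0 < sin (\<alpha> * pi / 2)"
    using assms by (intro sin_gt_zero) auto
  then show ?thesis using assms by (simp add: fejer_mass_def Gamma_real_pos)
qed

lemma C_const_eq: "C_const \<alpha> = 2 / (2 - \<alpha>) / fejer_mass \<alpha>"
  by (simp add: C_const_def fejer_mass_def)

lemma C_const_pos: "0 < \<alpha> \<Longrightarrow> \<alpha> < 2 \<Longrightarrow> 0 < C_const \<alpha>"
  by (simp add: C_const_eq fejer_mass_pos)

lemma has_bochner_integral_fejer_powr:
  fixes \<alpha> c :: real
  assumes a: "0 < \<alpha>" "\<alpha> < 2"
  shows "has_bochner_integral lborel (\<lambda>y. c\<^sup>2 * fejer (c * y) * \<bar>y\<bar> powr (1 - \<alpha>)) (\<bar>c\<bar> powr \<alpha> * fejer_mass \<alpha>)"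
proof (cases "c = 0")
  case True
  then show ?thesis by (simp add: has_bochner_integral_zero)
next
  case False
  have "ennreal (fejer_mass \<alpha>) = 2 * ennreal (pi / (Gamma (1 + \<alpha>) * sin (\<alpha> * pi / 2)))"
    by (simp add: numeral_mult_ennreal fejer_mass_def)
  also have "\<dots> = 2 * (\<integral>\<^sup>+y\<in>{0..}. ennreal (fejer y * \<bar>y\<bar> powr (1 - \<alpha>)) \<partial>lborel)"
    by (subst nn_integral_fejer_powr[OF a, symmetric])
       (auto intro!: arg_cong[where f="\<lambda>x. 2 * x"] nn_integral_cong simp: indicator_def)
  also have "\<dots> = (\<integral>\<^sup>+y. ennreal (fejer y * \<bar>y\<bar> powr (1 - \<alpha>)) \<partial>lborel)"
    by (rule nn_integral_even[symmetric]) auto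
  also have "\<dots> = ennreal \<bar>c\<bar> * (\<integral>\<^sup>+y. ennreal (fejer (c * y) * \<bar>c * y\<bar> powr (1 - \<alpha>)) \<partial>lborel)"
    using False by (subst nn_integral_real_affine[where c=c and t=0]) auto
  finally have "ennreal (\<bar>c\<bar> powr \<alpha>) * ennreal (fejer_mass \<alpha>)
      = ennreal (\<bar>c\<bar> powr \<alpha> * \<bar>c\<bar>) * (\<integral>\<^sup>+y. ennreal (fejer (c * y) * \<bar>c * y\<bar> powr (1 - \<alpha>)) \<partial>lborel)"
    by (simp add: ennreal_mult' mult.assoc)
  also have "\<dots> = (\<integral>\<^sup>+y. ennreal (c\<^sup>2 * fejer (c * y) * \<bar>y\<bar> powr (1 - \<alpha>)) \<partial>lborel)"
  proof (subst nn_integral_cmult[symmetric])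
    have "\<bar>c\<bar> powr \<alpha> * \<bar>c\<bar> * \<bar>c\<bar> powr (1 - \<alpha>) = c\<^sup>2"
      using False by (simp add: powr_diff power2_eq_square)
    then have "\<bar>c\<bar> powr \<alpha> * \<bar>c\<bar> * (fejer (c * y) * \<bar>c * y\<bar> powr (1 - \<alpha>)) = c\<^sup>2 * fejer (c * y) * \<bar>y\<bar> powr (1 - \<alpha>)" for y
      by (simp add: abs_mult powr_mult)
    then have "ennreal (\<bar>c\<bar> powr \<alpha> * \<bar>c\<bar>) * ennreal (fejer (c * y) * \<bar>c * y\<bar> powr (1 - \<alpha>))
        = ennreal (c\<^sup>2 * fejer (c * y) * \<bar>y\<bar> powr (1 - \<alpha>))" for y
      by (subst ennreal_mult'[symmetric]) (simp_all only: mult_nonneg_nonneg powr_ge_zero abs_ge_zero)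
    then show "(\<integral>\<^sup>+ y. ennreal (\<bar>c\<bar> powr \<alpha> * \<bar>c\<bar>) * ennreal (fejer (c * y) * \<bar>c * y\<bar> powr (1 - \<alpha>)) \<partial>lborel)
      = (\<integral>\<^sup>+y. ennreal (c\<^sup>2 * fejer (c * y) * \<bar>y\<bar> powr (1 - \<alpha>)) \<partial>lborel)"
      by (simp only:)
  qed auto
  finally show ?thesis
    using fejer_mass_pos[OF a]
    by (intro has_bochner_integral_nn_integral) (auto simp: ennreal_mult')
qed

lemma nn_integral_powr_Icc:
  fixes \<gamma> R :: real
  assumes "\<gamma> > 0" "R \<ge> 0"
  shows "(\<integral>\<^sup>+y\<in>{0..R}. ennreal (y powr (\<gamma> - 1)) \<partial>lborel) = ennreal (R powr \<gamma> / \<gamma>)"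
  using nn_integral_has_integral_lebesgue'[OF _ has_integral_powr_from_0[of "\<gamma> - 1" R]] assms
  by simp

text \<open>
  The only possible limit of the rescaled spectral laws: the spectral distribution of fractional
  Gaussian noise with Hurst index \<open>\<alpha> / 2\<close>.
\<close>

definition fejer_limit :: "real \<Rightarrow> real measure" where
  "fejer_limit \<alpha> = density lborel (\<lambda>y. ennreal (fejer y * \<bar>y\<bar> powr (1 - \<alpha>) / fejer_mass \<alpha>))"

lemma real_distribution_fejer_limit:
  assumes a: "0 < \<alpha>" "\<alpha> < 2"
  shows "real_distribution (fejer_limit \<alpha>)"
proof -
  have "has_bochner_integral lborel (\<lambda>y. fejer y * \<bar>y\<bar> powr (1 - \<alpha>) / fejer_mass \<alpha>) (fejer_mass \<alpha> / fejer_mass \<alpha>)"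
    using has_bochner_integral_fejer_powr[OF a, of 1] by (intro has_bochner_integral_divide_zero) auto
  then have "(\<integral>\<^sup>+y. ennreal (fejer y * \<bar>y\<bar> powr (1 - \<alpha>) / fejer_mass \<alpha>) \<partial>lborel) = 1"
    using fejer_mass_pos[OF a]
    by (subst nn_integral_eq_integral) (auto simp: has_bochner_integral_iff)
  then have "prob_space (fejer_limit \<alpha>)"
    unfolding fejer_limit_def by (intro prob_spaceI) (simp add: emeasure_density)
  then show ?thesis
    by (simp add: real_distribution_def real_distribution_axioms_def fejer_limit_def)
qed

lemma char_eq_cos_integral:
  assumes "real_distribution N" "(\<integral>x. sin (t * x) \<partial>N) = 0"
  shows "char N t = complex_of_real (\<integral>x. cos (t * x) \<partial>N)"
proof -
  interpret real_distribution N by fact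
  have s: "integrable N (\<lambda>x. sin (t * x))" and c: "integrable N (\<lambda>x. cos (t * x))"
    by (auto intro!: integrable_const_bound[where B=1])
  have "char N t = (\<integral>x. complex_of_real (cos (t * x)) + \<i> * complex_of_real (sin (t * x)) \<partial>N)"
    unfolding char_def
    by (intro Bochner_Integration.integral_cong refl)
       (simp add: complex_eq_iff flip: of_real_mult cis_conv_exp)
  also have "\<dots> = complex_of_real (\<integral>x. cos (t * x) \<partial>N)"
    using s c assms(2) by simp
  finally show ?thesis .
qed

text \<open>
  The covariance function of fractional Gaussian noise, obtained from the second difference identity
  and the homogeneity of \<open>c \<mapsto> \<integral> c\<^sup>2 fejer (c y) |y|\<^sup>1\<^sup>-\<^sup>\<alpha> dy\<close>.
\<close>

lemma char_fejer_limit: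
  assumes a: "0 < \<alpha>" "\<alpha> < 2"
  shows "char (fejer_limit \<alpha>) s
     = complex_of_real ((\<bar>s + 1\<bar> powr \<alpha> + \<bar>s - 1\<bar> powr \<alpha> - 2 * \<bar>s\<bar> powr \<alpha>) / 2)"
proof -
  define Z where "Z = fejer_mass \<alpha>"
  have Z: "Z > 0" unfolding Z_def by (rule fejer_mass_pos[OF a])
  define w where "w y = fejer y * \<bar>y\<bar> powr (1 - \<alpha>) / Z" for y
  have w[measurable]: "w \<in> borel_measurable borel" unfolding w_def by simp
  have w0: "0 \<le> w y" for y unfolding w_def using Z by simp
  have lim: "fejer_limit \<alpha> = density lborel w" unfolding fejer_limit_def w_def Z_def ..
  have "(\<integral>x. sin (s * x) \<partial>fejer_limit \<alpha>) = (\<integral>y. w y * sin (s * y) \<partial>lborel)"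
    unfolding lim using w0 by (subst integral_density) auto
  also have "\<dots> = - (\<integral>y. w y * sin (s * y) \<partial>lborel)"
    by (subst lborel_integral_real_affine[where c="-1" and t=0]) (auto simp: w_def)
  also have "(\<integral>y. w y * sin (s * y) \<partial>lborel) = (\<integral>x. sin (s * x) \<partial>fejer_limit \<alpha>)"
    unfolding lim using w0 by (subst integral_density) auto
  finally have odd: "(\<integral>x. sin (s * x) \<partial>fejer_limit \<alpha>) = 0"
    by simp
  let ?p = "\<lambda>c y. c\<^sup>2 * fejer (c * y) * \<bar>y\<bar> powr (1 - \<alpha>)"
  have p: "has_bochner_integral lborel (?p c) (\<bar>c\<bar> powr \<alpha> * Z)" for c
    unfolding Z_def by (rule has_bochner_integral_fejer_powr[OF a])
  have eq: "w y * cos (s * y) = (?p (s + 1) y + ?p (s - 1) y - 2 * ?p s y) / (2 * Z)" for y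
  proof -
    have "2 * Z * (w y * cos (s * y)) = (2 * cos (s * y) * fejer y) * \<bar>y\<bar> powr (1 - \<alpha>)"
      using Z by (simp add: w_def)
    also have "\<dots> = ?p (s + 1) y + ?p (s - 1) y - 2 * ?p s y"
      unfolding cos_mult_fejer by (simp add: algebra_simps)
    finally show ?thesis using Z by (simp add: field_simps)
  qed
  have "(\<integral>x. cos (s * x) \<partial>fejer_limit \<alpha>) = (\<integral>y. w y * cos (s * y) \<partial>lborel)"
    unfolding lim using w0 by (subst integral_density) auto
  also have "\<dots> = (\<bar>s + 1\<bar> powr \<alpha> * Z + \<bar>s - 1\<bar> powr \<alpha> * Z - 2 * (\<bar>s\<bar> powr \<alpha> * Z)) / (2 * Z)"
    unfolding eq
    by (intro has_bochner_integral_integral_eq has_bochner_integral_divide_zero has_bochner_integral_diff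
        has_bochner_integral_add has_bochner_integral_mult_right p)
  also have "\<dots> = (\<bar>s + 1\<bar> powr \<alpha> + \<bar>s - 1\<bar> powr \<alpha> - 2 * \<bar>s\<bar> powr \<alpha>) / 2"
    using Z by (simp add: divide_simps) (simp add: algebra_simps)
  finally show ?thesis
    using char_eq_cos_integral[OF real_distribution_fejer_limit[OF a] odd] by (simp only:)
qed

section \<open>A Tauberian theorem for the Fejer kernel\<close>

definition fejer_transform :: "real measure \<Rightarrow> real \<Rightarrow> real" where
  "fejer_transform \<mu> T = (\<integral>b. fejer (b * T) \<partial>\<mu>)"

context finite_borel_measure
begin

lemma measurable_M [measurable_cong]: "sets M = sets borel"
  by (rule M_is_borel)

lemma space_M [simp]: "space M = UNIV"
  using sets_eq_imp_space_eq[OF M_is_borel] by simp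

lemma integrable_fejer: "integrable M (\<lambda>b. fejer (b * T))"
  using fejer_le_1 by (intro integrable_const_bound[where B=1]) auto

lemma fejer_transform_nonneg: "0 \<le> fejer_transform M T"
  unfolding fejer_transform_def by (rule integral_nonneg_AE) auto

lemma fejer_transform_pos_iff: "0 < fejer_transform M T \<longleftrightarrow> fejer_transform M T \<noteq> 0"
  using fejer_transform_nonneg[of T] by linarith

lemma fejer_transform_abs: "fejer_transform M \<bar>T\<bar> = fejer_transform M T"
  unfolding fejer_transform_def
  by (intro Bochner_Integration.integral_cong refl) (metis abs_mult abs_abs fejer_abs)

text \<open>
  The law of \<open>b T\<close> when \<open>b\<close> is distributed according to \<open>M\<close> reweighted by \<open>w (b T)\<close> and normalised. The
  weight \<open>fejer\<close> serves the Tauberian direction, an indicator function the Abelian one.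
\<close>

definition tilted :: "(real \<Rightarrow> real) \<Rightarrow> real \<Rightarrow> real measure" where
  "tilted w T = distr (density M (\<lambda>b. ennreal (w (b * T) / (\<integral>b. w (b * T) \<partial>M)))) borel (\<lambda>b. b * T)"

lemma integral_tilted:
  fixes f w :: "real \<Rightarrow> real"
  assumes [measurable]: "f \<in> borel_measurable borel" "w \<in> borel_measurable borel" and w: "\<And>y. 0 \<le> w y"
  shows "(\<integral>y. f y \<partial>tilted w T) = (\<integral>b. f (b * T) * w (b * T) \<partial>M) / (\<integral>b. w (b * T) \<partial>M)"
proof -
  have "0 \<le> (\<integral>b. w (b * T) \<partial>M)"
    using w by (intro integral_nonneg_AE) auto
  then have "(\<integral>b. f (b * T) \<partial>density M (\<lambda>b. ennreal (w (b * T) / (\<integral>b. w (b * T) \<partial>M))))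
    = (\<integral>b. (w (b * T) / (\<integral>b. w (b * T) \<partial>M)) *\<^sub>R f (b * T) \<partial>M)"
    using w by (subst integral_density) auto
  also have "\<dots> = (\<integral>b. f (b * T) * w (b * T) / (\<integral>b. w (b * T) \<partial>M) \<partial>M)"
    by (intro Bochner_Integration.integral_cong) auto
  finally show ?thesis
    unfolding tilted_def by (subst integral_distr) auto
qed

lemma real_distribution_tilted:
  fixes w :: "real \<Rightarrow> real"
  assumes [measurable]: "w \<in> borel_measurable borel" and w: "\<And>y. 0 \<le> w y"
    and pos: "0 < (\<integral>b. w (b * T) \<partial>M)"
  shows "real_distribution (tilted w T)"
proof -
  have int: "integrable M (\<lambda>b. w (b * T))"
    using pos not_integrable_integral_eq by fastforce
  have "(\<integral>\<^sup>+b. ennreal (w (b * T) / (\<integral>b. w (b * T) \<partial>M)) \<partial>M) = ennreal (\<integral>b. w (b * T) / (\<integral>b. w (b * T) \<partial>M) \<partial>M)"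
    using pos w int by (intro nn_integral_eq_integral) auto
  also have "\<dots> = 1"
    using pos by simp
  finally have "prob_space (density M (\<lambda>b. ennreal (w (b * T) / (\<integral>b. w (b * T) \<partial>M))))"
    by (intro prob_spaceI) (simp add: emeasure_density cong: nn_integral_cong)
  then have "prob_space (tilted w T)"
    unfolding tilted_def by (rule prob_space.prob_space_distr) auto
  then show ?thesis
    by (simp add: real_distribution_def real_distribution_axioms_def tilted_def)
qed

lemma integral_odd_eq_0:
  fixes f :: "real \<Rightarrow> real"
  assumes sym: "distr M borel uminus = M" and [measurable]: "f \<in> borel_measurable borel"
    and odd: "\<And>b. f (- b) = - f b"
  shows "(\<integral>b. f b \<partial>M) = 0"
proof -
  have "(\<integral>b. f b \<partial>M) = (\<integral>b. f (- b) \<partial>M)"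
    by (subst sym[symmetric], subst integral_distr) auto
  then show ?thesis by (simp add: odd)
qed

lemma real_distribution_tilted_fejer:
  assumes "0 < fejer_transform M T"
  shows "real_distribution (tilted fejer T)"
  using assms unfolding fejer_transform_def by (intro real_distribution_tilted) auto

text \<open>
  The characteristic function at a fixed point depends only on ratios of values of the transform at
  proportional arguments. This is why regular variation of the transform, which controls such ratios
  pointwise, suffices for weak convergence of the tilted laws.
\<close>

lemma char_tilted:
  assumes sym: "distr M borel uminus = M" and pos: "fejer_transform M T > 0"
  shows "char (tilted fejer T) s = complex_of_real
    (((s + 1)\<^sup>2 * fejer_transform M ((s + 1) * T) + (s - 1)\<^sup>2 * fejer_transform M ((s - 1) * T)
      - 2 * (s\<^sup>2 * fejer_transform M (s * T))) / fejer_transform M T / 2)"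
proof -
  have "(\<integral>y. sin (s * y) \<partial>tilted fejer T) = 0"
    using integral_odd_eq_0[OF sym, of "\<lambda>b. sin (s * (b * T)) * fejer (b * T)"]
    by (subst integral_tilted) auto
  note char_eq_cos_integral[OF real_distribution_tilted_fejer[OF pos] this]
  also have "(\<integral>y. cos (s * y) \<partial>tilted fejer T) = (\<integral>b. (2 * cos (s * (b * T)) * fejer (b * T)) / 2 \<partial>M) / fejer_transform M T"
    by (subst integral_tilted) (auto simp: fejer_transform_def)
  also have "(\<integral>b. (2 * cos (s * (b * T)) * fejer (b * T)) / 2 \<partial>M)
     = (\<integral>b. ((s + 1)\<^sup>2 * fejer (b * ((s + 1) * T)) + (s - 1)\<^sup>2 * fejer (b * ((s - 1) * T)) - 2 * (s\<^sup>2 * fejer (b * (s * T)))) / 2 \<partial>M)"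
    unfolding cos_mult_fejer by (simp add: mult_ac)
  also have "\<dots> = ((s + 1)\<^sup>2 * fejer_transform M ((s + 1) * T) + (s - 1)\<^sup>2 * fejer_transform M ((s - 1) * T)
      - 2 * (s\<^sup>2 * fejer_transform M (s * T))) / 2"
    unfolding fejer_transform_def by (simp add: integrable_fejer)
  finally show ?thesis by simp
qed

text \<open>
  The ratios \<open>W(c T) / W(T)\<close> converge for each fixed \<open>c\<close>, so the characteristic functions of the tilted laws
  converge pointwise, and Levy's continuity theorem gives weak convergence to \<open>fejer_limit \<alpha>\<close>. The
  kernel is positive on \<open>[-1, 1]\<close>, and therefore the mass of \<open>[-1/T, 1/T]\<close> is \<open>W(T)\<close> times the integral
  of \<open>1\<^bsub>[-1, 1]\<^esub> / fejer\<close>, a bounded function that the limit law integrates to \<open>C(\<alpha>)\<close>.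
\<close>

lemma tauberian_fejer:
  assumes sym: "distr M borel uminus = M" and a: "0 < \<alpha>" "\<alpha> < 2"
    and rv: "\<And>s. s > 0 \<Longrightarrow> ((\<lambda>T. fejer_transform M (s * T) / fejer_transform M T) \<longlongrightarrow> s powr (\<alpha> - 2)) at_top"
  shows "((\<lambda>T. measure M {-1/T..1/T} / fejer_transform M T) \<longlongrightarrow> C_const \<alpha>) at_top"
proof (rule tendsto_at_topI_sequentially)
  let ?W = "fejer_transform M"
  fix X :: "nat \<Rightarrow> real"
  assume X: "filterlim X at_top sequentially"
  have ev: "\<forall>\<^sub>F T in at_top. ?W T > 0 \<and> T > 0"
  proof -
    have "\<forall>\<^sub>F T in at_top. ?W (1 * T) / ?W T > 0"
      by (rule order_tendstoD(1)[OF rv[of 1]]) auto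
    then show ?thesis using eventually_gt_at_top[of 0]
      by eventually_elim (auto simp: zero_less_divide_iff fejer_transform_pos_iff)
  qed
  from eventually_compose_filterlim[OF this X] obtain N where N: "\<And>n. n \<ge> N \<Longrightarrow> ?W (X n) > 0 \<and> X n > 0"
    by (auto simp: eventually_sequentially)
  \<comment> \<open>the tilted laws are probability measures only where the transform is positive, so finitely many terms are dropped\<close>
  define Y where "Y n = X (n + N)" for n
  have Y: "filterlim Y at_top sequentially"
    unfolding Y_def using X by (rule filterlim_compose) (rule filterlim_add_const_nat_at_top)
  have W: "?W (Y n) > 0" and Ypos: "Y n > 0" for n
    using N[of "n + N"] by (auto simp: Y_def)
  have scale: "(\<lambda>n. c\<^sup>2 * ?W (c * Y n) / ?W (Y n)) \<longlonglongrightarrow> \<bar>c\<bar> powr \<alpha>" for c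
  proof (cases "c = 0")
    case False
    have "(\<lambda>n. c\<^sup>2 * (?W (\<bar>c\<bar> * Y n) / ?W (Y n))) \<longlonglongrightarrow> c\<^sup>2 * \<bar>c\<bar> powr (\<alpha> - 2)"
      using False by (intro tendsto_mult tendsto_const filterlim_compose[OF rv Y]) auto
    moreover have "?W (\<bar>c\<bar> * Y n) = ?W (c * Y n)" for n
      using Ypos[of n] fejer_transform_abs[of "c * Y n"] by (simp add: abs_mult)
    moreover have "c\<^sup>2 * \<bar>c\<bar> powr (\<alpha> - 2) = \<bar>c\<bar> powr \<alpha>"
      using False by (simp add: powr_diff powr_numeral)
    ultimately show ?thesis by simp
  qed auto
  have "weak_conv_m (\<lambda>n. tilted fejer (Y n)) (fejer_limit \<alpha>)"
  proof (rule levy_continuity)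
    fix s
    have "(\<lambda>n. ((s + 1)\<^sup>2 * ?W ((s + 1) * Y n) / ?W (Y n) + (s - 1)\<^sup>2 * ?W ((s - 1) * Y n) / ?W (Y n)
        - 2 * (s\<^sup>2 * ?W (s * Y n) / ?W (Y n))) / 2)
      \<longlonglongrightarrow> (\<bar>s + 1\<bar> powr \<alpha> + \<bar>s - 1\<bar> powr \<alpha> - 2 * \<bar>s\<bar> powr \<alpha>) / 2"
      by (intro tendsto_divide tendsto_diff tendsto_add tendsto_mult_left tendsto_const scale) auto
    then show "(\<lambda>n. char (tilted fejer (Y n)) s) \<longlonglongrightarrow> char (fejer_limit \<alpha>) s"
      unfolding char_tilted[OF sym W] char_fejer_limit[OF a]
      by (intro tendsto_of_real) (simp add: diff_divide_distrib add_divide_distrib)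
  qed (auto intro: real_distribution_tilted_fejer W real_distribution_fejer_limit a)
  \<comment> \<open>dividing by the kernel undoes the tilt: the integral of \<open>f\<close> is the mass of \<open>[-1/T, 1/T]\<close> up to normalisation\<close>
  moreover define f :: "real \<Rightarrow> real" where "f y = indicator {-1..1} y / fejer y" for y
  obtain B where B: "\<And>y. \<bar>y\<bar> \<le> 1 \<Longrightarrow> 1 / fejer y \<le> B"
  proof -
    have "compact ((\<lambda>y. 1 / fejer y) ` {-1..1})"
    proof (intro compact_continuous_image continuous_intros)
      show "continuous_on {-1..1} fejer"
        by (intro continuous_at_imp_continuous_on ballI isCont_fejer)
      show "\<forall>y\<in>{-1..1}. fejer y \<noteq> 0"
        using fejer_pos by (metis abs_le_iff atLeastAtMost_iff less_irrefl minus_le_iff)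
    qed auto
    then have "bounded ((\<lambda>y. 1 / fejer y) ` {-1..1})" by (rule compact_imp_bounded)
    then obtain B where "\<forall>x\<in>(\<lambda>y. 1 / fejer y) ` {-1..1}. norm x \<le> B"
      unfolding bounded_iff by auto
    then have "1 / fejer y \<le> B" if "\<bar>y\<bar> \<le> 1" for y
      using that by (auto simp: abs_le_iff)
    then show ?thesis by (rule that)
  qed
  have "(\<lambda>n. \<integral>y. f y \<partial>tilted fejer (Y n)) \<longlonglongrightarrow> (\<integral>y. f y \<partial>fejer_limit \<alpha>)"
  proof (rule weak_conv_imp_bdd_ae_continuous_conv)
    show "emeasure (fejer_limit \<alpha>) {x. \<not> isCont f x} = 0"
    proof -
      have "isCont f x" if x: "x \<notin> {-1, 1}" for x
      proof -
        consider "x < -1" | "x > 1" | "-1 < x \<and> x < 1" 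
          using x linorder_less_linear[of x "-1"] linorder_less_linear[of x 1] by auto
        then show ?thesis
        proof cases
          case 3
          then have "isCont (\<lambda>y. 1 / fejer y) x"
            using fejer_pos[of x] by (intro continuous_intros isCont_fejer) (auto simp: abs_le_iff)
          moreover have "\<forall>\<^sub>F y in nhds x. f y = 1 / fejer y"
            using 3 by (intro eventually_nhds_in_open[of "{-1<..<1}", THEN eventually_mono]) (auto simp: f_def)
          ultimately show ?thesis using isCont_cong by fast
        next
          case 1
          then have "\<forall>\<^sub>F y in nhds x. f y = 0"
            by (intro eventually_nhds_in_open[of "{..<-1}", THEN eventually_mono]) (auto simp: f_def)
          then show ?thesis using isCont_cong[of f "\<lambda>_. 0"] by auto
        next
          case 2
          then have "\<forall>\<^sub>F y in nhds x. f y = 0"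
            by (intro eventually_nhds_in_open[of "{1<..}", THEN eventually_mono]) (auto simp: f_def)
          then show ?thesis using isCont_cong[of f "\<lambda>_. 0"] by auto
        qed
      qed
      then have sub: "{x. \<not> isCont f x} \<subseteq> {-1, 1}" by auto
      then have fin: "finite {x. \<not> isCont f x}" by (rule finite_subset) auto
      then have "{x. \<not> isCont f x} \<in> null_sets lborel"
        by (rule finite_imp_null_set_lborel)
      then have "{x. \<not> isCont f x} \<in> null_sets (fejer_limit \<alpha>)"
        unfolding fejer_limit_def by (subst null_sets_density_iff) (auto dest: AE_not_in elim: eventually_mono)
      then show ?thesis by auto
    qed
    have "0 \<le> B" using B[of 0] by (simp add: fejer_def)
    then show "norm (f x) \<le> B" for x
      using B[of x] by (auto simp: f_def indicator_def abs_le_iff)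
    show "f \<in> borel_measurable borel"
      unfolding f_def by measurable
  qed (auto intro: real_distribution_tilted_fejer W real_distribution_fejer_limit a calculation)
  moreover have "(\<integral>y. f y \<partial>tilted fejer (Y n)) = measure M {-1/Y n..1/Y n} / ?W (Y n)" for n
  proof -
    have "(\<integral>y. f y \<partial>tilted fejer (Y n)) = (\<integral>b. f (b * Y n) * fejer (b * Y n) \<partial>M) / ?W (Y n)"
      unfolding fejer_transform_def by (intro integral_tilted) (auto simp: f_def)
    also have "(\<integral>b. f (b * Y n) * fejer (b * Y n) \<partial>M) = (\<integral>b. indicator {-1/Y n..1/Y n} b \<partial>M)"
    proof (intro Bochner_Integration.integral_cong refl)
      fix b
      have "b * Y n \<in> {-1..1} \<longleftrightarrow> b \<in> {-1/Y n..1/Y n}"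
        using Ypos[of n] by (auto simp: field_simps)
      then show "f (b * Y n) * fejer (b * Y n) = indicator {-1/Y n..1/Y n} b"
        using fejer_pos[of "b * Y n"] by (auto simp: f_def indicator_def abs_le_iff)
    qed
    finally show ?thesis by simp
  qed
  moreover have "(\<integral>y. f y \<partial>fejer_limit \<alpha>) = C_const \<alpha>"
  proof -
    have "(\<integral>\<^sup>+y. ennreal (indicator {-1..1} y * \<bar>y\<bar> powr (1 - \<alpha>)) \<partial>lborel)
       = 2 * (\<integral>\<^sup>+y\<in>{0..1}. ennreal (y powr ((2 - \<alpha>) - 1)) \<partial>lborel)"
      by (subst nn_integral_even) (auto intro!: nn_integral_cong arg_cong[where f="\<lambda>x. 2 * x"] simp: indicator_def)
    also have "\<dots> = ennreal (2 / (2 - \<alpha>))"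
      using a by (subst nn_integral_powr_Icc) (auto simp: numeral_mult_ennreal)
    finally have "has_bochner_integral lborel (\<lambda>y. indicator {-1..1} y * \<bar>y\<bar> powr (1 - \<alpha>)) (2 / (2 - \<alpha>))"
      using a by (intro has_bochner_integral_nn_integral) auto
    then have "(\<integral>y. indicator {-1..1} y * \<bar>y\<bar> powr (1 - \<alpha>) / fejer_mass \<alpha> \<partial>lborel) = C_const \<alpha>"
      by (simp add: has_bochner_integral_iff C_const_eq)
    moreover have "(\<integral>y. f y \<partial>fejer_limit \<alpha>) = (\<integral>y. (fejer y * \<bar>y\<bar> powr (1 - \<alpha>) / fejer_mass \<alpha>) *\<^sub>R f y \<partial>lborel)"
      unfolding fejer_limit_def using fejer_mass_pos[OF a]
      by (intro integral_density) (auto simp: f_def)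
    moreover have "(fejer y * \<bar>y\<bar> powr (1 - \<alpha>) / fejer_mass \<alpha>) *\<^sub>R f y = indicator {-1..1} y * \<bar>y\<bar> powr (1 - \<alpha>) / fejer_mass \<alpha>" for y
      using fejer_pos[of y] by (auto simp: f_def indicator_def abs_le_iff)
    ultimately show ?thesis by (simp only:)
  qed
  ultimately have "(\<lambda>n. measure M {-1/X (n + N)..1/X (n + N)} / ?W (X (n + N))) \<longlonglongrightarrow> C_const \<alpha>"
    by (simp add: Y_def)
  then show "(\<lambda>n. measure M {-1/X n..1/X n} / ?W (X n)) \<longlonglongrightarrow> C_const \<alpha>"
    by (rule LIMSEQ_offset)
qed

end

section \<open>An Abelian theorem for the Fejer kernel\<close>

lemma tendsto_at_right_0_inverse:
  fixes f :: "real \<Rightarrow> real"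
  shows "(f \<longlongrightarrow> l) (at_right 0) \<longleftrightarrow> ((\<lambda>T. f (1 / T)) \<longlongrightarrow> l) at_top"
  by (simp add: filterlim_at_right_to_top inverse_eq_divide)

context finite_borel_measure
begin

text \<open>
  Iterated doubling: a limit ratio \<open>2\<^sup>\<gamma>\<close> below \<open>2\<^sup>3\<^sup>/\<^sup>2\<close> forces growth of order at most \<open>3/2\<close>. This
  exponent lies above every \<open>\<gamma> = 2 - \<alpha>\<close> with \<open>\<alpha> \<ge> 1\<close> and below \<open>2\<close>, the decay rate of the kernel.
\<close>

lemma cdf_dyadic_growth:
  assumes \<gamma>: "\<gamma> < 3 / 2"
    and rv: "((\<lambda>x. cdf M (2 * x) / cdf M x) \<longlongrightarrow> 2 powr \<gamma>) (at_right 0)"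
  obtains C x0 where "x0 > 0" "C > 0"
    "\<And>x y. 0 < x \<Longrightarrow> x \<le> x0 \<Longrightarrow> 1 \<le> y \<Longrightarrow> cdf M (y * x) \<le> C * y powr (3 / 2) * cdf M x"
proof -
  have "2 powr \<gamma> < 2 powr (3 / 2)"
    using \<gamma> by (simp add: powr_less_cancel_iff)
  then have "\<forall>\<^sub>F x in at_right 0. cdf M (2 * x) / cdf M x < 2 powr (3 / 2) \<and> 0 < cdf M (2 * x) / cdf M x"
    using order_tendstoD[OF rv] by (intro eventually_conj) auto
  then obtain e where e: "e > 0" "\<And>x. 0 < x \<Longrightarrow> x < e \<Longrightarrow> cdf M (2 * x) / cdf M x < 2 powr (3 / 2) \<and> 0 < cdf M (2 * x) / cdf M x"
    unfolding eventually_at_right_field by auto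
  define x0 where "x0 = e / 2"
  have x0: "x0 > 0" using e by (simp add: x0_def)
  have pos: "0 < cdf M x" if "0 < x" "x \<le> x0" for x
  proof -
    have "0 < cdf M (2 * x) / cdf M x" using e(2)[of x] e(1) that by (auto simp: x0_def)
    then show ?thesis
      using cdf_nonneg[of x] by (auto simp: zero_less_divide_iff)
  qed
  have step: "cdf M (2 * x) \<le> 2 powr (3 / 2) * cdf M x" if "0 < x" "x \<le> x0" for x
    using e(2)[of x] e(1) that pos[OF that] by (auto simp: x0_def pos_divide_less_eq)
  \<comment> \<open>the last doubling may end at \<open>2 x\<^sub>0\<close>, because the bound is applied at the point before it\<close>
  have iter: "cdf M (2 ^ n * x) \<le> (2 ^ n) powr (3 / 2) * cdf M x" if "0 < x" "2 ^ n * x \<le> 2 * x0" for n x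
    using that
  proof (induction n)
    case (Suc n)
    have le: "2 ^ n * x \<le> x0" using Suc.prems by simp
    have "cdf M (2 * (2 ^ n * x)) \<le> 2 powr (3 / 2) * cdf M (2 ^ n * x)"
      using Suc.prems le by (intro step) auto
    also have "\<dots> \<le> 2 powr (3 / 2) * ((2 ^ n) powr (3 / 2) * cdf M x)"
      using Suc.prems le x0 by (intro mult_left_mono Suc.IH) auto
    finally show ?case by (simp add: powr_mult mult.assoc)
  qed auto
  have near: "cdf M (y * x) \<le> (2 * y) powr (3 / 2) * cdf M x" if "0 < x" "1 \<le> y" "y * x \<le> x0" for x y
  proof -
    define n where "n = nat \<lceil>log 2 y\<rceil>"
    have n: "log 2 y \<le> n" "n < log 2 y + 1"
      using \<open>1 \<le> y\<close> unfolding n_def by (auto simp: zero_le_log_cancel_iff of_nat_nat) linarith+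
    have y: "y = 2 powr log 2 y" using \<open>1 \<le> y\<close> by simp
    have 1: "y \<le> 2 ^ n"
      using n(1) y by (metis one_less_numeral_iff powr_le_cancel_iff powr_realpow semiring_norm(76) zero_less_numeral)
    have "2 powr n \<le> 2 powr (log 2 y + 1)"
      using n(2) by (intro powr_mono) auto
    then have 2: "2 ^ n \<le> 2 * y"
      using \<open>1 \<le> y\<close> by (simp add: powr_add powr_realpow)
    have "2 ^ n * x \<le> 2 * y * x"
      using 2 that by (intro mult_right_mono) auto
    then have 3: "2 ^ n * x \<le> 2 * x0" using that(3) by linarith
    have "cdf M (y * x) \<le> cdf M (2 ^ n * x)"
      using 1 that by (intro cdf_nondecreasing mult_right_mono) auto
    also have "\<dots> \<le> (2 ^ n) powr (3 / 2) * cdf M x" by (rule iter[OF that(1) 3])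
    also have "\<dots> \<le> (2 * y) powr (3 / 2) * cdf M x"
      using 2 by (intro mult_right_mono powr_mono2 cdf_nonneg) auto
    finally show ?thesis .
  qed
  define m where "m = measure M UNIV"
  have m: "cdf M x \<le> m" for x
    unfolding cdf_def m_def by (rule finite_measure_mono) (auto simp: M_is_borel)
  have G0: "0 < cdf M x0" using x0 by (intro pos) auto
  \<comment> \<open>the factor \<open>m / F(x\<^sub>0)\<close> covers arguments beyond \<open>x\<^sub>0\<close>, where \<open>F\<close> is at most the total mass \<open>m\<close>\<close>
  define C where "C = 2 powr (3 / 2) * (m / cdf M x0)"
  have ratio: "1 \<le> m / cdf M x0" using m[of x0] G0 by simp
  show ?thesis
  proof (rule that[OF x0])
    show "C > 0" unfolding C_def using ratio G0 m[of x0] by auto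
    fix x y :: real assume *: "0 < x" "x \<le> x0" "1 \<le> y"
    show "cdf M (y * x) \<le> C * y powr (3 / 2) * cdf M x"
    proof (cases "y * x \<le> x0")
      case True
      have "(2 * y) powr (3 / 2) * cdf M x \<le> (2 * y) powr (3 / 2) * cdf M x * (m / cdf M x0)"
        using mult_left_mono[OF ratio, of "(2 * y) powr (3 / 2) * cdf M x"] cdf_nonneg[of x] by simp
      then show ?thesis
        using near[OF *(1,3) True] *(3) by (simp add: C_def powr_mult mult_ac)
    next
      case False
      have "cdf M x0 \<le> (2 * (x0 / x)) powr (3 / 2) * cdf M x"
        using near[of x "x0 / x"] * by simp
      also have "\<dots> \<le> (2 * y) powr (3 / 2) * cdf M x"
        using False * x0 by (intro mult_right_mono powr_mono2 cdf_nonneg) (auto simp: field_simps)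
      finally have "cdf M x0 * (m / cdf M x0) \<le> (2 * y) powr (3 / 2) * cdf M x * (m / cdf M x0)"
        using ratio by (intro mult_right_mono) auto
      then have "m \<le> C * y powr (3 / 2) * cdf M x"
        using G0 *(3) by (simp add: C_def powr_mult mult_ac)
      then show ?thesis using m[of "y * x"] by linarith
    qed
  qed
qed

text \<open>
  The kernel decays like \<open>x\<^sup>2 / b\<^sup>2\<close>, one half power faster than the distribution function can grow, so
  the mass beyond \<open>R x\<close> contributes a fraction \<open>O(R\<^sup>-\<^sup>1\<^sup>/\<^sup>2)\<close> of \<open>F(x)\<close>, uniformly in \<open>x\<close>.
\<close>

lemma fejer_tail_bound:
  assumes nonneg: "measure M {..<0} = 0" and x: "0 < x" and R: "1 \<le> R" and C: "0 < C"
    and growth: "\<And>y. 1 \<le> y \<Longrightarrow> cdf M (y * x) \<le> C * y powr (3 / 2) * cdf M x"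
  shows "(\<integral>b. fejer (b * (1 / x)) * indicator {R * x<..} b \<partial>M) \<le> 16 * C * R powr (- 1 / 2) * cdf M x"
proof -
  interpret pair_sigma_finite M lborel ..
  have "(\<integral>\<^sup>+b. ennreal (fejer (b * (1 / x)) * indicator {R * x<..} b) \<partial>M)
  \<comment> \<open>\<open>4 x\<^sup>2 / b\<^sup>2\<close> is the integral of \<open>8 / u\<^sup>3\<close> over \<open>u \<ge> b / x\<close>, which turns the tail into an integral of \<open>F(u x)\<close>\<close>
    \<le> (\<integral>\<^sup>+b. \<integral>\<^sup>+u. (if R \<le> u \<and> b \<le> u * x \<and> 0 \<le> b then ennreal (8 / u ^ 3) else 0) \<partial>lborel \<partial>M)"
  proof (intro nn_integral_mono)
    fix b :: real
    show "ennreal (fejer (b * (1 / x)) * indicator {R * x<..} b)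
      \<le> (\<integral>\<^sup>+u. (if R \<le> u \<and> b \<le> u * x \<and> 0 \<le> b then ennreal (8 / u ^ 3) else 0) \<partial>lborel)"
    proof (cases "R * x < b")
      case True
      then have b: "R < b / x" "0 < b"
        using x R by (auto simp: pos_less_divide_eq intro: less_trans[of 0 "R * x"])
      have "(\<integral>\<^sup>+u. (if R \<le> u \<and> b \<le> u * x \<and> 0 \<le> b then ennreal (8 / u ^ 3) else 0) \<partial>lborel)
        = (\<integral>\<^sup>+u. ennreal (8 / u ^ 3) * indicator {b / x..} u \<partial>lborel)"
      proof (intro nn_integral_cong)
        fix u
        have "R \<le> u \<and> b \<le> u * x \<and> 0 \<le> b \<longleftrightarrow> b / x \<le> u"
          using b x by (auto simp: pos_divide_le_eq intro: order_trans less_imp_le)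
        then show "(if R \<le> u \<and> b \<le> u * x \<and> 0 \<le> b then ennreal (8 / u ^ 3) else 0)
            = ennreal (8 / u ^ 3) * indicator {b / x..} u"
          by (simp add: indicator_def)
      qed
      also have "\<dots> = ennreal (0 - (- 4 / (b / x)\<^sup>2))"
      proof (rule nn_integral_FTC_atLeast)
        fix u assume "b / x \<le> u"
        then have u: "u > 0" using b R by linarith
        then show "((\<lambda>u. - 4 / u\<^sup>2) has_real_derivative 8 / u ^ 3) (at u)"
          by (auto intro!: derivative_eq_intros simp: field_simps eval_nat_numeral)
        show "0 \<le> 8 / u ^ 3" using u by simp
      next
        show "((\<lambda>u::real. - 4 / u\<^sup>2) \<longlongrightarrow> 0) at_top"
          by (intro tendsto_divide_0[OF tendsto_const] filterlim_at_top_imp_at_infinity filterlim_pow_at_top filterlim_ident) auto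
      qed auto
      also have "ennreal (fejer (b * (1 / x)) * indicator {R * x<..} b) \<le> \<dots>"
        using fejer_le_inverse_square[of "b / x"] b x by (intro ennreal_leI) (auto simp: indicator_def)
      finally show ?thesis .
    qed (simp add: indicator_def)
  qed
  also have "\<dots> = (\<integral>\<^sup>+u. \<integral>\<^sup>+b. (if R \<le> u \<and> b \<le> u * x \<and> 0 \<le> b then ennreal (8 / u ^ 3) else 0) \<partial>M \<partial>lborel)"
    by (rule Fubini'[symmetric]) measurable
  also have "\<dots> \<le> (\<integral>\<^sup>+u. ennreal (8 * C * cdf M x) * (ennreal (u powr (- 3 / 2)) * indicator {R..} u) \<partial>lborel)"
  proof (intro nn_integral_mono)
    fix u :: real
    show "(\<integral>\<^sup>+b. (if R \<le> u \<and> b \<le> u * x \<and> 0 \<le> b then ennreal (8 / u ^ 3) else 0) \<partial>M)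
      \<le> ennreal (8 * C * cdf M x) * (ennreal (u powr (- 3 / 2)) * indicator {R..} u)"
    proof (cases "R \<le> u")
      case True
      have u: "u \<ge> 1" using True R by linarith
      have "(\<integral>\<^sup>+b. (if R \<le> u \<and> b \<le> u * x \<and> 0 \<le> b then ennreal (8 / u ^ 3) else 0) \<partial>M)
        \<le> (\<integral>\<^sup>+b. ennreal (8 / u ^ 3) * indicator {..u * x} b \<partial>M)"
        by (intro nn_integral_mono) (auto simp: indicator_def)
      also have "\<dots> = ennreal (8 / u ^ 3) * ennreal (cdf M (u * x))"
        by (subst nn_integral_cmult_indicator) (auto simp: M_is_borel cdf_def emeasure_eq_measure)
      also have "\<dots> \<le> ennreal (8 / u ^ 3 * (C * u powr (3 / 2) * cdf M x))"
        using growth[OF u] u by (subst ennreal_mult'[symmetric]) (auto intro!: ennreal_leI mult_left_mono divide_right_mono)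
      also have "8 / u ^ 3 * (C * u powr (3 / 2) * cdf M x) = 8 * C * cdf M x * u powr (- 3 / 2)"
      proof -
        have "u powr (- 3 / 2) = u powr (3 / 2) * u powr (- 3)" by (simp flip: powr_add)
        also have "u powr (- 3) = 1 / u ^ 3"
          using u by (simp add: powr_minus divide_inverse powr_numeral)
        finally show ?thesis by simp
      qed
      finally show ?thesis
        using True C cdf_nonneg by (simp add: ennreal_mult'[symmetric])
    qed auto
  qed
  also have "\<dots> = ennreal (8 * C * cdf M x) * (\<integral>\<^sup>+u. ennreal (u powr (- 3 / 2)) * indicator {R..} u \<partial>lborel)"
    by (rule nn_integral_cmult) auto
  also have "(\<integral>\<^sup>+u. ennreal (u powr (- 3 / 2)) * indicator {R..} u \<partial>lborel) = ennreal (0 - (- 2 * R powr (- 1 / 2)))"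
  proof (rule nn_integral_FTC_atLeast)
    fix u assume "R \<le> u"
    then have u: "u > 0" using R by linarith
    then show "((\<lambda>u. - 2 * u powr (- 1 / 2)) has_real_derivative u powr (- 3 / 2)) (at u)"
      by (auto intro!: derivative_eq_intros)
  next
    have "((\<lambda>u::real. u powr (- 1 / 2)) \<longlongrightarrow> 0) at_top"
      by (rule tendsto_neg_powr) (auto simp: filterlim_ident)
    then show "((\<lambda>u::real. - 2 * u powr (- 1 / 2)) \<longlongrightarrow> 0) at_top"
      by (rule tendsto_mult_right_zero)
  qed auto
  also have "ennreal (8 * C * cdf M x) * ennreal (0 - (- 2 * R powr (- 1 / 2))) = ennreal (16 * C * R powr (- 1 / 2) * cdf M x)"
    using C cdf_nonneg by (simp add: ennreal_mult'[symmetric] mult_ac)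
  finally show ?thesis
    using C cdf_nonneg[of x] by (intro integral_real_bounded) auto
qed

end

text \<open>
  The law on \<open>[0, R]\<close> with distribution function \<open>(t / R)\<^sup>\<gamma>\<close>, the limit of a regularly varying
  measure truncated to \<open>[0, R / T]\<close> and rescaled.
\<close>

definition power_law :: "real \<Rightarrow> real \<Rightarrow> real measure" where
  "power_law \<gamma> R = density lborel (\<lambda>y. ennreal (\<gamma> / R powr \<gamma> * y powr (\<gamma> - 1) * indicator {0..R} y))"

lemma emeasure_power_law_atMost:
  assumes "\<gamma> > 0" "R > 0" "t \<ge> 0"
  shows "emeasure (power_law \<gamma> R) {..t} = ennreal ((min t R / R) powr \<gamma>)"
proof -
  have "emeasure (power_law \<gamma> R) {..t} = (\<integral>\<^sup>+y. ennreal (\<gamma> / R powr \<gamma>) * (ennreal (y powr (\<gamma> - 1)) * indicator {0..min t R} y) \<partial>lborel)"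
    unfolding power_law_def using assms
    by (subst emeasure_density) (auto intro!: nn_integral_cong simp: indicator_def ennreal_mult'[symmetric])
  also have "\<dots> = ennreal (\<gamma> / R powr \<gamma>) * ennreal (min t R powr \<gamma> / \<gamma>)"
    using assms by (subst nn_integral_cmult, simp, subst nn_integral_powr_Icc) auto
  also have "\<dots> = ennreal ((min t R / R) powr \<gamma>)"
    using assms by (simp add: ennreal_mult'[symmetric] powr_divide)
  finally show ?thesis .
qed

lemma real_distribution_power_law:
  assumes "\<gamma> > 0" "R > 0"
  shows "real_distribution (power_law \<gamma> R)"
proof -
  have "emeasure (power_law \<gamma> R) {R<..} = 0"
    unfolding power_law_def by (subst emeasure_density) (auto simp: nn_integral_0_iff_AE indicator_def)
  moreover have "emeasure (power_law \<gamma> R) UNIV = emeasure (power_law \<gamma> R) {..R} + emeasure (power_law \<gamma> R) {R<..}"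
    by (subst plus_emeasure) (auto simp: power_law_def intro!: arg_cong[where f="emeasure _"])
  ultimately have "emeasure (power_law \<gamma> R) UNIV = 1"
    using assms by (simp add: emeasure_power_law_atMost)
  then have "prob_space (power_law \<gamma> R)"
    by (intro prob_spaceI) (simp add: power_law_def)
  then show ?thesis
    by (simp add: real_distribution_def real_distribution_axioms_def power_law_def)
qed

lemma cdf_power_law:
  assumes "\<gamma> > 0" "R > 0"
  shows "cdf (power_law \<gamma> R) t = (if t < 0 then 0 else (min t R / R) powr \<gamma>)"
proof (cases "t < 0")
  case True
  then have "emeasure (power_law \<gamma> R) {..t} = 0"
    unfolding power_law_def by (subst emeasure_density) (auto simp: nn_integral_0_iff_AE indicator_def)
  then show ?thesis using True by (simp add: cdf_def measure_def)
next
  case False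
  then show ?thesis using emeasure_power_law_atMost[OF assms, of t] by (simp add: cdf_def measure_def)
qed

context finite_borel_measure
begin

text \<open>
  On \<open>[0, R / T]\<close> regular variation gives weak convergence of the rescaled measure to a power law, and the
  kernel is bounded and continuous; beyond \<open>R / T\<close> the tail is uniformly small. Letting \<open>T\<close> and
  then \<open>R\<close> tend to infinity leaves the full integral of \<open>fejer y \<cdot> y\<^sup>1\<^sup>-\<^sup>\<alpha>\<close>.
\<close>

lemma abelian_fejer_nonneg:
  assumes nonneg: "measure M {..<0} = 0" and a: "1 / 2 < \<alpha>" "\<alpha> < 2"
    and rv: "\<And>s. s > 0 \<Longrightarrow> ((\<lambda>x. cdf M (s * x) / cdf M x) \<longlongrightarrow> s powr (2 - \<alpha>)) (at_right 0)"
  shows "((\<lambda>T. fejer_transform M T / cdf M (1 / T)) \<longlongrightarrow> 1 / C_const \<alpha>) at_top"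
proof -
  define \<gamma> where "\<gamma> = 2 - \<alpha>"
  have \<gamma>: "0 < \<gamma>" "\<gamma> < 3 / 2" using a by (auto simp: \<gamma>_def)
  let ?G = "cdf M"
  let ?W = "fejer_transform M"
  note rv = rv[folded \<gamma>_def]
  obtain C x0 where C: "x0 > 0" "C > 0"
    and growth: "\<And>x y. 0 < x \<Longrightarrow> x \<le> x0 \<Longrightarrow> 1 \<le> y \<Longrightarrow> ?G (y * x) \<le> C * y powr (3 / 2) * ?G x"
    by (rule cdf_dyadic_growth[OF \<gamma>(2) rv[OF zero_less_numeral]]) (rule that)
  have rvT: "((\<lambda>T. ?G (s / T) / ?G (1 / T)) \<longlongrightarrow> s powr \<gamma>) at_top" if "s > 0" for s
    using rv[OF that] unfolding tendsto_at_right_0_inverse by simp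
  have Gpos: "\<forall>\<^sub>F T in at_top. 0 < ?G (s / T)" if "s > 0" for s
  proof -
    have "\<forall>\<^sub>F T in at_top. 0 < ?G (s / T) / ?G (1 / T)"
      using order_tendstoD(1)[OF rvT[OF that], of 0] that by simp
    then show ?thesis
      by eventually_elim (auto simp: zero_less_divide_iff cdf_nonneg[THEN leD])
  qed
  define J where "J R = (\<integral>y. indicator {0..R} y * (\<gamma> * (fejer y * y powr (\<gamma> - 1))) \<partial>lborel)" for R
  have L: "has_bochner_integral lborel (\<lambda>y. indicator {0..} y * (\<gamma> * (fejer y * y powr (\<gamma> - 1)))) (1 / C_const \<alpha>)"
  proof -
    have "(\<integral>\<^sup>+y. ennreal (indicator {0..} y * (fejer y * y powr (\<gamma> - 1))) \<partial>lborel)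
      = (\<integral>\<^sup>+y\<in>{0..}. ennreal (fejer y * y powr (1 - \<alpha>)) \<partial>lborel)"
      by (intro nn_integral_cong) (auto simp: indicator_def \<gamma>_def)
    also have "\<dots> = ennreal (fejer_mass \<alpha> / 2)"
      using a by (subst nn_integral_fejer_powr) (auto simp: fejer_mass_def)
    finally have "has_bochner_integral lborel (\<lambda>y. indicator {0..} y * (fejer y * y powr (\<gamma> - 1))) (fejer_mass \<alpha> / 2)"
      using fejer_mass_pos[of \<alpha>] a by (intro has_bochner_integral_nn_integral) auto
    from has_bochner_integral_mult_right[OF this, of \<gamma>]
    show ?thesis
      by (simp add: mult.left_commute C_const_eq \<gamma>_def)
  qed
  have Jlim: "(J \<longlongrightarrow> 1 / C_const \<alpha>) at_top"
  proof -
    have "((\<lambda>R. \<integral>y. indicator {..R} y *\<^sub>R (indicator {0..} y * (\<gamma> * (fejer y * y powr (\<gamma> - 1)))) \<partial>lborel)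
      \<longlongrightarrow> (\<integral>y. indicator {0..} y * (\<gamma> * (fejer y * y powr (\<gamma> - 1))) \<partial>lborel)) at_top"
      using L by (intro tendsto_integral_at_top) (auto simp: has_bochner_integral_iff)
    moreover have "(\<integral>y. indicator {..R} y *\<^sub>R (indicator {0..} y * (\<gamma> * (fejer y * y powr (\<gamma> - 1)))) \<partial>lborel) = J R" for R
      unfolding J_def by (intro Bochner_Integration.integral_cong) (auto simp: indicator_def)
    ultimately show ?thesis using L by (simp add: has_bochner_integral_iff)
  qed
  define V where "V R T = (\<integral>b. fejer (b * T) * indicator {..R / T} b \<partial>M)" for R T
  have Vlim: "((\<lambda>T. V R T / ?G (1 / T)) \<longlongrightarrow> J R) at_top" if R: "R > 0" for R
  proof (rule tendsto_at_topI_sequentially)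
    fix X :: "nat \<Rightarrow> real"
    assume X: "filterlim X at_top sequentially"
    have "\<forall>\<^sub>F T in at_top. 0 < ?G (R / T) \<and> 0 < T"
      using Gpos[OF R] eventually_gt_at_top[of 0] by eventually_elim auto
    from eventually_compose_filterlim[OF this X]
    obtain N where N: "\<And>n. n \<ge> N \<Longrightarrow> 0 < ?G (R / X n) \<and> 0 < X n"
      by (auto simp: eventually_sequentially)
    define Y where "Y n = X (n + N)" for n
    have Y: "filterlim Y at_top sequentially"
      unfolding Y_def using X by (rule filterlim_compose) (rule filterlim_add_const_nat_at_top)
    have GY: "?G (R / Y n) > 0" and Ypos: "Y n > 0" for n
      using N[of "n + N"] by (auto simp: Y_def)
    \<comment> \<open>the law of \<open>b Y\<^sub>n\<close> conditioned on \<open>b \<le> R / Y\<^sub>n\<close>\<close>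
    let ?w = "indicator {..R} :: real \<Rightarrow> real"
    have ind: "(\<lambda>b. indicator {..t} (b * Y n) :: real) = indicator {..t / Y n}" for t n
      using Ypos[of n] by (auto simp: indicator_def field_simps fun_eq_iff)
    have mass: "(\<integral>b. ?w (b * Y n) \<partial>M) = ?G (R / Y n)" for n
      unfolding ind by (simp add: cdf_def)
    have dist: "real_distribution (tilted ?w (Y n))" for n
      by (intro real_distribution_tilted) (auto simp: mass GY)
    have cdfY: "cdf (tilted ?w (Y n)) t = ?G (min t R / Y n) / ?G (R / Y n)" for n t
    proof -
      interpret T: real_distribution "tilted ?w (Y n)" by (rule dist)
      have "cdf (tilted ?w (Y n)) t = (\<integral>y. indicator {..t} y \<partial>tilted ?w (Y n))"
        by (simp add: cdf_def)
      also have "\<dots> = (\<integral>b. indicator {..t} (b * Y n) * ?w (b * Y n) \<partial>M) / ?G (R / Y n)"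
        by (subst integral_tilted) (auto simp: mass)
      also have "(\<integral>b. indicator {..t} (b * Y n) * ?w (b * Y n) \<partial>M) = (\<integral>b. indicator {..min t R / Y n} b \<partial>M)"
        unfolding ind[of "min t R" n, symmetric]
        by (intro Bochner_Integration.integral_cong) (auto simp: indicator_def)
      finally show ?thesis by (simp add: cdf_def)
    qed
    have ratio: "(\<lambda>n. ?G (s / Y n) / ?G (R / Y n)) \<longlonglongrightarrow> (s / R) powr \<gamma>" if s: "s > 0" for s
    proof -
      have "(\<lambda>n. (?G (s / Y n) / ?G (1 / Y n)) / (?G (R / Y n) / ?G (1 / Y n))) \<longlonglongrightarrow> s powr \<gamma> / R powr \<gamma>"
        using R s by (intro tendsto_divide filterlim_compose[OF rvT Y]) auto
      moreover have "\<forall>\<^sub>F n in sequentially. (?G (s / Y n) / ?G (1 / Y n)) / (?G (R / Y n) / ?G (1 / Y n)) = ?G (s / Y n) / ?G (R / Y n)"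
        using eventually_compose_filterlim[OF Gpos[OF zero_less_one] Y]
        by eventually_elim simp
      ultimately have "(\<lambda>n. ?G (s / Y n) / ?G (R / Y n)) \<longlonglongrightarrow> s powr \<gamma> / R powr \<gamma>"
        by (rule Lim_transform_eventually)
      then show ?thesis
        using R s by (simp add: powr_divide)
    qed
    have "weak_conv_m (\<lambda>n. tilted ?w (Y n)) (power_law \<gamma> R)"
      unfolding weak_conv_m_def weak_conv_def cdfY cdf_power_law[OF \<gamma>(1) R]
    proof (intro allI impI)
      fix t :: real
      consider "t < 0" | "t = 0" | "t > 0" by linarith
      then show "(\<lambda>n. ?G (min t R / Y n) / ?G (R / Y n)) \<longlonglongrightarrow> (if t < 0 then 0 else (min t R / R) powr \<gamma>)"
      proof cases
        case 1
        have "?G (min t R / Y n) = 0" for n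
        proof -
          have "min t R / Y n < 0" using 1 Ypos[of n] by (simp add: divide_neg_pos min_def)
          then have "?G (min t R / Y n) \<le> measure M {..<0}"
            unfolding cdf_def by (intro finite_measure_mono) (auto simp: M_is_borel)
          then show ?thesis using cdf_nonneg[of "min t R / Y n"] nonneg by simp
        qed
        then show ?thesis using 1 by simp
      next
        case 3
        then show ?thesis using ratio[of "min t R"] R by simp
      next
        case 2
        \<comment> \<open>no atom survives at the origin: \<open>F(0)\<close> is below \<open>F(s / T)\<close> for every \<open>s > 0\<close>\<close>
        have "(\<lambda>n. ?G 0 / ?G (R / Y n)) \<longlonglongrightarrow> 0"
        proof (rule order_tendstoI)
          fix e :: real assume "e > 0"
          define s where "s = R * (e / 2) powr (1 / \<gamma>)"
          have s: "s > 0" "(s / R) powr \<gamma> < e"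
            using R \<gamma> \<open>e > 0\<close> by (auto simp: s_def powr_powr)
          have "\<forall>\<^sub>F n in sequentially. ?G (s / Y n) / ?G (R / Y n) < e"
            by (rule order_tendstoD(2)[OF ratio[OF s(1)] s(2)])
          then show "\<forall>\<^sub>F n in sequentially. ?G 0 / ?G (R / Y n) < e"
          proof eventually_elim
            case (elim n)
            have "?G 0 / ?G (R / Y n) \<le> ?G (s / Y n) / ?G (R / Y n)"
              using s(1) Ypos[of n] GY[of n] by (intro divide_right_mono cdf_nondecreasing) auto
            then show ?case using elim by linarith
          qed
        next
          fix e :: real assume "e < 0"
          then show "\<forall>\<^sub>F n in sequentially. e < ?G 0 / ?G (R / Y n)"
            using GY cdf_nonneg[of 0] by (intro always_eventually allI) (auto intro: less_le_trans simp: less_imp_le)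
        qed
        then show ?thesis using 2 R by simp
      qed
    qed
    from weak_conv_imp_integral_bdd_continuous_conv[OF dist real_distribution_power_law[OF \<gamma>(1) R] this, of fejer 1]
    have "(\<lambda>n. \<integral>y. fejer y \<partial>tilted ?w (Y n)) \<longlonglongrightarrow> (\<integral>y. fejer y \<partial>power_law \<gamma> R)"
      using fejer_le_1 by simp
    moreover have "(\<integral>y. fejer y \<partial>power_law \<gamma> R) = J R / R powr \<gamma>"
    proof -
      have "(\<integral>y. fejer y \<partial>power_law \<gamma> R) = (\<integral>y. (\<gamma> / R powr \<gamma> * y powr (\<gamma> - 1) * indicator {0..R} y) *\<^sub>R fejer y \<partial>lborel)"
        unfolding power_law_def using \<gamma> by (intro integral_density) (auto simp: indicator_def)
      also have "\<dots> = (\<integral>y. (indicator {0..R} y * (\<gamma> * (fejer y * y powr (\<gamma> - 1)))) / R powr \<gamma> \<partial>lborel)"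
        by (intro Bochner_Integration.integral_cong) auto
      finally show ?thesis by (simp add: J_def)
    qed
    moreover have "(\<integral>y. fejer y \<partial>tilted ?w (Y n)) = V R (Y n) / ?G (R / Y n)" for n
      using fun_cong[OF ind[of R n]]
      by (subst integral_tilted) (auto simp: V_def cdf_def)
    ultimately have "(\<lambda>n. V R (Y n) / ?G (R / Y n)) \<longlonglongrightarrow> J R / R powr \<gamma>" by simp
    then have "(\<lambda>n. V R (Y n) / ?G (R / Y n) * (?G (R / Y n) / ?G (1 / Y n))) \<longlonglongrightarrow> J R / R powr \<gamma> * R powr \<gamma>"
      by (intro tendsto_mult filterlim_compose[OF rvT Y] R)
    moreover have "(\<lambda>n. V R (Y n) / ?G (R / Y n) * (?G (R / Y n) / ?G (1 / Y n))) = (\<lambda>n. V R (Y n) / ?G (1 / Y n))"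
      using GY by (auto simp: fun_eq_iff less_imp_neq[THEN not_sym])
    moreover have "J R / R powr \<gamma> * R powr \<gamma> = J R" using R by simp
    ultimately have "(\<lambda>n. V R (Y n) / ?G (1 / Y n)) \<longlonglongrightarrow> J R" by (simp only:)
    then have "(\<lambda>n. V R (X (n + N)) / ?G (1 / X (n + N))) \<longlonglongrightarrow> J R" by (simp only: Y_def)
    then show "(\<lambda>n. V R (X n) / ?G (1 / X n)) \<longlonglongrightarrow> J R" by (rule LIMSEQ_offset)
  qed
  show ?thesis
  proof (rule tendstoI)
    fix e :: real assume e: "e > 0"
    have "((\<lambda>R. 16 * C * R powr (- 1 / 2)) \<longlongrightarrow> 16 * C * 0) at_top"
      by (intro tendsto_mult tendsto_const tendsto_neg_powr) (auto simp: filterlim_ident)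
    then have "\<forall>\<^sub>F R in at_top. 16 * C * R powr (- 1 / 2) < e / 3"
      using e by (intro order_tendstoD(2)) auto
    moreover have "\<forall>\<^sub>F R in at_top. dist (J R) (1 / C_const \<alpha>) < e / 3"
      using e by (intro tendstoD[OF Jlim]) auto
    ultimately have "\<forall>\<^sub>F R in at_top. 16 * C * R powr (- 1 / 2) < e / 3 \<and> dist (J R) (1 / C_const \<alpha>) < e / 3 \<and> 1 \<le> R"
      using eventually_ge_at_top[of 1] by eventually_elim auto
    then obtain R where R: "16 * C * R powr (- 1 / 2) < e / 3" "dist (J R) (1 / C_const \<alpha>) < e / 3" "1 \<le> R"
      using eventually_happens'[OF trivial_limit_at_top_linorder] by blast
    have "\<forall>\<^sub>F T in at_top. dist (V R T / ?G (1 / T)) (J R) < e / 3"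
      using e R by (intro tendstoD[OF Vlim]) auto
    then show "\<forall>\<^sub>F T in at_top. dist (?W T / ?G (1 / T)) (1 / C_const \<alpha>) < e"
      using Gpos[OF zero_less_one] eventually_ge_at_top[of "1 / x0"] eventually_gt_at_top[of 0]
    proof eventually_elim
      case (elim T)
      have T: "0 < 1 / T" "1 / T \<le> x0" using elim C by (auto simp: field_simps)
      define tail where "tail = (\<integral>b. fejer (b * T) * indicator {R / T<..} b \<partial>M)"
      have "tail \<le> 16 * C * R powr (- 1 / 2) * ?G (1 / T)"
        using fejer_tail_bound[OF nonneg T(1) R(3) C(2) growth[OF T]] by (simp add: tail_def)
      then have tail: "tail / ?G (1 / T) \<le> 16 * C * R powr (- 1 / 2)" "0 \<le> tail / ?G (1 / T)"
        using elim by (auto simp: tail_def pos_divide_le_eq intro!: divide_nonneg_nonneg integral_nonneg_AE)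
      have int: "integrable M (\<lambda>b. fejer (b * T) * indicator A b)" if "A \<in> sets borel" for A
        using that fejer_le_1 by (intro integrable_const_bound[where B=1]) (auto simp: indicator_def)
      have "?W T = (\<integral>b. fejer (b * T) * indicator {..R / T} b + fejer (b * T) * indicator {R / T<..} b \<partial>M)"
        unfolding fejer_transform_def by (intro Bochner_Integration.integral_cong) (auto simp: indicator_def)
      also have "\<dots> = V R T + tail"
        unfolding V_def tail_def by (intro Bochner_Integration.integral_add int) auto
      finally have "?W T / ?G (1 / T) = V R T / ?G (1 / T) + tail / ?G (1 / T)"
        by (simp add: add_divide_distrib)
      then show ?case
        using elim(1) tail R unfolding dist_real_def by linarith
    qed
  qed
qed

lemma abelian_fejer:
  assumes a: "1 / 2 < \<alpha>" "\<alpha> < 2"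
    and rv: "\<And>s. s > 0 \<Longrightarrow> ((\<lambda>x. measure M {- (s * x)..s * x} / measure M {-x..x}) \<longlongrightarrow> s powr (2 - \<alpha>)) (at_right 0)"
  shows "((\<lambda>T. fejer_transform M T / measure M {-1/T..1/T}) \<longlongrightarrow> 1 / C_const \<alpha>) at_top"
proof -
  define N where "N = distr M borel abs"
  interpret N: finite_borel_measure N
    unfolding N_def by (intro finite_borel_measure.intro finite_measure_distr finite_borel_measure_axioms.intro) auto
  have cdf: "cdf N x = measure M {-x..x}" for x
  proof -
    have "abs -` {..x} \<inter> space M = {-x..x}" by (auto simp: abs_le_iff)
    then show ?thesis by (simp add: cdf_def N_def measure_distr)
  qed
  have "measure N {..<0} = 0"
  proof -
    have "abs -` {..<0::real} \<inter> space M = {}" by auto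
    then show ?thesis by (simp add: N_def measure_distr)
  qed
  moreover have "fejer_transform N T = fejer_transform M T" for T
    unfolding fejer_transform_def N_def
    by (subst integral_distr) (auto intro!: Bochner_Integration.integral_cong simp: fejer_def abs_mult power_mult_distrib abs_if)
  ultimately show ?thesis
    using N.abelian_fejer_nonneg[OF _ a] rv by (simp add: cdf)
qed

end

section \<open>Complex-valued square-integrable functions\<close>

lemma borel_measurable_cnj [measurable]: "cnj \<in> borel_measurable borel"
  by (intro borel_measurable_continuous_onI continuous_intros)

lemma L2_measurable [measurable_dest]: "f \<in> L2 \<pi> \<Longrightarrow> f \<in> borel_measurable \<pi>"
  by (simp add: L2_def)

lemma L2_square_integrable: "f \<in> L2 \<pi> \<Longrightarrow> integrable \<pi> (\<lambda>x. (cmod (f x))\<^sup>2)"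
  by (simp add: L2_def)

lemma L2_zero [simp, intro]: "(\<lambda>x. 0) \<in> L2 \<pi>"
  by (simp add: L2_def)

lemma L2_cmult [simp, intro]:
  assumes "f \<in> L2 \<pi>"
  shows "(\<lambda>x. c * f x) \<in> L2 \<pi>"
  using assms by (auto simp: L2_def norm_mult power_mult_distrib)

lemma L2_add [simp, intro]:
  assumes f: "f \<in> L2 \<pi>" and h: "h \<in> L2 \<pi>"
  shows "(\<lambda>x. f x + h x) \<in> L2 \<pi>"
proof -
  note [measurable] = L2_measurable[OF f] L2_measurable[OF h]
  have "integrable \<pi> (\<lambda>x. (cmod (f x + h x))\<^sup>2)"
  proof (rule Bochner_Integration.integrable_bound)
    show "integrable \<pi> (\<lambda>x. 2 * (cmod (f x))\<^sup>2 + 2 * (cmod (h x))\<^sup>2)"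
      using L2_square_integrable[OF f] L2_square_integrable[OF h] by simp
    have "(cmod (f x + h x))\<^sup>2 \<le> 2 * (cmod (f x))\<^sup>2 + 2 * (cmod (h x))\<^sup>2" for x
    proof -
      have "(cmod (f x + h x))\<^sup>2 \<le> (cmod (f x) + cmod (h x))\<^sup>2"
        by (intro power_mono norm_triangle_ineq norm_ge_zero)
      also have "\<dots> \<le> 2 * (cmod (f x))\<^sup>2 + 2 * (cmod (h x))\<^sup>2"
        using sum_squares_bound[of "cmod (f x)" "cmod (h x)"] by (simp add: power2_sum)
      finally show ?thesis .
    qed
    then show "AE x in \<pi>. norm ((cmod (f x + h x))\<^sup>2) \<le> norm (2 * (cmod (f x))\<^sup>2 + 2 * (cmod (h x))\<^sup>2)"
      by (auto intro!: AE_I2 order_trans[OF _ abs_ge_self])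
  qed measurable
  then show ?thesis by (simp add: L2_def)
qed

lemma L2_diff [simp, intro]: "f \<in> L2 \<pi> \<Longrightarrow> h \<in> L2 \<pi> \<Longrightarrow> (\<lambda>x. f x - h x) \<in> L2 \<pi>"
  using L2_add[of f \<pi> "\<lambda>x. - 1 * h x"] L2_cmult[of h \<pi> "- 1"] by simp

lemma L2_divide [simp, intro]: "f \<in> L2 \<pi> \<Longrightarrow> (\<lambda>x. f x / c) \<in> L2 \<pi>"
  using L2_cmult[of f \<pi> "1 / c"] by simp

lemma L2_sum [simp, intro]: "(\<And>i. i \<in> I \<Longrightarrow> f i \<in> L2 \<pi>) \<Longrightarrow> (\<lambda>x. \<Sum>i\<in>I. f i x) \<in> L2 \<pi>"
  by (induction I rule: infinite_finite_induct) auto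

lemma L2_mult_integrable:
  assumes f: "f \<in> L2 \<pi>" and h: "h \<in> L2 \<pi>"
  shows "integrable \<pi> (\<lambda>x. f x * cnj (h x))"
proof (rule Bochner_Integration.integrable_bound)
  note [measurable] = L2_measurable[OF f] L2_measurable[OF h]
  show "integrable \<pi> (\<lambda>x. (cmod (f x))\<^sup>2 + (cmod (h x))\<^sup>2)"
    using L2_square_integrable[OF f] L2_square_integrable[OF h] by simp
  have "cmod (f x * cnj (h x)) \<le> (cmod (f x))\<^sup>2 + (cmod (h x))\<^sup>2" for x
  proof -
    have "2 * (cmod (f x) * cmod (h x)) \<le> (cmod (f x))\<^sup>2 + (cmod (h x))\<^sup>2"
      using sum_squares_bound[of "cmod (f x)" "cmod (h x)"] by simp
    moreover have "0 \<le> cmod (f x) * cmod (h x)" by simp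
    ultimately show ?thesis unfolding norm_mult complex_mod_cnj by linarith
  qed
  then show "AE x in \<pi>. norm (f x * cnj (h x)) \<le> norm ((cmod (f x))\<^sup>2 + (cmod (h x))\<^sup>2)"
    by (auto intro!: AE_I2 order_trans[OF _ abs_ge_self])
  show "(\<lambda>x. f x * cnj (h x)) \<in> borel_measurable \<pi>" by measurable
qed

lemma L2_inner_add_left [simp]:
  "f \<in> L2 \<pi> \<Longrightarrow> f' \<in> L2 \<pi> \<Longrightarrow> h \<in> L2 \<pi> \<Longrightarrow> L2_inner \<pi> (\<lambda>x. f x + f' x) h = L2_inner \<pi> f h + L2_inner \<pi> f' h"
  using L2_mult_integrable[of f \<pi> h] L2_mult_integrable[of f' \<pi> h]
  by (simp add: L2_inner_def distrib_right)

lemma L2_inner_cmult_left [simp]: "L2_inner \<pi> (\<lambda>x. c * f x) h = c * L2_inner \<pi> f h"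
  by (simp add: L2_inner_def mult.assoc)

lemma L2_inner_divide_left [simp]: "L2_inner \<pi> (\<lambda>x. f x / c) h = L2_inner \<pi> f h / c"
  using L2_inner_cmult_left[of \<pi> "1 / c" f h] by simp

lemma L2_inner_diff_left [simp]:
  "f \<in> L2 \<pi> \<Longrightarrow> f' \<in> L2 \<pi> \<Longrightarrow> h \<in> L2 \<pi> \<Longrightarrow> L2_inner \<pi> (\<lambda>x. f x - f' x) h = L2_inner \<pi> f h - L2_inner \<pi> f' h"
  using L2_mult_integrable[of f \<pi> h] L2_mult_integrable[of f' \<pi> h]
  by (simp add: L2_inner_def left_diff_distrib)

lemma L2_inner_zero_left [simp]: "L2_inner \<pi> (\<lambda>x. 0) h = 0"
  by (simp add: L2_inner_def)

lemma L2_inner_sum_left: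
  "finite I \<Longrightarrow> (\<And>i. i \<in> I \<Longrightarrow> f i \<in> L2 \<pi>) \<Longrightarrow> h \<in> L2 \<pi> \<Longrightarrow>
    L2_inner \<pi> (\<lambda>x. \<Sum>i\<in>I. f i x) h = (\<Sum>i\<in>I. L2_inner \<pi> (f i) h)"
  by (induction I rule: finite_induct) simp_all

lemma L2_inner_cnj: "L2_inner \<pi> f h = cnj (L2_inner \<pi> h f)"
  unfolding L2_inner_def by (subst Bochner_Integration.integral_cnj[symmetric]) (simp add: mult.commute)

lemma L2_inner_add_right [simp]:
  "f \<in> L2 \<pi> \<Longrightarrow> f' \<in> L2 \<pi> \<Longrightarrow> h \<in> L2 \<pi> \<Longrightarrow> L2_inner \<pi> h (\<lambda>x. f x + f' x) = L2_inner \<pi> h f + L2_inner \<pi> h f'"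
  by (simp add: L2_inner_cnj[of \<pi> h])

lemma L2_inner_cmult_right [simp]: "L2_inner \<pi> h (\<lambda>x. c * f x) = cnj c * L2_inner \<pi> h f"
  by (simp add: L2_inner_cnj[of \<pi> h])

lemma L2_inner_diff_right [simp]:
  "f \<in> L2 \<pi> \<Longrightarrow> f' \<in> L2 \<pi> \<Longrightarrow> h \<in> L2 \<pi> \<Longrightarrow> L2_inner \<pi> h (\<lambda>x. f x - f' x) = L2_inner \<pi> h f - L2_inner \<pi> h f'"
  by (simp add: L2_inner_cnj[of \<pi> h])

lemma L2_norm_nonneg [simp]: "0 \<le> L2_norm \<pi> f"
  by (simp add: L2_norm_def)

lemma L2_inner_self: "L2_inner \<pi> f f = of_real ((L2_norm \<pi> f)\<^sup>2)"
proof -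
  have "f x * cnj (f x) = of_real ((cmod (f x))\<^sup>2)" for x
    by (simp only: complex_norm_square)
  then have "L2_inner \<pi> f f = of_real (\<integral>x. (cmod (f x))\<^sup>2 \<partial>\<pi>)"
    unfolding L2_inner_def by (simp only: integral_complex_of_real)
  then show ?thesis by (simp add: L2_norm_def)
qed

lemma L2_norm_square: "(L2_norm \<pi> f)\<^sup>2 = Re (L2_inner \<pi> f f)"
  by (simp add: L2_inner_self)

lemma L2_Cauchy_Schwarz:
  assumes f: "f \<in> L2 \<pi>" and h: "h \<in> L2 \<pi>"
  shows "cmod (L2_inner \<pi> f h) \<le> L2_norm \<pi> f * L2_norm \<pi> h"
proof -
  define c where "c = L2_inner \<pi> f h"
  define A where "A = (L2_norm \<pi> h)\<^sup>2"
  have A: "A \<ge> 0" by (simp add: A_def)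
  have quad: "0 \<le> (L2_norm \<pi> f)\<^sup>2 - 2 * s * (cmod c)\<^sup>2 + s\<^sup>2 * (cmod c)\<^sup>2 * A" for s :: real
  proof -
    have "complex_of_real ((L2_norm \<pi> (\<lambda>x. f x - (of_real s * c) * h x))\<^sup>2)
       = of_real ((L2_norm \<pi> f)\<^sup>2) - of_real s * (c * cnj c) - of_real s * (c * cnj c) + of_real (s\<^sup>2) * (c * cnj c) * of_real A"
      unfolding L2_inner_self[symmetric] A_def using f h
      by (simp add: c_def[symmetric] L2_inner_cnj[of \<pi> h f] algebra_simps power2_eq_square)
    also have "\<dots> = of_real ((L2_norm \<pi> f)\<^sup>2 - 2 * s * (cmod c)\<^sup>2 + s\<^sup>2 * (cmod c)\<^sup>2 * A)"
      unfolding complex_norm_square[symmetric] by simp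
    finally show ?thesis by (metis of_real_eq_iff zero_le_power2)
  qed
  have "(cmod c)\<^sup>2 \<le> (L2_norm \<pi> f)\<^sup>2 * A"
  proof (cases "A = 0")
    case True
    have "(cmod c)\<^sup>2 = 0"
    proof (rule ccontr)
      assume nz: "(cmod c)\<^sup>2 \<noteq> 0"
      then have "0 \<le> (L2_norm \<pi> f)\<^sup>2 - ((L2_norm \<pi> f)\<^sup>2 + 1)"
        using quad[of "((L2_norm \<pi> f)\<^sup>2 + 1) / (2 * (cmod c)\<^sup>2)"] True by simp
      then show False by simp
    qed
    then show ?thesis by (simp add: True)
  next
    case False
    then have "0 \<le> (L2_norm \<pi> f)\<^sup>2 - (cmod c)\<^sup>2 / A"
      using quad[of "1 / A"] by (simp add: power2_eq_square)
    then show ?thesis using A False by (simp add: field_simps)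
  qed
  then have "(cmod c)\<^sup>2 \<le> (L2_norm \<pi> f * L2_norm \<pi> h)\<^sup>2"
    by (simp add: A_def power_mult_distrib)
  then show ?thesis
    unfolding c_def by (rule power2_le_imp_le) simp
qed

lemma L2_norm_cmult [simp]: "L2_norm \<pi> (\<lambda>x. c * f x) = cmod c * L2_norm \<pi> f"
  by (simp add: L2_norm_def norm_mult power_mult_distrib real_sqrt_mult)

lemma L2_norm_triangle:
  assumes f: "f \<in> L2 \<pi>" and h: "h \<in> L2 \<pi>"
  shows "L2_norm \<pi> (\<lambda>x. f x + h x) \<le> L2_norm \<pi> f + L2_norm \<pi> h"
proof (rule power2_le_imp_le)
  have "(L2_norm \<pi> (\<lambda>x. f x + h x))\<^sup>2 = (L2_norm \<pi> f)\<^sup>2 + (L2_norm \<pi> h)\<^sup>2 + 2 * Re (L2_inner \<pi> f h)"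
    unfolding L2_norm_square using f h by (simp add: L2_inner_cnj[of \<pi> h f])
  also have "\<dots> \<le> (L2_norm \<pi> f)\<^sup>2 + (L2_norm \<pi> h)\<^sup>2 + 2 * (L2_norm \<pi> f * L2_norm \<pi> h)"
    using order_trans[OF complex_Re_le_cmod L2_Cauchy_Schwarz[OF f h]] by simp
  finally show "(L2_norm \<pi> (\<lambda>x. f x + h x))\<^sup>2 \<le> (L2_norm \<pi> f + L2_norm \<pi> h)\<^sup>2"
    by (simp add: power2_sum)
qed simp

text \<open>
  Equality in the Hilbert space \<open>L\<^sup>2(\<pi>)\<close>, tested by inner products. The operators act on functions, not
  on classes modulo null functions, and most identities between them are known through their inner
  products; this relation is therefore easier to produce than equality almost everywhere.
\<close>

definition weak_eq :: "'s measure \<Rightarrow> ('s \<Rightarrow> complex) \<Rightarrow> ('s \<Rightarrow> complex) \<Rightarrow> bool" where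
  "weak_eq \<pi> f f' \<longleftrightarrow> f \<in> L2 \<pi> \<and> f' \<in> L2 \<pi> \<and> (\<forall>h\<in>L2 \<pi>. L2_inner \<pi> f h = L2_inner \<pi> f' h)"

lemma weak_eqD: "weak_eq \<pi> f f' \<Longrightarrow> h \<in> L2 \<pi> \<Longrightarrow> L2_inner \<pi> f h = L2_inner \<pi> f' h"
  by (simp add: weak_eq_def)

lemma weak_eqD_right: "weak_eq \<pi> f f' \<Longrightarrow> h \<in> L2 \<pi> \<Longrightarrow> L2_inner \<pi> h f = L2_inner \<pi> h f'"
  by (simp add: L2_inner_cnj[of \<pi> h] weak_eqD)

lemma weak_eq_L2: "weak_eq \<pi> f f' \<Longrightarrow> f \<in> L2 \<pi>" "weak_eq \<pi> f f' \<Longrightarrow> f' \<in> L2 \<pi>"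
  by (auto simp: weak_eq_def)

lemma weak_eq_norm:
  assumes "weak_eq \<pi> f f'"
  shows "L2_norm \<pi> f = L2_norm \<pi> f'"
proof -
  have "(L2_norm \<pi> f)\<^sup>2 = (L2_norm \<pi> f')\<^sup>2"
    unfolding L2_norm_square using assms
    by (simp add: weak_eqD weak_eqD_right weak_eq_L2)
  then show ?thesis by simp
qed

lemma AE_eq_imp_weak_eq:
  assumes "f \<in> L2 \<pi>" "f' \<in> L2 \<pi>" "AE x in \<pi>. f x = f' x"
  shows "weak_eq \<pi> f f'"
proof -
  have "L2_inner \<pi> f h = L2_inner \<pi> f' h" if h: "h \<in> L2 \<pi>" for h
  proof -
    note [measurable] = L2_measurable[OF assms(1)] L2_measurable[OF assms(2)] L2_measurable[OF h]
    show ?thesis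
      unfolding L2_inner_def using assms(3) by (intro integral_cong_AE) auto
  qed
  then show ?thesis using assms by (simp add: weak_eq_def)
qed

section \<open>Projection-valued measures\<close>

locale pvm =
  fixes \<pi> :: "'s measure" and E :: "complex set \<Rightarrow> ('s \<Rightarrow> complex) \<Rightarrow> ('s \<Rightarrow> complex)"
  assumes pvm: "projection_valued_measure \<pi> E"
begin

lemma E_L2 [simp, intro]: "B \<in> sets borel \<Longrightarrow> f \<in> L2 \<pi> \<Longrightarrow> E B f \<in> L2 \<pi>"
  using pvm by (auto simp: projection_valued_measure_def orthogonal_projection_def)

lemma E_selfadjoint:
  "B \<in> sets borel \<Longrightarrow> f \<in> L2 \<pi> \<Longrightarrow> h \<in> L2 \<pi> \<Longrightarrow> L2_inner \<pi> (E B f) h = L2_inner \<pi> f (E B h)"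
  using pvm by (auto simp: projection_valued_measure_def orthogonal_projection_def)

lemma E_inter:
  assumes "B \<in> sets borel" "C \<in> sets borel" "f \<in> L2 \<pi>"
  shows "weak_eq \<pi> (E B (E C f)) (E (B \<inter> C) f)"
proof -
  have "AE x in \<pi>. E (B \<inter> C) f x = E B (E C f) x"
    using pvm assms by (auto simp: projection_valued_measure_def)
  then show ?thesis
    using assms by (intro AE_eq_imp_weak_eq) auto
qed

lemma inner_E_E:
  assumes "B \<in> sets borel" "C \<in> sets borel" "f \<in> L2 \<pi>" "h \<in> L2 \<pi>"
  shows "L2_inner \<pi> (E B f) (E C h) = L2_inner \<pi> (E (B \<inter> C) f) h"
  using assms weak_eqD[OF E_inter[of C B f], of h]
  by (simp add: E_selfadjoint[symmetric] Int_commute)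

lemma E_empty: "f \<in> L2 \<pi> \<Longrightarrow> h \<in> L2 \<pi> \<Longrightarrow> L2_inner \<pi> (E {} f) h = 0"
proof -
  assume f: "f \<in> L2 \<pi>" and h: "h \<in> L2 \<pi>"
  have "AE x in \<pi>. E {} f x = (\<lambda>_. 0) x"
    using pvm f by (auto simp: projection_valued_measure_def)
  then have "weak_eq \<pi> (E {} f) (\<lambda>_. 0)"
    using f by (intro AE_eq_imp_weak_eq) auto
  then show ?thesis using weak_eqD[OF _ h] by fastforce
qed

lemma E_UNIV: "f \<in> L2 \<pi> \<Longrightarrow> weak_eq \<pi> (E UNIV f) f"
  using pvm by (intro AE_eq_imp_weak_eq) (auto simp: projection_valued_measure_def)

lemma E_partition_norm:
  assumes A: "\<And>i::nat. A i \<in> sets borel" "disjoint_family A" and f: "f \<in> L2 \<pi>"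
  shows "(\<lambda>n. L2_norm \<pi> (\<lambda>x. (\<Sum>i<n. E (A i) f x) - E (\<Union>i. A i) f x)) \<longlonglongrightarrow> 0"
  using pvm assms by (auto simp: projection_valued_measure_def image_subset_iff)

lemma E_partition:
  assumes A: "\<And>i::nat. A i \<in> sets borel" "disjoint_family A" and f: "f \<in> L2 \<pi>" and h: "h \<in> L2 \<pi>"
  shows "(\<lambda>i. L2_inner \<pi> (E (A i) f) h) sums L2_inner \<pi> (E (\<Union>i. A i) f) h"
  unfolding sums_def
proof (rule LIM_zero_cancel, rule Lim_null_comparison)
  have L2: "(\<lambda>x. \<Sum>i<n. E (A i) f x) \<in> L2 \<pi>" "E (\<Union>i. A i) f \<in> L2 \<pi>" for n
    using A f by auto
  show "\<forall>\<^sub>F n in sequentially. norm ((\<Sum>i<n. L2_inner \<pi> (E (A i) f) h) - L2_inner \<pi> (E (\<Union>i. A i) f) h)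
      \<le> L2_norm \<pi> (\<lambda>x. (\<Sum>i<n. E (A i) f x) - E (\<Union>i. A i) f x) * L2_norm \<pi> h"
  proof (intro always_eventually allI)
    fix n
    have "(\<Sum>i<n. L2_inner \<pi> (E (A i) f) h) - L2_inner \<pi> (E (\<Union>i. A i) f) h
       = L2_inner \<pi> (\<lambda>x. (\<Sum>i<n. E (A i) f x) - E (\<Union>i. A i) f x) h"
      using L2 h A f by (simp add: L2_inner_sum_left)
    also have "norm \<dots> \<le> L2_norm \<pi> (\<lambda>x. (\<Sum>i<n. E (A i) f x) - E (\<Union>i. A i) f x) * L2_norm \<pi> h"
      using L2 h by (intro L2_Cauchy_Schwarz) auto
    finally show "norm ((\<Sum>i<n. L2_inner \<pi> (E (A i) f) h) - L2_inner \<pi> (E (\<Union>i. A i) f) h)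
      \<le> L2_norm \<pi> (\<lambda>x. (\<Sum>i<n. E (A i) f x) - E (\<Union>i. A i) f x) * L2_norm \<pi> h" .
  qed
  show "(\<lambda>n. L2_norm \<pi> (\<lambda>x. (\<Sum>i<n. E (A i) f x) - E (\<Union>i. A i) f x) * L2_norm \<pi> h) \<longlonglongrightarrow> 0"
    by (rule tendsto_mult_left_zero[OF E_partition_norm[OF A f]])
qed

lemma E_disjoint_Un:
  assumes B: "B \<in> sets borel" "C \<in> sets borel" "B \<inter> C = {}" and f: "f \<in> L2 \<pi>" and h: "h \<in> L2 \<pi>"
  shows "L2_inner \<pi> (E (B \<union> C) f) h = L2_inner \<pi> (E B f) h + L2_inner \<pi> (E C f) h"
proof -
  have "(\<lambda>i. L2_inner \<pi> (E (binaryset B C i) f) h) sums L2_inner \<pi> (E (\<Union>i. binaryset B C i) f) h"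
    using B f h by (intro E_partition) (auto simp: binaryset_def disjoint_family_on_def)
  moreover have "(\<lambda>i. L2_inner \<pi> (E (binaryset B C i) f) h) sums (L2_inner \<pi> (E B f) h + L2_inner \<pi> (E C f) h)"
    by (rule binaryset_sums) (use f h in \<open>simp add: E_empty\<close>)
  ultimately show ?thesis by (metis UN_binaryset_eq sums_unique2)
qed

lemma inner_E_self: "B \<in> sets borel \<Longrightarrow> f \<in> L2 \<pi> \<Longrightarrow> L2_inner \<pi> (E B f) f = of_real ((L2_norm \<pi> (E B f))\<^sup>2)"
  using inner_E_E[of B B f f] by (simp add: L2_inner_self)

lemma sets_pvm_measure [simp, measurable_cong]: "sets (pvm_measure \<pi> E f) = sets borel"
  unfolding pvm_measure_def using sets.sigma_sets_eq[of "borel :: complex measure"]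
  by (subst sets_measure_of) auto

lemma space_pvm_measure [simp]: "space (pvm_measure \<pi> E f) = UNIV"
  unfolding pvm_measure_def by (simp add: space_measure_of)

lemma emeasure_pvm_measure:
  assumes f: "f \<in> L2 \<pi>" and B: "B \<in> sets borel"
  shows "emeasure (pvm_measure \<pi> E f) B = ennreal ((L2_norm \<pi> (E B f))\<^sup>2)"
proof -
  have "emeasure (pvm_measure \<pi> E f) B = ennreal (Re (L2_inner \<pi> (E B f) f))"
  proof (rule emeasure_measure_of[OF pvm_measure_def])
    show "positive (sets (pvm_measure \<pi> E f)) (\<lambda>B. ennreal (Re (L2_inner \<pi> (E B f) f)))"
      using f by (simp add: positive_def E_empty)
    show "countably_additive (sets (pvm_measure \<pi> E f)) (\<lambda>B. ennreal (Re (L2_inner \<pi> (E B f) f)))"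
    proof (rule countably_additiveI)
      fix A :: "nat \<Rightarrow> complex set"
      assume A: "range A \<subseteq> sets (pvm_measure \<pi> E f)" "disjoint_family A"
      then have "(\<lambda>i. L2_inner \<pi> (E (A i) f) f) sums L2_inner \<pi> (E (\<Union>i. A i) f) f"
        using f by (intro E_partition) auto
      then have sums: "(\<lambda>i. Re (L2_inner \<pi> (E (A i) f) f)) sums Re (L2_inner \<pi> (E (\<Union>i. A i) f) f)"
        by (rule sums_Re)
      have nonneg: "0 \<le> Re (L2_inner \<pi> (E (A i) f) f)" for i
        using A f by (subst inner_E_self) auto
      show "(\<Sum>i. ennreal (Re (L2_inner \<pi> (E (A i) f) f))) = ennreal (Re (L2_inner \<pi> (E (\<Union>i. A i) f) f))"
        by (subst suminf_ennreal2[OF nonneg sums_summable[OF sums]]) (simp add: sums_unique[OF sums, symmetric])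
    qed
  qed (use B in auto)
  then show ?thesis using f B by (simp add: inner_E_self)
qed

lemma finite_measure_pvm: "f \<in> L2 \<pi> \<Longrightarrow> finite_measure (pvm_measure \<pi> E f)"
  by (intro finite_measureI) (simp add: emeasure_pvm_measure)

lemma measure_pvm_measure:
  "f \<in> L2 \<pi> \<Longrightarrow> B \<in> sets borel \<Longrightarrow> measure (pvm_measure \<pi> E f) B = (L2_norm \<pi> (E B f))\<^sup>2"
  by (simp add: measure_def emeasure_pvm_measure)

definition in_range :: "complex set \<Rightarrow> ('s \<Rightarrow> complex) \<Rightarrow> bool" where
  "in_range B v \<longleftrightarrow> v \<in> L2 \<pi> \<and> weak_eq \<pi> (E B v) v"

lemma in_range_L2: "in_range B v \<Longrightarrow> v \<in> L2 \<pi>"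
  by (simp add: in_range_def)

lemma in_range_E: "B \<in> sets borel \<Longrightarrow> f \<in> L2 \<pi> \<Longrightarrow> in_range B (E B f)"
  using E_inter[of B B f] by (simp add: in_range_def)

lemma in_range_inner:
  assumes "in_range B v" "B \<in> sets borel" "C \<in> sets borel" "h \<in> L2 \<pi>"
  shows "L2_inner \<pi> v (E C h) = L2_inner \<pi> v (E (B \<inter> C) h)"
proof -
  have v: "v \<in> L2 \<pi>" "weak_eq \<pi> (E B v) v" using assms by (auto simp: in_range_def)
  have "L2_inner \<pi> v (E C h) = L2_inner \<pi> (E B v) (E C h)"
    using assms v by (intro weak_eqD[OF v(2), symmetric]) auto
  also have "\<dots> = L2_inner \<pi> (E (B \<inter> C) v) h"
    using assms v by (intro inner_E_E) auto
  also have "\<dots> = L2_inner \<pi> v (E (B \<inter> C) h)"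
    using assms v by (intro E_selfadjoint) auto
  finally show ?thesis .
qed

lemma in_range_iff:
  assumes "B \<in> sets borel"
  shows "in_range B v \<longleftrightarrow> v \<in> L2 \<pi> \<and> (\<forall>h\<in>L2 \<pi>. L2_inner \<pi> v (E B h) = L2_inner \<pi> v h)"
  using assms by (auto simp: in_range_def weak_eq_def E_selfadjoint)

lemma in_range_compl:
  assumes B: "B \<in> sets borel" and v: "v \<in> L2 \<pi>"
    and null: "\<And>h. h \<in> L2 \<pi> \<Longrightarrow> L2_inner \<pi> v (E (- B) h) = 0"
  shows "in_range B v"
proof -
  have "L2_inner \<pi> v (E B h) = L2_inner \<pi> v h" if h: "h \<in> L2 \<pi>" for h
  proof -
    have "L2_inner \<pi> (E (B \<union> - B) h) v = L2_inner \<pi> (E B h) v + L2_inner \<pi> (E (- B) h) v"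
      using B h v by (intro E_disjoint_Un) auto
    moreover have "L2_inner \<pi> (E (- B) h) v = 0"
      using null[OF h] by (simp add: L2_inner_cnj[of \<pi> _ v])
    moreover have "L2_inner \<pi> (E (B \<union> - B) h) v = L2_inner \<pi> h v"
      using weak_eqD[OF E_UNIV[OF h] v] by (simp add: Compl_partition)
    ultimately show ?thesis
      by (simp add: L2_inner_cnj[of \<pi> v])
  qed
  then show ?thesis using B v by (simp add: in_range_iff)
qed

lemma in_range_add:
  "B \<in> sets borel \<Longrightarrow> in_range B v \<Longrightarrow> in_range B w \<Longrightarrow> in_range B (\<lambda>x. v x + w x)"
  by (simp add: in_range_iff)

lemma in_range_cmult:
  "B \<in> sets borel \<Longrightarrow> in_range B v \<Longrightarrow> in_range B (\<lambda>x. c * v x)"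
  by (simp add: in_range_iff)

lemma in_range_diff:
  "B \<in> sets borel \<Longrightarrow> in_range B v \<Longrightarrow> in_range B w \<Longrightarrow> in_range B (\<lambda>x. v x - w x)"
  by (simp add: in_range_iff)

lemma in_range_mono:
  assumes "in_range B v" "B \<subseteq> C" "B \<in> sets borel" "C \<in> sets borel"
  shows "in_range C v"
  using assms in_range_inner[of B v C] by (auto simp: in_range_iff Int_absorb2)

lemma in_range_disjoint:
  assumes "in_range B v" "B \<inter> C = {}" "B \<in> sets borel" "C \<in> sets borel" "h \<in> L2 \<pi>"
  shows "L2_inner \<pi> v (E C h) = 0"
  using in_range_inner[of B v C h] assms E_empty[of h v]
  by (simp add: in_range_L2 L2_inner_cnj[of \<pi> v])

text \<open>
  Since \<open>E C\<close> and \<open>E B\<close> multiply to \<open>E (B \<inter> C)\<close>, projecting a vector restricts its spectral measure.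
\<close>

lemma pvm_measure_E:
  assumes f: "f \<in> L2 \<pi>" and B: "B \<in> sets borel" and v: "weak_eq \<pi> (E B f) v"
  shows "pvm_measure \<pi> E v = density (pvm_measure \<pi> E f) (indicator B)"
proof (rule measure_eqI)
  show "sets (pvm_measure \<pi> E v) = sets (density (pvm_measure \<pi> E f) (indicator B))" by simp
  fix C assume "C \<in> sets (pvm_measure \<pi> E v)"
  then have C: "C \<in> sets borel" by simp
  have vL2: "v \<in> L2 \<pi>" using v by (rule weak_eq_L2)
  have "L2_inner \<pi> (E C v) v = L2_inner \<pi> v (E C v)"
    using C vL2 by (rule E_selfadjoint) (rule vL2)
  also have "\<dots> = L2_inner \<pi> (E B f) (E C v)"
    using weak_eqD[OF v, of "E C v"] C vL2 by simp
  also have "\<dots> = L2_inner \<pi> (E (B \<inter> C) f) v"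
    using B C f vL2 by (rule inner_E_E)
  also have "\<dots> = L2_inner \<pi> (E (B \<inter> C) f) (E B f)"
    using B C f by (intro weak_eqD_right[OF v, symmetric]) auto
  also have "\<dots> = L2_inner \<pi> (E (B \<inter> C) f) f"
    using B C f by (simp add: inner_E_E Int_ac)
  finally have "L2_inner \<pi> (E C v) v = L2_inner \<pi> (E (B \<inter> C) f) f" .
  then have "(L2_norm \<pi> (E C v))\<^sup>2 = (L2_norm \<pi> (E (B \<inter> C) f))\<^sup>2"
    using B C f vL2 by (simp only: inner_E_self sets.Int of_real_eq_iff)
  moreover have "emeasure (density (pvm_measure \<pi> E f) (indicator B)) C = emeasure (pvm_measure \<pi> E f) (B \<inter> C)"
    using B C by (simp add: emeasure_density nn_integral_indicator' flip: indicator_inter_arith)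
  ultimately show "emeasure (pvm_measure \<pi> E v) C = emeasure (density (pvm_measure \<pi> E f) (indicator B)) C"
    using B C f vL2 by (simp add: emeasure_pvm_measure)
qed

lemma AE_pvm_measure_in_range:
  assumes "in_range B v" "B \<in> sets borel"
  shows "AE z in pvm_measure \<pi> E v. z \<in> B"
proof -
  have "L2_inner \<pi> (E (- B) v) v = 0"
    using in_range_disjoint[of B v "- B" v] assms by (simp add: in_range_L2 L2_inner_cnj[of \<pi> _ v])
  then have "(L2_norm \<pi> (E (- B) v))\<^sup>2 = 0"
    using inner_E_self[of "- B" v] assms by (simp add: in_range_L2)
  then have "- B \<in> null_sets (pvm_measure \<pi> E v)"
    using assms by (auto simp: null_sets_def emeasure_pvm_measure in_range_L2)
  then have "AE z in pvm_measure \<pi> E v. z \<notin> - B" by (rule AE_not_in)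
  then show ?thesis by simp
qed

lemma integral_pvm_measure_E:
  fixes F :: "complex \<Rightarrow> complex"
  assumes f: "f \<in> L2 \<pi>" and B: "B \<in> sets borel" and v: "weak_eq \<pi> (E B f) v"
    and [measurable]: "F \<in> borel_measurable borel"
  shows "(\<integral>z. F z \<partial>pvm_measure \<pi> E v) = (\<integral>z\<in>B. F z \<partial>pvm_measure \<pi> E f)"
proof -
  have "pvm_measure \<pi> E v = density (pvm_measure \<pi> E f) (\<lambda>z. ennreal (indicator B z))"
    unfolding pvm_measure_E[OF f B v] by (simp add: ennreal_indicator)
  then show ?thesis
    using B by (simp add: integral_density set_lebesgue_integral_def)
qed

end

section \<open>Contraction semigroups and their generators\<close>

text \<open>
  Mean value inequality with a comparison function, in the one-sided form that suits a semigroup,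
  which is not differentiable from the left at time \<open>0\<close>.
\<close>

lemma has_vector_derivative_bound_from_0:
  fixes f :: "real \<Rightarrow> complex" and p :: "real \<Rightarrow> real"
  assumes f: "\<And>s. 0 \<le> s \<Longrightarrow> (f has_vector_derivative f' s) (at s within {0..})"
    and p: "\<And>s. 0 \<le> s \<Longrightarrow> (p has_real_derivative p' s) (at s)"
    and bound: "\<And>s. 0 \<le> s \<Longrightarrow> s \<le> t \<Longrightarrow> cmod (f' s) \<le> p' s" and t: "0 \<le> t"
  shows "cmod (f t - f 0) \<le> p t - p 0"
proof (cases "t = 0")
  case False
  then have t: "0 < t" using t by simp
  show ?thesis
  proof (rule differentiable_bound_general[OF t])
    show "continuous_on {0..t} f"
      by (rule continuous_on_vector_derivative) (auto intro: has_vector_derivative_within_subset[OF f])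
    show "continuous_on {0..t} p"
      by (intro continuous_at_imp_continuous_on ballI) (auto intro: DERIV_isCont p)
    show "(f has_vector_derivative f' s) (at s)" if "0 < s" "s < t" for s
      using f[of s] that at_within_interior[of s "{0..}"] by (simp add: interior_real_atLeast)
    show "(p has_vector_derivative p' s) (at s)" if "0 < s" "s < t" for s
      using p[of s] that by (simp add: has_real_derivative_iff_has_vector_derivative)
  qed (auto intro: bound)
qed simp

text \<open>
  Linearity, the semigroup law and the initial condition hold weakly, which is all that the inner
  products \<open>\<langle>T\<^sub>t v, x\<rangle>\<close> can see and all that conditional expectations provide.
\<close>

locale contraction_semigroup =
  fixes \<pi> :: "'s measure" and T :: "real \<Rightarrow> ('s \<Rightarrow> complex) \<Rightarrow> ('s \<Rightarrow> complex)"
  assumes T_L2 [simp, intro]: "0 \<le> t \<Longrightarrow> f \<in> L2 \<pi> \<Longrightarrow> T t f \<in> L2 \<pi>"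
    and T_add: "0 \<le> t \<Longrightarrow> f \<in> L2 \<pi> \<Longrightarrow> h \<in> L2 \<pi> \<Longrightarrow> weak_eq \<pi> (T t (\<lambda>x. f x + h x)) (\<lambda>x. T t f x + T t h x)"
    and T_cmult: "0 \<le> t \<Longrightarrow> f \<in> L2 \<pi> \<Longrightarrow> weak_eq \<pi> (T t (\<lambda>x. c * f x)) (\<lambda>x. c * T t f x)"
    and T_contraction: "0 \<le> t \<Longrightarrow> f \<in> L2 \<pi> \<Longrightarrow> L2_norm \<pi> (T t f) \<le> L2_norm \<pi> f"
    and T_semigroup: "0 \<le> s \<Longrightarrow> 0 \<le> t \<Longrightarrow> f \<in> L2 \<pi> \<Longrightarrow> weak_eq \<pi> (T (s + t) f) (T s (T t f))"
    and T_0: "f \<in> L2 \<pi> \<Longrightarrow> weak_eq \<pi> (T 0 f) f"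
    and T_strong: "strongly_continuous \<pi> T"
begin

lemma inner_T_add:
  "0 \<le> t \<Longrightarrow> f \<in> L2 \<pi> \<Longrightarrow> h \<in> L2 \<pi> \<Longrightarrow> x \<in> L2 \<pi> \<Longrightarrow>
    L2_inner \<pi> (T t (\<lambda>x. f x + h x)) x = L2_inner \<pi> (T t f) x + L2_inner \<pi> (T t h) x"
  using weak_eqD[OF T_add] by simp

lemma inner_T_cmult:
  "0 \<le> t \<Longrightarrow> f \<in> L2 \<pi> \<Longrightarrow> x \<in> L2 \<pi> \<Longrightarrow> L2_inner \<pi> (T t (\<lambda>x. c * f x)) x = c * L2_inner \<pi> (T t f) x"
  using weak_eqD[OF T_cmult] by simp

lemma inner_T_diff:
  "0 \<le> t \<Longrightarrow> f \<in> L2 \<pi> \<Longrightarrow> h \<in> L2 \<pi> \<Longrightarrow> x \<in> L2 \<pi> \<Longrightarrow>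
    L2_inner \<pi> (T t (\<lambda>x. f x - h x)) x = L2_inner \<pi> (T t f) x - L2_inner \<pi> (T t h) x"
  using inner_T_add[of t f "\<lambda>x. - 1 * h x" x] inner_T_cmult[of t h x "- 1"] L2_cmult[of h \<pi> "- 1"] by simp

lemma inner_T_bound:
  "0 \<le> t \<Longrightarrow> f \<in> L2 \<pi> \<Longrightarrow> x \<in> L2 \<pi> \<Longrightarrow> cmod (L2_inner \<pi> (T t f) x) \<le> L2_norm \<pi> f * L2_norm \<pi> x"
  by (rule order_trans[OF L2_Cauchy_Schwarz mult_right_mono[OF T_contraction]]) auto

lemma inner_T_sum:
  assumes "finite I" "0 \<le> t" "\<And>i. i \<in> I \<Longrightarrow> f i \<in> L2 \<pi>" "x \<in> L2 \<pi>"
  shows "L2_inner \<pi> (T t (\<lambda>x. \<Sum>i\<in>I. f i x)) x = (\<Sum>i\<in>I. L2_inner \<pi> (T t (f i)) x)"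
  using assms
proof (induction I rule: finite_induct)
  case empty
  then show ?case using inner_T_cmult[of t "\<lambda>_. 0" x 0] by simp
next
  case (insert i I)
  then show ?case by (simp add: inner_T_add)
qed

lemma inner_T_cong:
  assumes "weak_eq \<pi> f f'" "0 \<le> t" "x \<in> L2 \<pi>"
  shows "L2_inner \<pi> (T t f) x = L2_inner \<pi> (T t f') x"
proof -
  have L2: "f \<in> L2 \<pi>" "f' \<in> L2 \<pi>" using assms by (auto dest: weak_eq_L2)
  have "(L2_norm \<pi> (\<lambda>x. f x - f' x))\<^sup>2 = 0"
    unfolding L2_norm_square using assms L2 by (simp add: weak_eqD)
  moreover have "cmod (L2_inner \<pi> (T t (\<lambda>x. f x - f' x)) x) \<le> L2_norm \<pi> (\<lambda>x. f x - f' x) * L2_norm \<pi> x"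
    using assms L2 by (intro inner_T_bound) auto
  ultimately show ?thesis using assms L2 by (simp add: inner_T_diff)
qed

lemma generator_L2: "(f, u) \<in> generator \<pi> T \<Longrightarrow> f \<in> L2 \<pi>" "(f, u) \<in> generator \<pi> T \<Longrightarrow> u \<in> L2 \<pi>"
  by (auto simp: generator_def)

lemma generator_limit:
  "(f, u) \<in> generator \<pi> T \<Longrightarrow>
    ((\<lambda>t. L2_norm \<pi> (\<lambda>x. (T t f x - f x) / of_real t - u x)) \<longlongrightarrow> 0) (at_right 0)"
  by (auto simp: generator_def)

lemma generator_add_cmult:
  assumes fu: "(f, u) \<in> generator \<pi> T" and hw: "(h, w) \<in> generator \<pi> T"
  shows "((\<lambda>x. f x + c * h x), (\<lambda>x. u x + c * w x)) \<in> generator \<pi> T"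
proof -
  have L2[simp]: "f \<in> L2 \<pi>" "u \<in> L2 \<pi>" "h \<in> L2 \<pi>" "w \<in> L2 \<pi>"
    using generator_L2[OF fu] generator_L2[OF hw] by auto
  let ?A = "\<lambda>t x. (T t f x - f x) / of_real t - u x" and ?B = "\<lambda>t x. (T t h x - h x) / of_real t - w x"
  let ?C = "\<lambda>t x. (T t (\<lambda>x. f x + c * h x) x - (f x + c * h x)) / of_real t - (u x + c * w x)"
  have "((\<lambda>t. L2_norm \<pi> (?C t)) \<longlongrightarrow> 0) (at_right 0)"
  proof (rule Lim_null_comparison[where g="\<lambda>t. L2_norm \<pi> (?A t) + cmod c * L2_norm \<pi> (?B t)"])
    show "((\<lambda>t. L2_norm \<pi> (?A t) + cmod c * L2_norm \<pi> (?B t)) \<longlongrightarrow> 0) (at_right 0)"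
      by (intro tendsto_add_zero tendsto_mult_right_zero generator_limit fu hw)
    show "\<forall>\<^sub>F t in at_right 0. norm (L2_norm \<pi> (?C t)) \<le> L2_norm \<pi> (?A t) + cmod c * L2_norm \<pi> (?B t)"
      using eventually_at_right_less[of 0]
    proof eventually_elim
      case (elim t)
      have "weak_eq \<pi> (?C t) (\<lambda>x. ?A t x + c * ?B t x)"
        unfolding weak_eq_def using elim
        by (auto intro!: L2_add L2_diff L2_divide L2_cmult T_L2 simp: inner_T_add inner_T_cmult)
           (simp add: field_simps)
      then have "L2_norm \<pi> (?C t) = L2_norm \<pi> (\<lambda>x. ?A t x + c * ?B t x)"
        by (rule weak_eq_norm)
      also have "\<dots> \<le> L2_norm \<pi> (?A t) + L2_norm \<pi> (\<lambda>x. c * ?B t x)"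
        using elim by (intro L2_norm_triangle) auto
      finally show ?case by simp
    qed
  qed
  then show ?thesis by (simp add: generator_def)
qed

lemma generator_cmult:
  assumes "(h, w) \<in> generator \<pi> T"
  shows "((\<lambda>x. c * h x), (\<lambda>x. c * w x)) \<in> generator \<pi> T"
  using generator_add_cmult[OF assms assms, of "c - 1"] by (simp add: algebra_simps)

lemma inner_T_increment:
  assumes vw: "(v, w) \<in> generator \<pi> T" and x: "x \<in> L2 \<pi>" and s: "0 \<le> s" and r: "0 < r"
  shows "cmod (L2_inner \<pi> (T (s + r) v) x - L2_inner \<pi> (T s v) x - of_real r * L2_inner \<pi> (T s w) x)
    \<le> r * L2_norm \<pi> (\<lambda>x. (T r v x - v x) / of_real r - w x) * L2_norm \<pi> x"
proof -
  have L2[simp]: "v \<in> L2 \<pi>" "w \<in> L2 \<pi>" "T r v \<in> L2 \<pi>"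
    using generator_L2[OF vw] r by auto
  let ?d = "\<lambda>x. of_real r * ((T r v x - v x) / of_real r - w x)"
  have d: "?d = (\<lambda>x. (T r v x - v x) - of_real r * w x)"
    using r by (auto simp: field_simps)
  have "L2_inner \<pi> (T (s + r) v) x = L2_inner \<pi> (T s (T r v)) x"
    using s r x by (intro weak_eqD[OF T_semigroup]) auto
  then have "L2_inner \<pi> (T (s + r) v) x - L2_inner \<pi> (T s v) x - of_real r * L2_inner \<pi> (T s w) x
      = L2_inner \<pi> (T s ?d) x"
    unfolding d using s x by (simp add: inner_T_diff inner_T_cmult)
  also have "cmod \<dots> \<le> L2_norm \<pi> ?d * L2_norm \<pi> x"
    using s x by (intro inner_T_bound) auto
  also have "L2_norm \<pi> ?d = r * L2_norm \<pi> (\<lambda>x. (T r v x - v x) / of_real r - w x)"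
    using r by (subst L2_norm_cmult) auto
  finally show ?thesis .
qed

lemma inner_T_continuity:
  assumes w: "w \<in> L2 \<pi>" and x: "x \<in> L2 \<pi>" and s: "0 \<le> s" and r: "0 \<le> r"
  shows "cmod (L2_inner \<pi> (T (s + r) w) x - L2_inner \<pi> (T s w) x) \<le> L2_norm \<pi> (\<lambda>x. T r w x - w x) * L2_norm \<pi> x"
proof -
  have "L2_inner \<pi> (T (s + r) w) x = L2_inner \<pi> (T s (T r w)) x"
    using s r x w by (intro weak_eqD[OF T_semigroup]) auto
  then have "L2_inner \<pi> (T (s + r) w) x - L2_inner \<pi> (T s w) x = L2_inner \<pi> (T s (\<lambda>x. T r w x - w x)) x"
    using s r x w by (simp add: inner_T_diff)
  also have "cmod \<dots> \<le> L2_norm \<pi> (\<lambda>x. T r w x - w x) * L2_norm \<pi> x"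
    using s r x w by (intro inner_T_bound) auto
  finally show ?thesis .
qed

text \<open>
  The generator is defined by a right derivative at time \<open>0\<close>. The semigroup law moves it to any time
  \<open>s\<close>; the left derivative at \<open>s\<close> is controlled by the right increment from the earlier time, at the price
  of comparing \<open>T\<^sub>t w\<close> with \<open>T\<^sub>s w\<close>, for which strong continuity is used.
\<close>

lemma inner_T_derivative:
  assumes vw: "(v, w) \<in> generator \<pi> T" and x: "x \<in> L2 \<pi>" and s: "0 \<le> s"
  shows "((\<lambda>t. L2_inner \<pi> (T t v) x) has_vector_derivative L2_inner \<pi> (T s w) x) (at s within {0..})"
proof -
  have L2: "v \<in> L2 \<pi>" "w \<in> L2 \<pi>"
    using generator_L2[OF vw] by auto
  let ?\<phi> = "\<lambda>t. L2_inner \<pi> (T t v) x" and ?\<psi> = "\<lambda>t. L2_inner \<pi> (T t w) x"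
  define e where "e r = L2_norm \<pi> (\<lambda>x. (T r v x - v x) / of_real r - w x)" for r
  define d where "d r = L2_norm \<pi> (\<lambda>x. T r w x - w x)" for r
  let ?n = "L2_norm \<pi> x"
  have step: "cmod (?\<phi> t - ?\<phi> s - of_real (t - s) * ?\<psi> s) / \<bar>t - s\<bar> \<le> (e \<bar>t - s\<bar> + d \<bar>t - s\<bar>) * ?n"
    if t: "0 \<le> t" "t \<noteq> s" for t
  proof (cases "s < t")
    case True
    have "cmod (?\<phi> t - ?\<phi> s - of_real (t - s) * ?\<psi> s) \<le> (t - s) * e (t - s) * ?n"
      using inner_T_increment[OF vw x s, of "t - s"] True by (simp add: e_def)
    also have "\<dots> \<le> (t - s) * ((e \<bar>t - s\<bar> + d \<bar>t - s\<bar>) * ?n)"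
      using True by (auto simp: mult.assoc d_def intro!: mult_left_mono mult_right_mono)
    finally show ?thesis using True by (simp add: pos_divide_le_eq mult.commute)
  next
    case False
    then have ts: "t < s" using t by simp
    have 1: "cmod (?\<phi> s - ?\<phi> t - of_real (s - t) * ?\<psi> t) \<le> (s - t) * e (s - t) * ?n"
      using inner_T_increment[OF vw x t(1), of "s - t"] ts by (simp add: e_def)
    have "cmod (?\<psi> s - ?\<psi> t) \<le> d (s - t) * ?n"
      using inner_T_continuity[OF L2(2) x t(1), of "s - t"] ts by (simp add: d_def)
    then have 2: "cmod (of_real (s - t) * (?\<psi> s - ?\<psi> t)) \<le> (s - t) * (d (s - t) * ?n)"
      unfolding norm_mult norm_of_real using ts by (auto intro!: mult_left_mono)
    have "?\<phi> t - ?\<phi> s - of_real (t - s) * ?\<psi> s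
      = of_real (s - t) * (?\<psi> s - ?\<psi> t) - (?\<phi> s - ?\<phi> t - of_real (s - t) * ?\<psi> t)"
      by (simp add: algebra_simps)
    then have "cmod (?\<phi> t - ?\<phi> s - of_real (t - s) * ?\<psi> s)
      = cmod (of_real (s - t) * (?\<psi> s - ?\<psi> t) - (?\<phi> s - ?\<phi> t - of_real (s - t) * ?\<psi> t))"
      by (rule arg_cong)
    also have "\<dots> \<le> (s - t) * (d (s - t) * ?n) + (s - t) * e (s - t) * ?n"
      by (rule order_trans[OF norm_triangle_ineq4 add_mono[OF 2 1]])
    finally have "cmod (?\<phi> t - ?\<phi> s - of_real (t - s) * ?\<psi> s) \<le> (s - t) * (d (s - t) * ?n) + (s - t) * e (s - t) * ?n" .
    then show ?thesis using ts by (simp add: pos_divide_le_eq algebra_simps)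
  qed
  have lim0: "((\<lambda>r. (e r + d r) * ?n) \<longlongrightarrow> 0) (at_right 0)"
    using generator_limit[OF vw] T_strong L2(2)
    by (intro tendsto_mult_left_zero tendsto_add_zero) (auto simp: e_def[abs_def] d_def[abs_def] strongly_continuous_def)
  have "filterlim (\<lambda>t. \<bar>t - s\<bar>) (at_right 0) (at s within {0..})"
    unfolding filterlim_at
    by (auto intro!: tendsto_eq_intros simp: eventually_at_filter)
  then have "((\<lambda>t. (e \<bar>t - s\<bar> + d \<bar>t - s\<bar>) * ?n) \<longlongrightarrow> 0) (at s within {0..})"
    by (rule filterlim_compose[OF lim0])
  then have "((\<lambda>t. cmod (?\<phi> t - ?\<phi> s - (t - s) *\<^sub>R ?\<psi> s) / norm (t - s)) \<longlongrightarrow> 0) (at s within {0..})"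
    by (rule Lim_null_comparison[rotated])
       (use step in \<open>auto simp: eventually_at_filter scaleR_conv_of_real\<close>)
  then show ?thesis
    unfolding has_vector_derivative_def has_derivative_iff_norm
    by (simp add: bounded_linear_scaleR_left)
qed

lemma generator_dissipative:
  assumes vw: "(v, w) \<in> generator \<pi> T"
  shows "Re (L2_inner \<pi> w v) \<le> 0"
proof (rule tendsto_lowerbound)
  have L2[simp]: "v \<in> L2 \<pi>" "w \<in> L2 \<pi>"
    using generator_L2[OF vw] by auto
  show "((\<lambda>r. L2_norm \<pi> (\<lambda>x. (T r v x - v x) / of_real r - w x) * L2_norm \<pi> v) \<longlongrightarrow> 0) (at_right 0)"
    by (intro tendsto_mult_left_zero generator_limit vw)
  show "\<forall>\<^sub>F r in at_right 0. Re (L2_inner \<pi> w v) \<le> L2_norm \<pi> (\<lambda>x. (T r v x - v x) / of_real r - w x) * L2_norm \<pi> v"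
    using eventually_at_right_less[of 0]
  proof eventually_elim
    case (elim r)
    have "Re (L2_inner \<pi> (T r v) v) \<le> L2_norm \<pi> v * L2_norm \<pi> v"
      using elim by (intro order_trans[OF complex_Re_le_cmod inner_T_bound]) auto
    then have "Re (L2_inner \<pi> (\<lambda>x. (T r v x - v x) / of_real r) v) \<le> 0"
      using elim by (simp add: L2_inner_self power2_eq_square divide_nonpos_pos)
    moreover have "Re (L2_inner \<pi> (\<lambda>x. (T r v x - v x) / of_real r) v) - Re (L2_inner \<pi> w v)
       = Re (L2_inner \<pi> (\<lambda>x. (T r v x - v x) / of_real r - w x) v)"
      using elim by simp
    moreover have "\<bar>Re (L2_inner \<pi> (\<lambda>x. (T r v x - v x) / of_real r - w x) v)\<bar>
       \<le> L2_norm \<pi> (\<lambda>x. (T r v x - v x) / of_real r - w x) * L2_norm \<pi> v"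
      using elim by (intro order_trans[OF abs_Re_le_cmod L2_Cauchy_Schwarz]) auto
    ultimately show ?case by linarith
  qed
qed simp

end

lemma cmod_exp_diff_le:
  fixes z w :: complex
  assumes "Re z \<le> 0" "Re w \<le> 0"
  shows "cmod (exp z - exp w) \<le> cmod (z - w)"
proof -
  have "cmod (exp z - exp w) \<le> 1 * cmod (z - w)"
  proof (rule field_differentiable_bound[where S="{z. Re z \<le> 0}"])
    show "convex {z. Re z \<le> 0}" by (rule convex_halfspace_Re_le)
    show "(exp has_field_derivative exp z) (at z within {z. Re z \<le> 0})" for z :: complex
      by (rule has_field_derivative_at_within[OF DERIV_exp])
  qed (use assms in auto)
  then show ?thesis by simp
qed

lemma sets_left_half_plane [measurable]: "left_half_plane \<in> sets borel"
  unfolding left_half_plane_def by (intro borel_closed closed_halfspace_Re_le)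

text \<open>
  A square grid of mesh \<open>\<delta> / 2\<close>. The centres stay in the half-plane so that \<open>|exp (c t)| \<le> 1\<close>.
\<close>

lemma left_half_plane_cells:
  fixes \<delta> :: real
  assumes "0 < \<delta>"
  shows "\<exists>c :: nat \<Rightarrow> complex. (\<forall>k. Re (c k) \<le> 0) \<and> left_half_plane \<subseteq> (\<Union>k. cball (c k) \<delta>)"
proof -
  define e where "e = \<delta> / 2"
  have e: "e > 0" using assms by (simp add: e_def)
  define c where "c k = (let (i, j) = from_nat k :: int \<times> int in Complex (- e * \<bar>of_int i\<bar>) (e * of_int j))" for k
  have "\<exists>k. z \<in> cball (c k) \<delta>" if z: "Re z \<le> 0" for z
  proof -
    define i j where "i = \<lfloor>- Re z / e\<rfloor>" and "j = \<lfloor>Im z / e\<rfloor>"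
    have "0 \<le> i" using z e by (simp add: i_def divide_nonpos_pos)
    then have c: "c (to_nat (i, j)) = Complex (- e * of_int i) (e * of_int j)"
      by (simp add: c_def)
    have "of_int i \<le> - Re z / e" "- Re z / e < of_int i + 1" "of_int j \<le> Im z / e" "Im z / e < of_int j + 1"
      unfolding i_def j_def by linarith+
    then have "\<bar>- e * of_int i - Re z\<bar> \<le> e" "\<bar>e * of_int j - Im z\<bar> \<le> e"
      using e by (auto simp: field_simps abs_le_iff)
    then have "cmod (c (to_nat (i, j)) - z) \<le> e + e"
      using cmod_le[of "c (to_nat (i, j)) - z"] unfolding c by simp
    then show ?thesis by (intro exI[of _ "to_nat (i, j)"]) (simp add: dist_norm e_def)
  qed
  moreover have "Re (c k) \<le> 0" for k
    using e by (auto simp: c_def split: prod.split)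
  ultimately show ?thesis
    by (intro exI[of _ c]) (auto simp: left_half_plane_def)
qed

section \<open>The spectral representation of a semigroup\<close>

locale resolved_semigroup = contraction_semigroup \<pi> T + pvm \<pi> E
  for \<pi> :: "'s measure" and T E +
  assumes resolution: "spectral_resolution \<pi> (generator \<pi> T) E"
begin

text \<open>
  The domain of \<open>L\<close> is described by second moments of spectral measures, and these are finite for
  spectral measures with bounded support.
\<close>

lemma in_generator_domain:
  assumes v: "in_range B v" and B: "B \<in> sets borel" "bounded B"
  obtains w where "(v, w) \<in> generator \<pi> T"
proof -
  have vL2: "v \<in> L2 \<pi>" using v by (rule in_range_L2)
  interpret finite_measure "pvm_measure \<pi> E v" by (rule finite_measure_pvm[OF vL2])
  obtain b where b: "\<And>z. z \<in> B \<Longrightarrow> cmod z \<le> b"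
    using B(2) by (auto simp: bounded_iff)
  have "integrable (pvm_measure \<pi> E v) (\<lambda>z. (cmod z)\<^sup>2)"
    using AE_pvm_measure_in_range[OF v B(1)]
    by (intro integrable_const_bound[where B="b\<^sup>2"]) (auto elim!: eventually_mono intro!: power_mono b)
  then have "v \<in> Domain (generator \<pi> T)"
    using resolution vL2 by (simp add: spectral_resolution_def)
  then show ?thesis using that by blast
qed

lemma generator_quadratic_form:
  assumes "(v, w) \<in> generator \<pi> T"
  shows "L2_inner \<pi> w v = (\<integral>z. z \<partial>pvm_measure \<pi> E v)"
  using resolution assms by (auto simp: spectral_resolution_def)

lemma integrable_identity:
  assumes "(v, w) \<in> generator \<pi> T"
  shows "integrable (pvm_measure \<pi> E v) (\<lambda>z. z)"
proof -
  have v: "v \<in> L2 \<pi>" using assms by (rule generator_L2)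
  interpret finite_measure "pvm_measure \<pi> E v" by (rule finite_measure_pvm[OF v])
  have "v \<in> Domain (generator \<pi> T)" using assms by auto
  then have "integrable (pvm_measure \<pi> E v) (\<lambda>z. (cmod z)\<^sup>2)"
    using resolution by (simp add: spectral_resolution_def)
  then have "integrable (pvm_measure \<pi> E v) (\<lambda>z. 1 + (cmod z)\<^sup>2)"
    by simp
  then show ?thesis
  proof (rule Bochner_Integration.integrable_bound)
    have "cmod z \<le> 1 + (cmod z)\<^sup>2" for z
    proof -
      have "2 * cmod z \<le> 1 + (cmod z)\<^sup>2"
        using sum_squares_bound[of 1 "cmod z"] by simp
      then show ?thesis using norm_ge_zero[of z] by linarith
    qed
    then show "AE z in pvm_measure \<pi> E v. norm z \<le> norm (1 + (cmod z)\<^sup>2)"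
      by (auto intro!: AE_I2 order_trans[OF _ abs_ge_self])
  qed simp
qed

text \<open>
  The resolution only gives the quadratic form \<open>\<langle>L f, f\<rangle>\<close>. The spectral measure of \<open>v + c h\<close> is the sum
  of its parts on the disjoint sets \<open>B\<close> and \<open>C\<close>, so the mixed terms of the quadratic form cancel for
  every scalar \<open>c\<close>.
\<close>

lemma generator_inner_disjoint:
  assumes v: "in_range B v" and h: "in_range C h" and disj: "B \<inter> C = {}"
    and B: "B \<in> sets borel" and C: "C \<in> sets borel"
    and vw: "(v, w) \<in> generator \<pi> T" and hk: "(h, k) \<in> generator \<pi> T"
  shows "L2_inner \<pi> w h = 0"
proof -
  have L2[simp]: "v \<in> L2 \<pi>" "w \<in> L2 \<pi>" "h \<in> L2 \<pi>" "k \<in> L2 \<pi>"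
    using generator_L2[OF vw] generator_L2[OF hk] by auto
  have cross: "cnj c * L2_inner \<pi> w h + c * L2_inner \<pi> k v = 0" for c
  proof -
    let ?f = "\<lambda>x. v x + c * h x" and ?u = "\<lambda>x. w x + c * k x"
    have fu: "(?f, ?u) \<in> generator \<pi> T" by (rule generator_add_cmult[OF vw hk])
    have fL2: "?f \<in> L2 \<pi>" by simp
    have EB: "weak_eq \<pi> (E B ?f) v"
      using B v in_range_disjoint[OF h _ C B] disj
      by (auto simp: weak_eq_def E_selfadjoint in_range_iff Int_commute)
    have EC: "weak_eq \<pi> (E C ?f) (\<lambda>x. c * h x)"
      using C h in_range_disjoint[OF v disj B C]
      by (auto simp: weak_eq_def E_selfadjoint in_range_iff)
    have f: "in_range (B \<union> C) ?f"
      using B C by (intro in_range_add in_range_cmult in_range_mono[OF v] in_range_mono[OF h]) auto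
    let ?m = "pvm_measure \<pi> E ?f"
    have int: "integrable ?m (\<lambda>z. z)" by (rule integrable_identity[OF fu])
    have "L2_inner \<pi> ?u ?f = (\<integral>z. z \<partial>?m)" by (rule generator_quadratic_form[OF fu])
    also have "\<dots> = (\<integral>z\<in>B \<union> C. z \<partial>?m)"
      unfolding set_lebesgue_integral_def
      using AE_pvm_measure_in_range[OF f] B C
      by (intro integral_cong_AE) (auto elim!: eventually_mono simp: indicator_def)
    also have "\<dots> = (\<integral>z\<in>B. z \<partial>?m) + (\<integral>z\<in>C. z \<partial>?m)"
      using disj B C int unfolding set_integrable_def
      by (intro set_integral_Un) (auto simp: set_integrable_def intro!: integrable_mult_indicator)
    also have "(\<integral>z\<in>B. z \<partial>?m) = L2_inner \<pi> w v"
      using integral_pvm_measure_E[OF fL2 B EB, of "\<lambda>z. z"] generator_quadratic_form[OF vw] by simp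
    also have "(\<integral>z\<in>C. z \<partial>?m) = L2_inner \<pi> (\<lambda>x. c * k x) (\<lambda>x. c * h x)"
      using integral_pvm_measure_E[OF fL2 C EC, of "\<lambda>z. z"] generator_quadratic_form[OF generator_cmult[OF hk, of c]] by simp
    finally show ?thesis by (simp add: distrib_left)
  qed
  \<comment> \<open>polarisation: the two values of \<open>c\<close> separate the linear from the antilinear term\<close>
  from cross[of 1] cross[of \<i>] show ?thesis
    by (simp add: complex_eq_iff)
qed

text \<open>
  \<open>L\<close> commutes with the resolution: \<open>L v\<close> is orthogonal to the ranges of all bounded pieces of the
  complement of \<open>B\<close>, and these pieces span the range of \<open>E (- B)\<close>.
\<close>

lemma in_range_generator:
  assumes v: "in_range B v" and B: "B \<in> sets borel" "bounded B" and vw: "(v, w) \<in> generator \<pi> T"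
  shows "in_range B w"
proof (rule in_range_compl[OF B(1)])
  show w: "w \<in> L2 \<pi>" using vw by (rule generator_L2)
  fix h assume h: "h \<in> L2 \<pi>"
  \<comment> \<open>bounded annuli exhaust the complement of \<open>B\<close>; vectors in their ranges lie in the domain of the generator\<close>
  define D where "D = (\<lambda>n. {z. real n \<le> cmod z \<and> cmod z < real n + 1} - B)"
  have D: "D n \<in> sets borel" "bounded (D n)" "B \<inter> D n = {}" for n
    using B by (auto simp: D_def bounded_iff intro!: exI[of _ "real n + 1"])
  have "disjoint_family D"
    unfolding D_def disjoint_family_on_def
  proof (intro ballI impI)
    fix m n :: nat assume "m \<noteq> n"
    then have "real m + 1 \<le> real n \<or> real n + 1 \<le> real m" by linarith
    then show "({z. real m \<le> cmod z \<and> cmod z < real m + 1} - B) \<inter> ({z. real n \<le> cmod z \<and> cmod z < real n + 1} - B) = {}"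
      by auto
  qed
  moreover have "(\<Union>n. D n) = - B"
  proof -
    have "\<exists>n. real n \<le> cmod z \<and> cmod z < real n + 1" for z
      by (intro exI[of _ "nat \<lfloor>cmod z\<rfloor>"]) (auto simp: of_nat_nat)
    then show ?thesis by (auto simp: D_def)
  qed
  ultimately have "(\<lambda>n. L2_inner \<pi> (E (D n) h) w) sums L2_inner \<pi> (E (- B) h) w"
    using E_partition[of D h w] D h w by auto
  moreover have "L2_inner \<pi> (E (D n) h) w = 0" for n
  proof -
    have r: "in_range (D n) (E (D n) h)" by (rule in_range_E[OF D(1) h])
    then obtain k where "(E (D n) h, k) \<in> generator \<pi> T"
      using D(1,2)[of n] by (rule in_generator_domain)
    then have "L2_inner \<pi> w (E (D n) h) = 0"
      by (rule generator_inner_disjoint[OF v r D(3) B(1) D(1) vw])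
    then show ?thesis by (subst L2_inner_cnj) simp
  qed
  ultimately have "L2_inner \<pi> (E (- B) h) w = 0"
    using sums_unique2[OF _ sums_zero] by simp
  then show "L2_inner \<pi> w (E (- B) h) = 0" by (subst L2_inner_cnj) simp
qed

text \<open>
  On the range of \<open>E B\<close> the quadratic form of \<open>A = L - z\<^sub>0\<close> is at most \<open>\<delta> \<parallel>f\<parallel>\<^sup>2\<close>, because the spectral
  measure of \<open>f\<close> sits within distance \<open>\<delta>\<close> of \<open>z\<^sub>0\<close>. Polarisation turns this into a bound for the
  operator with the usual loss of a factor \<open>2\<close>; it applies to \<open>v\<close> and \<open>A v\<close>, since both lie in the range.
\<close>

lemma generator_near_scalar:
  assumes v: "in_range B v" and B: "B \<in> sets borel" "B \<subseteq> cball z0 \<delta>" and \<delta>: "0 < \<delta>"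
    and vw: "(v, w) \<in> generator \<pi> T"
  shows "L2_norm \<pi> (\<lambda>x. w x - z0 * v x) \<le> 2 * \<delta> * L2_norm \<pi> v"
proof -
  have bdd: "bounded B" using B(2) by (rule bounded_subset[OF bounded_cball])
  have L2[simp]: "v \<in> L2 \<pi>" "w \<in> L2 \<pi>" using generator_L2[OF vw] by auto
  have form: "cmod (L2_inner \<pi> (\<lambda>x. u x - z0 * f x) f) \<le> \<delta> * (L2_norm \<pi> f)\<^sup>2"
    if f: "in_range B f" and fu: "(f, u) \<in> generator \<pi> T" for f u
  proof -
    have fL2: "f \<in> L2 \<pi>" "u \<in> L2 \<pi>" using generator_L2[OF fu] by auto
    interpret m: finite_measure "pvm_measure \<pi> E f" by (rule finite_measure_pvm[OF fL2(1)])
    have total: "measure (pvm_measure \<pi> E f) UNIV = (L2_norm \<pi> f)\<^sup>2"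
      using fL2 weak_eq_norm[OF E_UNIV] by (simp add: measure_pvm_measure)
    note int = integrable_identity[OF fu]
    have "L2_inner \<pi> (\<lambda>x. u x - z0 * f x) f = (\<integral>z. z \<partial>pvm_measure \<pi> E f) - z0 * of_real ((L2_norm \<pi> f)\<^sup>2)"
      using fL2 generator_quadratic_form[OF fu] by (simp add: L2_inner_self)
    also have "\<dots> = (\<integral>z. z - z0 \<partial>pvm_measure \<pi> E f)"
      using int by (simp add: total scaleR_conv_of_real mult.commute)
    also have "cmod \<dots> \<le> (\<integral>z. cmod (z - z0) \<partial>pvm_measure \<pi> E f)"
      by (rule integral_norm_bound)
    also have "\<dots> \<le> (\<integral>z. \<delta> \<partial>pvm_measure \<pi> E f)"
      using int AE_pvm_measure_in_range[OF f B(1)] B(2)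
      by (intro integral_mono_AE) (auto elim!: eventually_mono simp: dist_norm norm_minus_commute subset_eq)
    finally show ?thesis by (simp add: total mult.commute)
  qed
  define A where "A = (\<lambda>x. w x - z0 * v x)"
  have AL2[simp]: "A \<in> L2 \<pi>" by (simp add: A_def)
  have rA: "in_range B A"
    unfolding A_def using v in_range_generator[OF v B(1) bdd vw] B(1)
    by (intro in_range_diff in_range_cmult)
  obtain B' where AB: "(A, B') \<in> generator \<pi> T"
    using rA B(1) bdd by (rule in_generator_domain)
  have [simp]: "B' \<in> L2 \<pi>" using generator_L2[OF AB] by auto
  \<comment> \<open>this value of \<open>l\<close> balances \<open>\<parallel>v\<parallel>\<^sup>2\<close> against \<open>l\<^sup>2 \<parallel>A\<parallel>\<^sup>2\<close> in the polarised estimate\<close>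
  define l where "l = 1 / (2 * \<delta>)"
  have l: "l > 0" using \<delta> by (simp add: l_def)
  define X where "X = (\<lambda>x. B' x - z0 * A x)"
  have [simp]: "X \<in> L2 \<pi>" by (simp add: X_def)
  define Q where "Q c = L2_inner \<pi> (\<lambda>x. A x + c * X x) (\<lambda>x. v x + c * A x)" for c
  have q: "cmod (Q c) \<le> \<delta> * (L2_norm \<pi> (\<lambda>x. v x + c * A x))\<^sup>2" for c
  proof -
    have "(\<lambda>x. A x + c * X x) = (\<lambda>x. (w x + c * B' x) - z0 * (v x + c * A x))"
      by (auto simp: A_def X_def algebra_simps)
    then show ?thesis unfolding Q_def
      using form[OF in_range_add[OF B(1) v in_range_cmult[OF B(1) rA]] generator_add_cmult[OF vw AB]] by simp
  qed
  have Q: "Q c = L2_inner \<pi> A v + cnj c * L2_inner \<pi> A A + c * (L2_inner \<pi> X v + cnj c * L2_inner \<pi> X A)" for c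
    unfolding Q_def by simp
  have norm_sq: "(L2_norm \<pi> (\<lambda>x. v x + c * A x))\<^sup>2
      = (L2_norm \<pi> v)\<^sup>2 + Re (cnj c * L2_inner \<pi> v A) + Re (c * L2_inner \<pi> A v) + (cmod c)\<^sup>2 * (L2_norm \<pi> A)\<^sup>2" for c
  proof -
    have "complex_of_real ((L2_norm \<pi> (\<lambda>x. v x + c * A x))\<^sup>2)
      = of_real ((L2_norm \<pi> v)\<^sup>2) + cnj c * L2_inner \<pi> v A + c * L2_inner \<pi> A v + c * cnj c * of_real ((L2_norm \<pi> A)\<^sup>2)"
      unfolding L2_inner_self[symmetric] by (simp add: distrib_left)
    also have "c * cnj c = of_real ((cmod c)\<^sup>2)" by (rule complex_norm_square[symmetric])
    finally have "Re (complex_of_real ((L2_norm \<pi> (\<lambda>x. v x + c * A x))\<^sup>2))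
      = Re (of_real ((L2_norm \<pi> v)\<^sup>2) + cnj c * L2_inner \<pi> v A + c * L2_inner \<pi> A v + of_real ((cmod c)\<^sup>2) * of_real ((L2_norm \<pi> A)\<^sup>2))"
      by (rule arg_cong)
    then show ?thesis by (simp only: Re_complex_of_real plus_complex.sel flip: of_real_mult)
  qed
  have "4 * of_real l * L2_inner \<pi> A A = Q (of_real l) - Q (- of_real l) + \<i> * (Q (\<i> * of_real l) - Q (- \<i> * of_real l))"
    unfolding Q by (simp add: algebra_simps)
  also have "cmod \<dots> \<le> cmod (Q (of_real l)) + cmod (Q (- of_real l)) + (cmod (Q (\<i> * of_real l)) + cmod (Q (- \<i> * of_real l)))"
    by (intro order_trans[OF norm_triangle_ineq] add_mono norm_triangle_ineq4) (auto simp: norm_mult intro: norm_triangle_ineq4)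
  also have "\<dots> \<le> \<delta> * (L2_norm \<pi> (\<lambda>x. v x + of_real l * A x))\<^sup>2 + \<delta> * (L2_norm \<pi> (\<lambda>x. v x + (- of_real l) * A x))\<^sup>2
      + (\<delta> * (L2_norm \<pi> (\<lambda>x. v x + (\<i> * of_real l) * A x))\<^sup>2 + \<delta> * (L2_norm \<pi> (\<lambda>x. v x + (- \<i> * of_real l) * A x))\<^sup>2)"
    by (intro add_mono q)
  also have "\<dots> = 4 * \<delta> * ((L2_norm \<pi> v)\<^sup>2 + l\<^sup>2 * (L2_norm \<pi> A)\<^sup>2)"
    unfolding norm_sq by (simp add: algebra_simps norm_mult power2_eq_square)
  finally have "4 * l * (L2_norm \<pi> A)\<^sup>2 \<le> 4 * \<delta> * ((L2_norm \<pi> v)\<^sup>2 + l\<^sup>2 * (L2_norm \<pi> A)\<^sup>2)"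
    using l by (simp add: L2_inner_self norm_mult norm_power)
  then have "(L2_norm \<pi> A)\<^sup>2 \<le> (2 * \<delta> * L2_norm \<pi> v)\<^sup>2"
    using \<delta> by (simp add: l_def field_simps power2_eq_square)
  then show ?thesis
    unfolding A_def by (rule power2_le_imp_le) (use \<delta> in simp)
qed

text \<open>
  For \<open>x\<close> in the range of \<open>E (- B)\<close> all derivatives of \<open>t \<mapsto> \<langle>T\<^sub>t v, x\<rangle>\<close> vanish at \<open>0\<close> and the \<open>n\<close>-th one is
  at most \<open>c\<^sup>n \<parallel>v\<parallel> \<parallel>x\<parallel>\<close>, since \<open>L\<close> is bounded by \<open>c\<close> on the range of \<open>E B\<close>. So the function is bounded by
  \<open>(c t)\<^sup>n / n!\<close> for every \<open>n\<close> and vanishes.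
\<close>

lemma in_range_T:
  assumes v: "in_range B v" and B: "B \<in> sets borel" "B \<subseteq> cball z0 \<delta>" and \<delta>: "0 < \<delta>" and t: "0 \<le> t"
  shows "in_range B (T t v)"
proof (rule in_range_compl[OF B(1)])
  show "T t v \<in> L2 \<pi>" using v t by (auto dest: in_range_L2)
  fix h assume h: "h \<in> L2 \<pi>"
  have bdd: "bounded B" using B(2) by (rule bounded_subset[OF bounded_cball])
  define x where "x = E (- B) h"
  have x: "x \<in> L2 \<pi>" unfolding x_def using B h by auto
  define c where "c = 2 * \<delta> + cmod z0"
  have c: "c \<ge> 0" using \<delta> by (simp add: c_def)
  \<comment> \<open>\<open>\<langle>T\<^sub>t v, x\<rangle>\<close> vanishes at \<open>t = 0\<close> and has derivative \<open>\<langle>T\<^sub>t L v, x\<rangle>\<close> with \<open>L v\<close> again in the range\<close>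
  have bound: "cmod (L2_inner \<pi> (T t v) x) \<le> (c * t) ^ n / fact n * (L2_norm \<pi> v * L2_norm \<pi> x)"
    if "in_range B v" "0 \<le> t" for v t n
    using that
  proof (induction n arbitrary: v t)
    case 0
    then show ?case by (auto intro!: inner_T_bound x dest: in_range_L2)
  next
    case (Suc n)
    have vL2: "v \<in> L2 \<pi>" using Suc.prems(1) by (rule in_range_L2)
    obtain w where vw: "(v, w) \<in> generator \<pi> T"
      using Suc.prems(1) B(1) bdd by (rule in_generator_domain)
    have wL2: "w \<in> L2 \<pi>" using generator_L2[OF vw] by simp
    have rw: "in_range B w" by (rule in_range_generator[OF Suc.prems(1) B(1) bdd vw])
    have "L2_norm \<pi> w \<le> L2_norm \<pi> (\<lambda>x. w x - z0 * v x) + L2_norm \<pi> (\<lambda>x. z0 * v x)"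
      using L2_norm_triangle[of "\<lambda>x. w x - z0 * v x" \<pi> "\<lambda>x. z0 * v x"] vL2 wL2 by simp
    then have w: "L2_norm \<pi> w \<le> c * L2_norm \<pi> v"
      using generator_near_scalar[OF Suc.prems(1) B \<delta> vw] by (simp add: c_def algebra_simps)
    define K where "K = L2_norm \<pi> v * L2_norm \<pi> x"
    have "L2_inner \<pi> (T 0 v) x = 0"
    proof -
      have "L2_inner \<pi> (T 0 v) x = L2_inner \<pi> v x"
        using weak_eqD[OF T_0[OF vL2] x] .
      also have "\<dots> = 0"
        unfolding x_def using B(1) h by (intro in_range_disjoint[OF Suc.prems(1)]) auto
      finally show ?thesis .
    qed
    moreover have "cmod (L2_inner \<pi> (T t v) x - L2_inner \<pi> (T 0 v) x)
       \<le> c ^ Suc n * t ^ Suc n / fact (Suc n) * K - c ^ Suc n * 0 ^ Suc n / fact (Suc n) * K"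
    proof (rule has_vector_derivative_bound_from_0)
      fix s :: real assume s: "0 \<le> s"
      show "((\<lambda>t. L2_inner \<pi> (T t v) x) has_vector_derivative L2_inner \<pi> (T s w) x) (at s within {0..})"
        by (rule inner_T_derivative[OF vw x s])
      show "((\<lambda>t. c ^ Suc n * t ^ Suc n / fact (Suc n) * K) has_real_derivative c ^ Suc n * s ^ n / fact n * K) (at s)"
        by (rule derivative_eq_intros refl | simp)+
      have "cmod (L2_inner \<pi> (T s w) x) \<le> (c * s) ^ n / fact n * (L2_norm \<pi> w * L2_norm \<pi> x)"
        by (rule Suc.IH[OF rw s])
      also have "\<dots> \<le> (c * s) ^ n / fact n * (c * L2_norm \<pi> v * L2_norm \<pi> x)"
        using c s w by (intro mult_left_mono mult_right_mono) auto
      finally show "cmod (L2_inner \<pi> (T s w) x) \<le> c ^ Suc n * s ^ n / fact n * K"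
        by (simp add: K_def power_mult_distrib mult_ac)
    qed (rule Suc.prems(2))
    ultimately show ?case by (simp add: K_def power_mult_distrib mult_ac)
  qed
  have "(\<lambda>n. (c * t) ^ n / fact n * (L2_norm \<pi> v * L2_norm \<pi> x)) \<longlonglongrightarrow> 0"
    using summable_LIMSEQ_zero[OF summable_exp[of "c * t"]]
    by (intro tendsto_mult_left_zero) (simp add: divide_inverse mult.commute)
  then have "cmod (L2_inner \<pi> (T t v) x) \<le> 0"
    by (rule LIMSEQ_le_const) (use bound[OF v t] in auto)
  then show "L2_inner \<pi> (T t v) (E (- B) h) = 0" by (simp add: x_def)
qed

text \<open>
  The derivative of \<open>exp (- z\<^sub>0 t) \<langle>T\<^sub>t v, v\<rangle>\<close> contains only \<open>L - z\<^sub>0\<close>, which is small on \<open>v\<close>.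
\<close>

lemma inner_T_near_exp:
  assumes v: "in_range B v" and B: "B \<in> sets borel" "B \<subseteq> cball z0 \<delta>" and \<delta>: "0 < \<delta>" and t: "0 \<le> t"
    and z0: "Re z0 \<le> 0"
  shows "cmod (L2_inner \<pi> (T t v) v - exp (z0 * of_real t) * of_real ((L2_norm \<pi> v)\<^sup>2)) \<le> 2 * \<delta> * t * (L2_norm \<pi> v)\<^sup>2"
proof -
  have bdd: "bounded B" using B(2) by (rule bounded_subset[OF bounded_cball])
  obtain w where vw: "(v, w) \<in> generator \<pi> T"
    using v B(1) bdd by (rule in_generator_domain)
  have L2[simp]: "v \<in> L2 \<pi>" "w \<in> L2 \<pi>" using generator_L2[OF vw] by auto
  let ?\<psi> = "\<lambda>s. exp (- z0 * of_real s) * L2_inner \<pi> (T s v) v"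
  let ?K = "exp (- Re z0 * t) * (2 * \<delta> * (L2_norm \<pi> v)\<^sup>2)"
  have "cmod (?\<psi> t - ?\<psi> 0) \<le> t * ?K - 0 * ?K"
  proof (rule has_vector_derivative_bound_from_0[where p="\<lambda>t. t * ?K" and p'="\<lambda>_. ?K"])
    fix s :: real assume s: "0 \<le> s"
    have "((\<lambda>s. exp (- z0 * of_real s)) has_vector_derivative - z0 * exp (- z0 * of_real s)) (at s within {0..})"
      by (rule has_vector_derivative_real_field) (auto intro!: derivative_eq_intros)
    from has_vector_derivative_mult[OF this inner_T_derivative[OF vw L2(1) s]]
    show "(?\<psi> has_vector_derivative exp (- z0 * of_real s) * L2_inner \<pi> (T s (\<lambda>x. w x - z0 * v x)) v) (at s within {0..})"
      using s by (simp add: inner_T_diff inner_T_cmult algebra_simps)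
    show "((\<lambda>t. t * ?K) has_real_derivative ?K) (at s)"
      by (auto intro!: derivative_eq_intros)
    assume "s \<le> t"
    then have "exp (- Re z0 * s) \<le> exp (- Re z0 * t)"
      using z0 by (simp add: mult_left_mono_neg)
    moreover have "cmod (L2_inner \<pi> (T s (\<lambda>x. w x - z0 * v x)) v) \<le> 2 * \<delta> * L2_norm \<pi> v * L2_norm \<pi> v"
      using s by (intro order_trans[OF inner_T_bound mult_right_mono[OF generator_near_scalar[OF v B \<delta> vw]]]) auto
    ultimately show "cmod (exp (- z0 * of_real s) * L2_inner \<pi> (T s (\<lambda>x. w x - z0 * v x)) v) \<le> ?K"
      unfolding norm_mult by (intro mult_mono) (auto simp: power2_eq_square)
  qed (rule t)
  moreover have "?\<psi> 0 = of_real ((L2_norm \<pi> v)\<^sup>2)"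
    using weak_eqD[OF T_0[OF L2(1)] L2(1)] by (simp add: L2_inner_self)
  ultimately have "cmod (?\<psi> t - of_real ((L2_norm \<pi> v)\<^sup>2)) \<le> t * ?K" by simp
  then have "cmod (exp (z0 * of_real t)) * cmod (?\<psi> t - of_real ((L2_norm \<pi> v)\<^sup>2)) \<le> cmod (exp (z0 * of_real t)) * (t * ?K)"
    by (intro mult_left_mono) auto
  moreover have "cmod (exp (z0 * of_real t)) * (t * ?K) = 2 * \<delta> * t * (L2_norm \<pi> v)\<^sup>2"
    by (simp add: exp_minus)
  moreover have "exp (z0 * of_real t) * (?\<psi> t - of_real ((L2_norm \<pi> v)\<^sup>2))
     = L2_inner \<pi> (T t v) v - exp (z0 * of_real t) * of_real ((L2_norm \<pi> v)\<^sup>2)"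
    by (simp add: algebra_simps exp_minus)
  ultimately show ?thesis by (metis norm_mult)
qed

text \<open>
  For a bounded set \<open>B\<close> in the open right half-plane, \<open>Re \<langle>L v, v\<rangle>\<close> with \<open>v = E(B) g\<close> is the integral over \<open>B\<close>
  of the positive function \<open>Re z\<close>, whereas the generator of a contraction semigroup is dissipative. So
  \<open>B\<close> is a null set.
\<close>

lemma AE_spectral_measure_left_half_plane:
  assumes g: "g \<in> L2 \<pi>"
  shows "AE z in pvm_measure \<pi> E g. Re z \<le> 0"
proof -
  define B where "B n = {z. 0 < Re z \<and> cmod z \<le> real n}" for n
  have "{z::complex. 0 < Re z} \<in> sets borel"
    by (intro borel_open open_halfspace_Re_gt)
  moreover have "{z::complex. cmod z \<le> real n} \<in> sets borel" for n
    by (intro borel_closed closed_Collect_le continuous_intros)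
  moreover have "B n = {z. 0 < Re z} \<inter> {z. cmod z \<le> real n}" for n
    by (auto simp: B_def)
  ultimately have B: "B n \<in> sets borel" "bounded (B n)" for n
    by (auto simp: bounded_iff)
  let ?m = "pvm_measure \<pi> E g"
  interpret finite_measure ?m by (rule finite_measure_pvm[OF g])
  have "AE z in ?m. z \<notin> B n" for n
  proof -
    let ?v = "E (B n) g"
    obtain w where vw: "(?v, w) \<in> generator \<pi> T"
      using in_range_E[OF B(1) g] B by (rule in_generator_domain)
    have int: "set_integrable ?m (B n) (\<lambda>z. z)"
      unfolding set_integrable_def using B
      by (intro integrable_const_bound[where B="real n"]) (auto simp: B_def indicator_def)
    have "weak_eq \<pi> ?v ?v" using B g by (simp add: weak_eq_def)
    then have "L2_inner \<pi> w ?v = (\<integral>z\<in>B n. z \<partial>?m)"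
      using generator_quadratic_form[OF vw] integral_pvm_measure_E[OF g B(1), where F="\<lambda>z. z"] by simp
    then have "Re (\<integral>z\<in>B n. z \<partial>?m) \<le> 0"
      using generator_dissipative[OF vw] by simp
    also have "Re (\<integral>z\<in>B n. z \<partial>?m) = (\<integral>z. indicator (B n) z * Re z \<partial>?m)"
      using int unfolding set_lebesgue_integral_def set_integrable_def by (subst integral_Re[symmetric]) auto
    finally have le: "(\<integral>z. indicator (B n) z * Re z \<partial>?m) \<le> 0" .
    have nonneg: "0 \<le> indicator (B n) z * Re z" for z
      by (auto simp: B_def indicator_def)
    have "integrable ?m (\<lambda>z. indicator (B n) z * Re z)"
      using integrable_Re[OF int[unfolded set_integrable_def]] by simp
    moreover have "(\<integral>z. indicator (B n) z * Re z \<partial>?m) = 0"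
      using le nonneg by (intro antisym integral_nonneg_AE) auto
    ultimately have "AE z in ?m. indicator (B n) z * Re z = 0"
      using nonneg by (subst (asm) integral_nonneg_eq_0_iff_AE) auto
    then show ?thesis
      by (auto elim!: eventually_mono simp: B_def indicator_def split: if_splits)
  qed
  then have "AE z in ?m. \<forall>n. z \<notin> B n" by (simp add: AE_all_countable)
  then show ?thesis
  proof eventually_elim
    case (elim z)
    obtain n :: nat where "cmod z \<le> n" using real_arch_simple by blast
    then show ?case using elim by (auto simp: B_def not_less)
  qed
qed

lemma T_partition:
  assumes A: "\<And>i::nat. A i \<in> sets borel" "disjoint_family A" and f: "f \<in> L2 \<pi>" and h: "h \<in> L2 \<pi>" and t: "0 \<le> t"
  shows "(\<lambda>i. L2_inner \<pi> (T t (E (A i) f)) h) sums L2_inner \<pi> (T t (E (\<Union>i. A i) f)) h"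
  unfolding sums_def
proof (rule LIM_zero_cancel, rule Lim_null_comparison)
  have L2: "(\<lambda>x. \<Sum>i<n. E (A i) f x) \<in> L2 \<pi>" "E (\<Union>i. A i) f \<in> L2 \<pi>" for n
    using A f by auto
  show "\<forall>\<^sub>F n in sequentially. norm ((\<Sum>i<n. L2_inner \<pi> (T t (E (A i) f)) h) - L2_inner \<pi> (T t (E (\<Union>i. A i) f)) h)
      \<le> L2_norm \<pi> (\<lambda>x. (\<Sum>i<n. E (A i) f x) - E (\<Union>i. A i) f x) * L2_norm \<pi> h"
  proof (intro always_eventually allI)
    fix n
    have "(\<Sum>i<n. L2_inner \<pi> (T t (E (A i) f)) h) - L2_inner \<pi> (T t (E (\<Union>i. A i) f)) h
       = L2_inner \<pi> (T t (\<lambda>x. (\<Sum>i<n. E (A i) f x) - E (\<Union>i. A i) f x)) h"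
      using L2 h A f t by (simp add: inner_T_sum inner_T_diff)
    also have "norm \<dots> \<le> L2_norm \<pi> (\<lambda>x. (\<Sum>i<n. E (A i) f x) - E (\<Union>i. A i) f x) * L2_norm \<pi> h"
      using L2 h t by (intro inner_T_bound) auto
    finally show "norm ((\<Sum>i<n. L2_inner \<pi> (T t (E (A i) f)) h) - L2_inner \<pi> (T t (E (\<Union>i. A i) f)) h)
      \<le> L2_norm \<pi> (\<lambda>x. (\<Sum>i<n. E (A i) f x) - E (\<Union>i. A i) f x) * L2_norm \<pi> h" .
  qed
  show "(\<lambda>n. L2_norm \<pi> (\<lambda>x. (\<Sum>i<n. E (A i) f x) - E (\<Union>i. A i) f x) * L2_norm \<pi> h) \<longlonglongrightarrow> 0"
    by (rule tendsto_mult_left_zero[OF E_partition_norm[OF A f]])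
qed

lemma integrable_exp_left_half_plane:
  assumes g: "g \<in> L2 \<pi>" and t: "0 \<le> t" and A: "A \<in> sets borel" "A \<subseteq> left_half_plane"
  shows "set_integrable (pvm_measure \<pi> E g) A (\<lambda>z. exp (z * of_real t))"
proof -
  interpret finite_measure "pvm_measure \<pi> E g" by (rule finite_measure_pvm[OF g])
  have "cmod (indicator A z *\<^sub>R exp (z * of_real t)) \<le> 1" for z
    using A(2) t by (auto simp: indicator_def left_half_plane_def mult_nonpos_nonneg)
  moreover have "(\<lambda>z. exp (z * complex_of_real t)) \<in> borel_measurable borel"
    by (intro borel_measurable_continuous_onI continuous_intros)
  ultimately show ?thesis
    unfolding set_integrable_def using A(1) by (intro integrable_const_bound[where B=1]) auto
qed

lemma inner_T_cell:
  assumes g: "g \<in> L2 \<pi>" and t: "0 \<le> t" and \<delta>: "0 < \<delta>" and z0: "Re z0 \<le> 0"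
    and A: "A \<in> sets borel" "A \<subseteq> left_half_plane" "A \<subseteq> cball z0 \<delta>"
  shows "cmod (L2_inner \<pi> (T t (E A g)) g - (\<integral>z\<in>A. exp (z * of_real t) \<partial>pvm_measure \<pi> E g))
    \<le> 3 * \<delta> * t * measure (pvm_measure \<pi> E g) A"
proof -
  let ?m = "pvm_measure \<pi> E g"
  interpret finite_measure ?m by (rule finite_measure_pvm[OF g])
  let ?v = "E A g"
  have v: "?v \<in> L2 \<pi>" "in_range A ?v" using A g by (auto intro: in_range_E)
  have m: "measure ?m A = (L2_norm \<pi> ?v)\<^sup>2" using A g by (simp add: measure_pvm_measure)
  have "L2_inner \<pi> (T t ?v) g = L2_inner \<pi> (T t ?v) ?v"
    using in_range_T[OF v(2) A(1,3) \<delta> t] g A(1) by (simp add: in_range_iff)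
  then have 1: "cmod (L2_inner \<pi> (T t ?v) g - exp (z0 * of_real t) * of_real (measure ?m A)) \<le> 2 * \<delta> * t * measure ?m A"
    using inner_T_near_exp[OF v(2) A(1,3) \<delta> t z0] by (simp add: m)
  note int = integrable_exp_left_half_plane[OF g t A(1,2)]
  have int0: "set_integrable ?m A (\<lambda>z. exp (z0 * complex_of_real t))"
    unfolding set_integrable_def using A(1)
    by (intro integrable_scaleR_left integrable_real_indicator) (auto simp: less_top[symmetric])
  have "(\<integral>z\<in>A. exp (z0 * complex_of_real t) \<partial>?m) = exp (z0 * of_real t) * of_real (measure ?m A)"
    using A(1) by (simp add: set_lebesgue_integral_def scaleR_conv_of_real mult.commute)
  then have "(\<integral>z\<in>A. exp (z * of_real t) \<partial>?m) - exp (z0 * of_real t) * of_real (measure ?m A)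
     = (\<integral>z\<in>A. exp (z * of_real t) - exp (z0 * complex_of_real t) \<partial>?m)"
    using set_integral_diff(2)[OF int int0] by simp
  also have "cmod \<dots> \<le> (\<integral>z. indicator A z * (\<delta> * t) \<partial>?m)"
    unfolding set_lebesgue_integral_def
  proof (rule Bochner_Integration.integral_norm_bound_integral)
    show "integrable ?m (\<lambda>z. indicator A z *\<^sub>R (exp (z * of_real t) - exp (z0 * complex_of_real t)))"
      using set_integral_diff(1)[OF int int0] by (simp add: set_integrable_def)
    show "integrable ?m (\<lambda>z. indicator A z * (\<delta> * t))"
      using A(1) by (intro integrable_mult_left integrable_real_indicator) (auto simp: less_top[symmetric])
    fix z
    show "norm (indicator A z *\<^sub>R (exp (z * of_real t) - exp (z0 * complex_of_real t))) \<le> indicator A z * (\<delta> * t)"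
    proof (cases "z \<in> A")
      case True
      then have "Re z \<le> 0" "cmod (z - z0) \<le> \<delta>"
        using A by (auto simp: left_half_plane_def dist_norm norm_minus_commute)
      have "cmod (exp (z * of_real t) - exp (z0 * of_real t)) \<le> cmod (z * of_real t - z0 * of_real t)"
        using \<open>Re z \<le> 0\<close> z0 t by (intro cmod_exp_diff_le) (auto simp: mult_nonpos_nonneg)
      also have "\<dots> = cmod (z - z0) * t"
        using t by (simp flip: left_diff_distrib add: norm_mult)
      also have "\<dots> \<le> \<delta> * t"
        using \<open>cmod (z - z0) \<le> \<delta>\<close> t by (intro mult_right_mono)
      finally show ?thesis using True by simp
    qed simp
  qed
  also have "\<dots> = \<delta> * t * measure ?m A"
    using A(1) by simp
  finally have 2: "cmod ((\<integral>z\<in>A. exp (z * of_real t) \<partial>?m) - exp (z0 * of_real t) * of_real (measure ?m A)) \<le> \<delta> * t * measure ?m A" .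
  show ?thesis
    using norm_triangle_ineq4[of "L2_inner \<pi> (T t ?v) g - exp (z0 * of_real t) * of_real (measure ?m A)"
        "(\<integral>z\<in>A. exp (z * of_real t) \<partial>?m) - exp (z0 * of_real t) * of_real (measure ?m A)"] 1 2
    by (simp add: algebra_simps)
qed

text \<open>
  The spectral theorem for the semigroup. Cutting the half-plane into cells of radius \<open>\<delta>\<close> and adding the
  cellwise errors gives a total error of at most \<open>3 \<delta> t \<nu>(\<complex>)\<close>, for every \<open>\<delta> > 0\<close>.
\<close>

lemma inner_T_spectral:
  assumes g: "g \<in> L2 \<pi>" and t: "0 \<le> t"
  shows "L2_inner \<pi> (T t g) g = (\<integral>z\<in>left_half_plane. exp (z * of_real t) \<partial>pvm_measure \<pi> E g)"
proof -
  let ?m = "pvm_measure \<pi> E g"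
  interpret finite_measure ?m by (rule finite_measure_pvm[OF g])
  let ?I = "\<lambda>A. \<integral>z\<in>A. exp (z * of_real t) \<partial>?m"
  let ?H = "left_half_plane"
  have bound: "cmod (L2_inner \<pi> (T t (E ?H g)) g - ?I ?H) \<le> 3 * \<delta> * t * measure ?m ?H" if \<delta>: "0 < \<delta>" for \<delta>
  proof -
    obtain c :: "nat \<Rightarrow> complex" where c: "\<And>k. Re (c k) \<le> 0" "?H \<subseteq> (\<Union>k. cball (c k) \<delta>)"
      using left_half_plane_cells[OF \<delta>] by blast
    define A where "A = disjointed (\<lambda>k. cball (c k) \<delta> \<inter> ?H)"
    have sub: "A k \<subseteq> cball (c k) \<delta>" "A k \<subseteq> ?H" for k
      using disjointed_subset[of "\<lambda>k. cball (c k) \<delta> \<inter> ?H" k] by (auto simp: A_def)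
    have un: "(\<Union>k. A k) = ?H"
      unfolding A_def UN_disjointed_eq using c(2) by auto
    have A: "A k \<in> sets borel" for k
      unfolding A_def disjointed_def by (auto intro!: sets.Diff sets.finite_UN)
    have disj: "disjoint_family A"
      unfolding A_def by (rule disjoint_family_disjointed)
    have sumT: "(\<lambda>k. L2_inner \<pi> (T t (E (A k) g)) g) sums L2_inner \<pi> (T t (E ?H g)) g"
      using T_partition[of A g g t] A disj g t by (simp add: un)
    have summ: "(\<lambda>k. measure ?m (A k)) sums measure ?m ?H"
      using A disj by (subst un[symmetric]) (intro finite_measure_UNION, auto)
    have sumI: "(\<lambda>k. ?I (A k)) sums ?I ?H"
    proof -
      have "summable (\<lambda>k. ?I (A k))"
      proof (rule summable_comparison_test)
        show "\<exists>N. \<forall>k\<ge>N. norm (?I (A k)) \<le> measure ?m (A k)"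
        proof (intro exI allI impI)
          fix k
          have "norm (?I (A k)) \<le> (\<integral>z. indicator (A k) z \<partial>?m)"
            unfolding set_lebesgue_integral_def
          proof (rule Bochner_Integration.integral_norm_bound_integral)
            show "integrable ?m (\<lambda>z. indicator (A k) z *\<^sub>R exp (z * of_real t))"
              using integrable_exp_left_half_plane[OF g t A sub(2)] by (simp add: set_integrable_def)
            show "integrable ?m (indicator (A k) :: complex \<Rightarrow> real)"
              using A by (intro integrable_real_indicator) (auto simp: less_top[symmetric])
            show "norm (indicator (A k) z *\<^sub>R exp (z * of_real t)) \<le> indicator (A k) z" for z
              using sub(2)[of k] t by (auto simp: indicator_def left_half_plane_def mult_nonpos_nonneg)
          qed
          then show "norm (?I (A k)) \<le> measure ?m (A k)" using A by simp
        qed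
        show "summable (\<lambda>k. measure ?m (A k))" using summ by (rule sums_summable)
      qed
      moreover have "?I ?H = (\<Sum>k. ?I (A k))"
        unfolding un[symmetric] using A disj integrable_exp_left_half_plane[OF g t sets_left_half_plane subset_refl]
        by (intro lebesgue_integral_countable_add) (auto simp: un disjoint_family_on_def)
      ultimately show ?thesis by (simp add: summable_sums)
    qed
    have diff: "(\<lambda>k. L2_inner \<pi> (T t (E (A k) g)) g - ?I (A k)) sums (L2_inner \<pi> (T t (E ?H g)) g - ?I ?H)"
      by (rule sums_diff[OF sumT sumI])
    have cell: "norm (L2_inner \<pi> (T t (E (A k) g)) g - ?I (A k)) \<le> 3 * \<delta> * t * measure ?m (A k)" for k
      by (rule inner_T_cell[OF g t \<delta> c(1) A sub(2) sub(1)])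
    have summ': "(\<lambda>k. 3 * \<delta> * t * measure ?m (A k)) sums (3 * \<delta> * t * measure ?m ?H)"
      by (rule sums_mult[OF summ])
    show ?thesis
      using norm_suminf_le[OF cell sums_summable[OF summ']]
      unfolding sums_unique[OF diff, symmetric] sums_unique[OF summ', symmetric] .
  qed
  have "cmod (L2_inner \<pi> (T t (E ?H g)) g - ?I ?H) \<le> 0"
  proof (rule tendsto_lowerbound)
    show "((\<lambda>\<delta>. 3 * \<delta> * t * measure ?m ?H) \<longlongrightarrow> 0) (at_right 0)"
      by (auto intro!: tendsto_eq_intros)
    show "\<forall>\<^sub>F \<delta> in at_right 0. cmod (L2_inner \<pi> (T t (E ?H g)) g - ?I ?H) \<le> 3 * \<delta> * t * measure ?m ?H"
      using eventually_at_right_less[of 0] by eventually_elim (rule bound)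
  qed simp
  then have "L2_inner \<pi> (T t (E ?H g)) g = ?I ?H" by simp
  moreover have "weak_eq \<pi> (E ?H g) g"
  proof -
    have "in_range ?H g"
    proof (rule in_range_compl[OF sets_left_half_plane g])
      fix h assume h: "h \<in> L2 \<pi>"
      have null: "- ?H \<in> null_sets ?m"
        using AE_spectral_measure_left_half_plane[OF g]
        by (subst (asm) AE_iff_null) (auto simp: left_half_plane_def Collect_neg_eq[symmetric])
      then have "measure ?m (- ?H) = 0" by (simp add: measure_eq_0_null_sets)
      then have n: "L2_norm \<pi> (E (- ?H) g) = 0" using g by (simp add: measure_pvm_measure)
      have "L2_inner \<pi> g (E (- ?H) h) = L2_inner \<pi> (E (- ?H) g) h"
        using g h by (simp add: E_selfadjoint)
      moreover have "cmod (L2_inner \<pi> (E (- ?H) g) h) \<le> L2_norm \<pi> (E (- ?H) g) * L2_norm \<pi> h"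
        using g h by (intro L2_Cauchy_Schwarz) auto
      ultimately show "L2_inner \<pi> g (E (- ?H) h) = 0" by (simp add: n)
    qed
    then show ?thesis by (simp add: in_range_def)
  qed
  ultimately show ?thesis using inner_T_cong[OF _ t g] by simp
qed

end

section \<open>Transition operators of a stationary Markov process\<close>

lemma vimage_algebra_factorization:
  fixes Y :: "'w \<Rightarrow> real"
  assumes \<xi>: "\<xi> \<in> X \<rightarrow> space N" and Y: "Y \<in> borel_measurable (vimage_algebra X \<xi> N)"
  shows "\<exists>u \<in> borel_measurable N. \<forall>\<omega>\<in>X. Y \<omega> = u (\<xi> \<omega>)"
proof -
  have nonneg: "\<exists>u \<in> borel_measurable N. \<forall>\<omega>\<in>X. Y \<omega> = u (\<xi> \<omega>)"
    if "Y \<in> borel_measurable (vimage_algebra X \<xi> N)" "\<And>\<omega>. 0 \<le> Y \<omega>" for Y :: "'w \<Rightarrow> real"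
    using that
  proof (induction Y rule: borel_measurable_induct_real)
    case (set A)
    then obtain B where "B \<in> sets N" "A = \<xi> -` B \<inter> X"
      unfolding sets_vimage_algebra2[OF \<xi>] by auto
    then show ?case by (intro bexI[of _ "indicator B"]) (auto simp: indicator_def)
  next
    case (mult Y c)
    obtain u where "u \<in> borel_measurable N" "\<forall>\<omega>\<in>X. Y \<omega> = u (\<xi> \<omega>)" using mult.IH by blast
    then show ?case by (intro bexI[of _ "\<lambda>x. c * u x"]) auto
  next
    case (add Y Z)
    obtain u v where "u \<in> borel_measurable N" "\<forall>\<omega>\<in>X. Y \<omega> = u (\<xi> \<omega>)"
      "v \<in> borel_measurable N" "\<forall>\<omega>\<in>X. Z \<omega> = v (\<xi> \<omega>)" using add.IH by blast
    then show ?case by (intro bexI[of _ "\<lambda>x. v x + u x"]) auto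
  next
    case (seq U)
    have "\<forall>i. \<exists>u \<in> borel_measurable N. \<forall>\<omega>\<in>X. U i \<omega> = u (\<xi> \<omega>)" using seq.IH by blast
    then obtain u where u: "\<And>i. u i \<in> borel_measurable N" "\<And>i \<omega>. \<omega> \<in> X \<Longrightarrow> U i \<omega> = u i (\<xi> \<omega>)" by metis
    have "(\<lambda>x. lim (\<lambda>i. u i x)) \<in> borel_measurable N"
      using u(1) by (rule borel_measurable_lim_metric)
    moreover have "Y \<omega> = lim (\<lambda>i. u i (\<xi> \<omega>))" if "\<omega> \<in> X" for \<omega>
      using seq.hyps(4)[of \<omega>] u(2)[OF that] that by (simp add: limI)
    ultimately show ?case by (intro bexI[of _ "\<lambda>x. lim (\<lambda>i. u i x)"]) auto
  qed
  have Ym: "(\<lambda>\<omega>. max 0 (Y \<omega>)) \<in> borel_measurable (vimage_algebra X \<xi> N)"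
    "(\<lambda>\<omega>. max 0 (- Y \<omega>)) \<in> borel_measurable (vimage_algebra X \<xi> N)"
    using Y by measurable
  obtain u where u: "u \<in> borel_measurable N" "\<forall>\<omega>\<in>X. max 0 (Y \<omega>) = u (\<xi> \<omega>)"
    using nonneg[OF Ym(1) max.cobounded1] by blast
  obtain v where v: "v \<in> borel_measurable N" "\<forall>\<omega>\<in>X. max 0 (- Y \<omega>) = v (\<xi> \<omega>)"
    using nonneg[OF Ym(2) max.cobounded1] by blast
  show ?thesis
  proof (intro bexI[of _ "\<lambda>x. u x - v x"] ballI)
    fix \<omega> assume "\<omega> \<in> X"
    then have "u (\<xi> \<omega>) = max 0 (Y \<omega>)" "v (\<xi> \<omega>) = max 0 (- Y \<omega>)" using u v by auto
    then show "Y \<omega> = u (\<xi> \<omega>) - v (\<xi> \<omega>)" by simp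
  qed (use u v in auto)
qed

lemma (in finite_measure) real_cond_exp_square_integrable:
  assumes sub: "subalgebra M G" and X: "X \<in> borel_measurable M" "integrable M (\<lambda>x. (X x)\<^sup>2)"
  shows "integrable M (\<lambda>x. (real_cond_exp M G X x)\<^sup>2)"
proof -
  interpret finite_measure_subalgebra M G by standard (rule sub)
  have int: "integrable M X" using X by (rule square_integrable_imp_integrable)
  have "convex_on UNIV (\<lambda>x::real. x\<^sup>2)"
    using convex_power2 by (rule convex_on_subset) auto
  then have le: "AE x in M. (real_cond_exp M G X x)\<^sup>2 \<le> real_cond_exp M G (\<lambda>x. (X x)\<^sup>2) x"
    using int X by (intro real_cond_exp_jensens_inequality(2)[where I=UNIV and q="\<lambda>x. x\<^sup>2"]) auto
  have "integrable M (real_cond_exp M G (\<lambda>x. (X x)\<^sup>2))"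
    using X by (intro real_cond_exp_int) auto
  then show ?thesis
  proof (rule Bochner_Integration.integrable_bound)
    show "AE x in M. norm ((real_cond_exp M G X x)\<^sup>2) \<le> norm (real_cond_exp M G (\<lambda>x. (X x)\<^sup>2) x)"
      using le by eventually_elim simp
  qed simp
qed

lemma L2_simple_approximation:
  assumes f: "f \<in> L2 \<pi>" and e: "e > 0"
  shows "\<exists>s. simple_function \<pi> s \<and> s \<in> L2 \<pi> \<and> L2_norm \<pi> (\<lambda>x. f x - s x) < e"
proof -
  note [measurable] = L2_measurable[OF f]
  from borel_measurable_implies_sequence_metric[OF L2_measurable[OF f], of 0]
  obtain s where s: "\<And>i. simple_function \<pi> (s i)" "\<And>x. x \<in> space \<pi> \<Longrightarrow> (\<lambda>i. s i x) \<longlonglongrightarrow> f x"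
    "\<And>i x. x \<in> space \<pi> \<Longrightarrow> cmod (s i x) \<le> 2 * cmod (f x)"
    by simp metis
  have [measurable]: "s i \<in> borel_measurable \<pi>" for i
    using s(1) by (rule borel_measurable_simple_function)
  have sL2: "s i \<in> L2 \<pi>" for i
  proof -
    have "integrable \<pi> (\<lambda>x. (cmod (s i x))\<^sup>2)"
    proof (rule Bochner_Integration.integrable_bound)
      show "integrable \<pi> (\<lambda>x. 4 * (cmod (f x))\<^sup>2)" using L2_square_integrable[OF f] by simp
      show "AE x in \<pi>. norm ((cmod (s i x))\<^sup>2) \<le> norm (4 * (cmod (f x))\<^sup>2)"
        using power_mono[OF s(3) norm_ge_zero, where n=2] by (intro AE_I2) (simp add: power_mult_distrib)
    qed measurable
    then show ?thesis by (simp add: L2_def)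
  qed
  have "(\<lambda>i. \<integral>x. (cmod (f x - s i x))\<^sup>2 \<partial>\<pi>) \<longlonglongrightarrow> (\<integral>x. 0 \<partial>\<pi>)"
  proof (rule integral_dominated_convergence)
    show "integrable \<pi> (\<lambda>x. 9 * (cmod (f x))\<^sup>2)" using L2_square_integrable[OF f] by simp
    show "AE x in \<pi>. (\<lambda>i. (cmod (f x - s i x))\<^sup>2) \<longlonglongrightarrow> 0"
      using s(2) by (intro AE_I2) (auto intro!: tendsto_eq_intros)
    show "AE x in \<pi>. norm ((cmod (f x - s i x))\<^sup>2) \<le> 9 * (cmod (f x))\<^sup>2" for i
    proof (intro AE_I2)
      fix x assume "x \<in> space \<pi>"
      then have "cmod (f x - s i x) \<le> 3 * cmod (f x)"
        using s(3)[where i=i and x=x] norm_triangle_ineq4[of "f x" "s i x"] by linarith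
      then have "(cmod (f x - s i x))\<^sup>2 \<le> (3 * cmod (f x))\<^sup>2" by (intro power_mono) auto
      then show "norm ((cmod (f x - s i x))\<^sup>2) \<le> 9 * (cmod (f x))\<^sup>2" by (simp add: power_mult_distrib)
    qed
  qed measurable
  then have "(\<lambda>i. L2_norm \<pi> (\<lambda>x. f x - s i x)) \<longlonglongrightarrow> 0"
    unfolding L2_norm_def using tendsto_real_sqrt by fastforce
  then have "\<forall>\<^sub>F i in sequentially. L2_norm \<pi> (\<lambda>x. f x - s i x) < e"
    using e by (rule order_tendstoD)
  then obtain i where "L2_norm \<pi> (\<lambda>x. f x - s i x) < e"
    by (auto simp: eventually_sequentially)
  then show ?thesis using s(1) sL2 by blast
qed

context stationary_markov_process
begin

lemma measurable_F: "0 \<le> t \<Longrightarrow> (\<lambda>x. x) \<in> M \<rightarrow>\<^sub>M F t"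
  using measurable_from_subalg[OF subalgebra_F measurable_ident] by (simp add: id_def)

lemma \<xi>_adapted: "0 \<le> t \<Longrightarrow> \<xi> t \<in> F t \<rightarrow>\<^sub>M \<pi>"
proof -
  assume t: "0 \<le> t"
  have "(\<lambda>\<omega>. (t, \<omega>)) \<in> F t \<rightarrow>\<^sub>M restrict_space borel {0..t} \<Otimes>\<^sub>M F t"
    using t by (intro measurable_Pair measurable_const measurable_ident_sets) (auto simp: space_restrict_space)
  from measurable_compose[OF this progressively_measurable[OF t]] show ?thesis by simp
qed

lemma measurable_\<xi>: "0 \<le> t \<Longrightarrow> \<xi> t \<in> M \<rightarrow>\<^sub>M \<pi>"
  by (rule measurable_from_subalg[OF subalgebra_F \<xi>_adapted])

lemma measurable_pair_\<xi>: "0 \<le> t \<Longrightarrow> (\<lambda>(s, \<omega>). \<xi> s \<omega>) \<in> restrict_space borel {0..t} \<Otimes>\<^sub>M M \<rightarrow>\<^sub>M \<pi>"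
proof -
  assume t: "0 \<le> t"
  have "(\<lambda>x. (fst x, snd x)) \<in> restrict_space borel {0..t} \<Otimes>\<^sub>M M \<rightarrow>\<^sub>M restrict_space borel {0..t} \<Otimes>\<^sub>M F t"
    by (intro measurable_Pair measurable_fst measurable_compose[OF measurable_snd measurable_F[OF t]])
  from measurable_compose[OF this progressively_measurable[OF t]] show ?thesis
    by (simp add: case_prod_beta')
qed

lemma distr_pair:
  assumes "0 \<le> s" "0 \<le> t"
  shows "distr M (\<pi> \<Otimes>\<^sub>M \<pi>) (\<lambda>\<omega>. (\<xi> s \<omega>, \<xi> (s + t) \<omega>)) = distr M (\<pi> \<Otimes>\<^sub>M \<pi>) (\<lambda>\<omega>. (\<xi> 0 \<omega>, \<xi> t \<omega>))"
proof -
  let ?P = "\<Pi>\<^sub>M t\<in>{0..}. \<pi>" and ?\<phi> = "\<lambda>x. (x (0::real), x t)"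
  have \<phi>: "?\<phi> \<in> ?P \<rightarrow>\<^sub>M \<pi> \<Otimes>\<^sub>M \<pi>"
    using assms by (intro measurable_Pair measurable_component_singleton) auto
  have X: "(\<lambda>\<omega>. \<lambda>t\<in>{0..}. \<xi> (r + t) \<omega>) \<in> M \<rightarrow>\<^sub>M ?P" if "0 \<le> r" for r
    using that by (intro measurable_restrict measurable_\<xi>) auto
  have "distr (distr M ?P (\<lambda>\<omega>. \<lambda>t\<in>{0..}. \<xi> (s + t) \<omega>)) (\<pi> \<Otimes>\<^sub>M \<pi>) ?\<phi>
      = distr (distr M ?P (\<lambda>\<omega>. \<lambda>t\<in>{0..}. \<xi> t \<omega>)) (\<pi> \<Otimes>\<^sub>M \<pi>) ?\<phi>"
    by (simp only: stationary[OF assms(1)])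
  then show ?thesis
    using assms X[of s] X[of 0] by (simp add: distr_distr[OF \<phi>] o_def)
qed

lemma distr_\<xi>: "0 \<le> t \<Longrightarrow> distr M \<pi> (\<xi> t) = \<pi>"
proof -
  assume t: "0 \<le> t"
  have "distr (distr M (\<pi> \<Otimes>\<^sub>M \<pi>) (\<lambda>\<omega>. (\<xi> t \<omega>, \<xi> (t + 0) \<omega>))) \<pi> fst = distr (distr M (\<pi> \<Otimes>\<^sub>M \<pi>) (\<lambda>\<omega>. (\<xi> 0 \<omega>, \<xi> 0 \<omega>))) \<pi> fst"
    by (simp only: distr_pair[OF t order_refl])
  then have "distr M \<pi> (\<xi> t) = distr M \<pi> (\<xi> 0)"
    using measurable_\<xi>[OF t] measurable_\<xi>[of 0] by (simp add: distr_distr o_def)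
  then show ?thesis using law by simp
qed

lemma L2_comp:
  assumes f: "f \<in> L2 \<pi>" and t: "0 \<le> t"
  shows "(\<lambda>\<omega>. f (\<xi> t \<omega>)) \<in> L2 M"
proof -
  note [measurable] = measurable_\<xi>[OF t] L2_measurable[OF f]
  have "integrable (distr M \<pi> (\<xi> t)) (\<lambda>x. (cmod (f x))\<^sup>2)"
    using L2_square_integrable[OF f] by (simp add: distr_\<xi>[OF t])
  then show ?thesis
    unfolding L2_def by (simp add: integrable_distr_eq)
qed

lemma L2_inner_comp:
  assumes f: "f \<in> L2 \<pi>" and h: "h \<in> L2 \<pi>" and t: "0 \<le> t"
  shows "L2_inner M (\<lambda>\<omega>. f (\<xi> t \<omega>)) (\<lambda>\<omega>. h (\<xi> t \<omega>)) = L2_inner \<pi> f h"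
proof -
  note [measurable] = measurable_\<xi>[OF t] L2_measurable[OF f] L2_measurable[OF h]
  have "L2_inner \<pi> f h = (\<integral>x. f x * cnj (h x) \<partial>distr M \<pi> (\<xi> t))"
    by (simp add: L2_inner_def distr_\<xi>[OF t])
  also have "\<dots> = L2_inner M (\<lambda>\<omega>. f (\<xi> t \<omega>)) (\<lambda>\<omega>. h (\<xi> t \<omega>))"
    unfolding L2_inner_def by (subst integral_distr) auto
  finally show ?thesis ..
qed

lemma L2_norm_comp:
  assumes f: "f \<in> L2 \<pi>" and t: "0 \<le> t"
  shows "L2_norm M (\<lambda>\<omega>. f (\<xi> t \<omega>)) = L2_norm \<pi> f"
  using L2_norm_square[of M "\<lambda>\<omega>. f (\<xi> t \<omega>)"] L2_norm_square[of \<pi> f] L2_inner_comp[OF f f t]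
  by (metis L2_norm_nonneg power2_eq_iff_nonneg)

lemma L2_inner_stationary:
  assumes f: "f \<in> L2 \<pi>" and h: "h \<in> L2 \<pi>" and s: "0 \<le> s" and t: "0 \<le> t"
  shows "L2_inner M (\<lambda>\<omega>. f (\<xi> (s + t) \<omega>)) (\<lambda>\<omega>. h (\<xi> s \<omega>)) = L2_inner M (\<lambda>\<omega>. f (\<xi> t \<omega>)) (\<lambda>\<omega>. h (\<xi> 0 \<omega>))"
proof -
  note [measurable] = measurable_\<xi>[OF t] measurable_\<xi>[OF s] measurable_\<xi>[of 0, simplified] measurable_\<xi>[of "s + t"] L2_measurable[OF f] L2_measurable[OF h]
  have [measurable]: "\<xi> (s + t) \<in> M \<rightarrow>\<^sub>M \<pi>" using s t by (intro measurable_\<xi>) auto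
  have [measurable]: "(\<lambda>(x, y). f y * cnj (h x)) \<in> borel_measurable (\<pi> \<Otimes>\<^sub>M \<pi>)" by measurable
  have "L2_inner M (\<lambda>\<omega>. f (\<xi> (s + t) \<omega>)) (\<lambda>\<omega>. h (\<xi> s \<omega>))
     = (\<integral>(x, y). f y * cnj (h x) \<partial>distr M (\<pi> \<Otimes>\<^sub>M \<pi>) (\<lambda>\<omega>. (\<xi> s \<omega>, \<xi> (s + t) \<omega>)))"
    by (subst integral_distr) (auto simp: L2_inner_def)
  also have "\<dots> = L2_inner M (\<lambda>\<omega>. f (\<xi> t \<omega>)) (\<lambda>\<omega>. h (\<xi> 0 \<omega>))"
    unfolding distr_pair[OF s t] by (subst integral_distr) (auto simp: L2_inner_def)
  finally show ?thesis .
qed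

definition sigma_\<xi> :: "real \<Rightarrow> 'w measure" where
  "sigma_\<xi> s = vimage_algebra (space M) (\<xi> s) \<pi>"

lemma subalgebra_sigma_\<xi>: "0 \<le> s \<Longrightarrow> subalgebra M (sigma_\<xi> s)"
  using measurable_\<xi>[of s] by (simp add: sigma_\<xi>_def subalgebra_def measurable_iff_sets)

lemma measurable_sigma_\<xi>:
  "0 \<le> s \<Longrightarrow> u \<in> borel_measurable \<pi> \<Longrightarrow> (\<lambda>\<omega>. u (\<xi> s \<omega>)) \<in> borel_measurable (sigma_\<xi> s)"
  using measurable_space[OF measurable_\<xi>[of s]] unfolding sigma_\<xi>_def
  by (intro measurable_compose[OF measurable_vimage_algebra1]) auto

text \<open>
  The conditional expectation of a square-integrable variable is square integrable by Jensen's
  inequality, and it factors through \<open>\<xi>\<^sub>0\<close> by the Doob-Dynkin lemma; hence the choice in the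
  definition of the transition operator is not vacuous.
\<close>

lemma transition_op_exists:
  assumes f: "f \<in> L2 \<pi>" and t: "0 \<le> t"
  shows "\<exists>u. u \<in> L2 \<pi> \<and> (AE \<omega> in M. u (\<xi> 0 \<omega>) = complex_cond_exp M (sigma_\<xi> 0) (\<lambda>\<omega>'. f (\<xi> t \<omega>')) \<omega>)"
proof -
  note sub = subalgebra_sigma_\<xi>[OF order_refl]
  have fL2: "(\<lambda>\<omega>. f (\<xi> t \<omega>)) \<in> L2 M" by (rule L2_comp[OF f t])
  note [measurable] = L2_measurable[OF fL2] measurable_\<xi>[of 0, simplified]
  have sq: "integrable M (\<lambda>\<omega>. (cmod (f (\<xi> t \<omega>)))\<^sup>2)" by (rule L2_square_integrable[OF fL2])
  have Re: "integrable M (\<lambda>\<omega>. (real_cond_exp M (sigma_\<xi> 0) (\<lambda>\<omega>'. Re (f (\<xi> t \<omega>'))) \<omega>)\<^sup>2)"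
    by (intro real_cond_exp_square_integrable[OF sub] Bochner_Integration.integrable_bound[OF sq])
       (auto simp: cmod_power2)
  have Im: "integrable M (\<lambda>\<omega>. (real_cond_exp M (sigma_\<xi> 0) (\<lambda>\<omega>'. Im (f (\<xi> t \<omega>'))) \<omega>)\<^sup>2)"
    by (intro real_cond_exp_square_integrable[OF sub] Bochner_Integration.integrable_bound[OF sq])
       (auto simp: cmod_power2)
  have \<xi>0: "\<xi> 0 \<in> space M \<rightarrow> space \<pi>" using measurable_space[OF measurable_\<xi>[of 0]] by auto
  obtain a where a[measurable]: "a \<in> borel_measurable \<pi>"
    and a': "\<And>\<omega>. \<omega> \<in> space M \<Longrightarrow> real_cond_exp M (sigma_\<xi> 0) (\<lambda>\<omega>'. Re (f (\<xi> t \<omega>'))) \<omega> = a (\<xi> 0 \<omega>)"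
    using vimage_algebra_factorization[OF \<xi>0 borel_measurable_cond_exp[of M "sigma_\<xi> 0", unfolded sigma_\<xi>_def]]
    unfolding sigma_\<xi>_def by metis
  obtain b where b[measurable]: "b \<in> borel_measurable \<pi>"
    and b': "\<And>\<omega>. \<omega> \<in> space M \<Longrightarrow> real_cond_exp M (sigma_\<xi> 0) (\<lambda>\<omega>'. Im (f (\<xi> t \<omega>'))) \<omega> = b (\<xi> 0 \<omega>)"
    using vimage_algebra_factorization[OF \<xi>0 borel_measurable_cond_exp[of M "sigma_\<xi> 0", unfolded sigma_\<xi>_def]]
    unfolding sigma_\<xi>_def by metis
  have ab: "(\<lambda>x. Complex (a x) (b x)) \<in> borel_measurable \<pi>"
    unfolding Complex_eq by measurable
  have "integrable M (\<lambda>\<omega>. (cmod (Complex (a (\<xi> 0 \<omega>)) (b (\<xi> 0 \<omega>))))\<^sup>2)"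
    using Bochner_Integration.integrable_add[OF Re Im] a' b'
    by (simp add: cmod_power2 cong: Bochner_Integration.integrable_cong)
  then have "integrable (distr M \<pi> (\<xi> 0)) (\<lambda>x. (cmod (Complex (a x) (b x)))\<^sup>2)"
    using ab by (subst integrable_distr_eq) auto
  then have "(\<lambda>x. Complex (a x) (b x)) \<in> L2 \<pi>"
    using ab law by (simp add: L2_def)
  moreover have "AE \<omega> in M. Complex (a (\<xi> 0 \<omega>)) (b (\<xi> 0 \<omega>)) = complex_cond_exp M (sigma_\<xi> 0) (\<lambda>\<omega>'. f (\<xi> t \<omega>')) \<omega>"
    using a' b' by (intro AE_I2) (simp add: complex_cond_exp_def)
  ultimately show ?thesis by (intro exI[of _ "\<lambda>x. Complex (a x) (b x)"]) simp
qed

abbreviation T :: "real \<Rightarrow> ('s \<Rightarrow> complex) \<Rightarrow> ('s \<Rightarrow> complex)" where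
  "T \<equiv> transition_op M \<pi> \<xi>"

lemma
  assumes f: "f \<in> L2 \<pi>" and t: "0 \<le> t"
  shows transition_op_L2: "T t f \<in> L2 \<pi>"
    and transition_op_AE: "AE \<omega> in M. T t f (\<xi> 0 \<omega>) = complex_cond_exp M (sigma_\<xi> 0) (\<lambda>\<omega>'. f (\<xi> t \<omega>')) \<omega>"
  using someI_ex[OF transition_op_exists[OF f t]]
  unfolding transition_op_def sigma_\<xi>_def by auto

lemma inner_complex_cond_exp:
  assumes sub: "subalgebra M G" and X: "X \<in> L2 M" and Y: "Y \<in> L2 M" "Y \<in> borel_measurable G"
    and Z: "Z \<in> borel_measurable M" "AE \<omega> in M. Z \<omega> = complex_cond_exp M G X \<omega>"
  shows "L2_inner M Z Y = L2_inner M X Y"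
proof -
  interpret G: finite_measure_subalgebra M G by standard (rule sub)
  note [measurable] = L2_measurable[OF X] Y(2) L2_measurable[OF Y(1)] Z(1)
  have X2: "integrable M (\<lambda>\<omega>. (cmod (X \<omega>))\<^sup>2)" and Y2: "integrable M (\<lambda>\<omega>. (cmod (Y \<omega>))\<^sup>2)"
    using X Y by (auto intro: L2_square_integrable)
  define E where "E = real_cond_exp M G"
  have int: "integrable M (\<lambda>\<omega>. p (Y \<omega>) * q (X \<omega>))"
    if "p \<in> {Re, Im}" "q \<in> {Re, Im}" for p q
  proof (rule Bochner_Integration.integrable_bound)
    show "integrable M (\<lambda>\<omega>. cmod (X \<omega> * cnj (Y \<omega>)))" using L2_mult_integrable[OF X Y(1)] by simp
    have "\<bar>p z\<bar> \<le> cmod z" "\<bar>q z\<bar> \<le> cmod z" for z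
      using that abs_Re_le_cmod abs_Im_le_cmod by auto
    then have "\<bar>p (Y \<omega>)\<bar> * \<bar>q (X \<omega>)\<bar> \<le> cmod (Y \<omega>) * cmod (X \<omega>)" for \<omega>
      by (intro mult_mono) auto
    then show "AE \<omega> in M. norm (p (Y \<omega>) * q (X \<omega>)) \<le> norm (cmod (X \<omega> * cnj (Y \<omega>)))"
      by (intro AE_I2) (simp add: norm_mult abs_mult mult.commute)
    show "(\<lambda>\<omega>. p (Y \<omega>) * q (X \<omega>)) \<in> borel_measurable M" using that by auto
  qed
  have cond: "integrable M (\<lambda>\<omega>. p (Y \<omega>) * E (\<lambda>\<omega>. q (X \<omega>)) \<omega>)"
      "(\<integral>\<omega>. p (Y \<omega>) * E (\<lambda>\<omega>. q (X \<omega>)) \<omega> \<partial>M) = (\<integral>\<omega>. p (Y \<omega>) * q (X \<omega>) \<partial>M)"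
    if "p \<in> {Re, Im}" "q \<in> {Re, Im}" for p q
    using G.real_cond_exp_intg[OF int[OF that]] that unfolding E_def by auto
  have split: "(\<integral>\<omega>. Complex (a \<omega>) (b \<omega>) * cnj (Y \<omega>) \<partial>M)
    = Complex ((\<integral>\<omega>. Re (Y \<omega>) * a \<omega> \<partial>M) + (\<integral>\<omega>. Im (Y \<omega>) * b \<omega> \<partial>M))
              ((\<integral>\<omega>. Re (Y \<omega>) * b \<omega> \<partial>M) - (\<integral>\<omega>. Im (Y \<omega>) * a \<omega> \<partial>M))"
    if "integrable M (\<lambda>\<omega>. Re (Y \<omega>) * a \<omega>)" "integrable M (\<lambda>\<omega>. Im (Y \<omega>) * b \<omega>)"
       "integrable M (\<lambda>\<omega>. Re (Y \<omega>) * b \<omega>)" "integrable M (\<lambda>\<omega>. Im (Y \<omega>) * a \<omega>)" for a b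
  proof -
    have "(\<lambda>\<omega>. Complex (a \<omega>) (b \<omega>) * cnj (Y \<omega>))
      = (\<lambda>\<omega>. complex_of_real (Re (Y \<omega>) * a \<omega> + Im (Y \<omega>) * b \<omega>) + \<i> * complex_of_real (Re (Y \<omega>) * b \<omega> - Im (Y \<omega>) * a \<omega>))"
      by (auto simp: complex_eq_iff mult.commute)
    moreover have "integrable M (\<lambda>\<omega>. Re (Y \<omega>) * a \<omega> + Im (Y \<omega>) * b \<omega>)" "integrable M (\<lambda>\<omega>. Re (Y \<omega>) * b \<omega> - Im (Y \<omega>) * a \<omega>)"
      using that by auto
    ultimately show ?thesis
      using that by (simp add: Complex_eq del: of_real_add of_real_diff of_real_mult)
  qed
  have "L2_inner M Z Y = (\<integral>\<omega>. Complex (E (\<lambda>\<omega>. Re (X \<omega>)) \<omega>) (E (\<lambda>\<omega>. Im (X \<omega>)) \<omega>) * cnj (Y \<omega>) \<partial>M)"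
    unfolding L2_inner_def
  proof (rule integral_cong_AE)
    show "AE \<omega> in M. Z \<omega> * cnj (Y \<omega>) = Complex (E (\<lambda>\<omega>. Re (X \<omega>)) \<omega>) (E (\<lambda>\<omega>. Im (X \<omega>)) \<omega>) * cnj (Y \<omega>)"
      using Z(2) by eventually_elim (simp add: complex_cond_exp_def E_def)
    show "(\<lambda>\<omega>. Complex (E (\<lambda>\<omega>. Re (X \<omega>)) \<omega>) (E (\<lambda>\<omega>. Im (X \<omega>)) \<omega>) * cnj (Y \<omega>)) \<in> borel_measurable M"
      unfolding Complex_eq E_def by measurable
  qed measurable
  also have "\<dots> = (\<integral>\<omega>. Complex (Re (X \<omega>)) (Im (X \<omega>)) * cnj (Y \<omega>) \<partial>M)"
    using cond int by (subst (1 2) split) auto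
  finally show ?thesis by (simp add: L2_inner_def)
qed

text \<open>
  The characterisation by inner products: it fixes \<open>T\<^sub>t f\<close> up to weak equality and refers neither to the
  chosen version nor to conditional expectations.
\<close>

lemma inner_transition_op:
  assumes f: "f \<in> L2 \<pi>" and h: "h \<in> L2 \<pi>" and t: "0 \<le> t"
  shows "L2_inner \<pi> (T t f) h = L2_inner M (\<lambda>\<omega>. f (\<xi> t \<omega>)) (\<lambda>\<omega>. h (\<xi> 0 \<omega>))"
proof -
  note TL2 = transition_op_L2[OF f t]
  have "L2_inner \<pi> (T t f) h = L2_inner M (\<lambda>\<omega>. T t f (\<xi> 0 \<omega>)) (\<lambda>\<omega>. h (\<xi> 0 \<omega>))"
    by (rule L2_inner_comp[OF TL2 h order_refl, symmetric])
  also have "\<dots> = L2_inner M (\<lambda>\<omega>. f (\<xi> t \<omega>)) (\<lambda>\<omega>. h (\<xi> 0 \<omega>))"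
    by (rule inner_complex_cond_exp[OF subalgebra_sigma_\<xi>[OF order_refl] L2_comp[OF f t] L2_comp[OF h order_refl]
        measurable_sigma_\<xi>[OF order_refl L2_measurable[OF h]] L2_measurable[OF L2_comp[OF TL2 order_refl]] transition_op_AE[OF f t]])
  finally show ?thesis .
qed

end

section \<open>The semigroup property of the transition operators\<close>

lemma L2_inner_diff_small:
  assumes f: "f \<in> L2 \<pi>" "f' \<in> L2 \<pi>" "h \<in> L2 \<pi>" and e: "L2_norm \<pi> (\<lambda>x. f x - f' x) \<le> e"
  shows "cmod (L2_inner \<pi> f h - L2_inner \<pi> f' h) \<le> e * L2_norm \<pi> h"
proof -
  have "L2_inner \<pi> f h - L2_inner \<pi> f' h = L2_inner \<pi> (\<lambda>x. f x - f' x) h"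
    using f by simp
  also have "cmod \<dots> \<le> L2_norm \<pi> (\<lambda>x. f x - f' x) * L2_norm \<pi> h"
    using f by (intro L2_Cauchy_Schwarz) auto
  also have "\<dots> \<le> e * L2_norm \<pi> h"
    using e by (intro mult_right_mono) auto
  finally show ?thesis .
qed

lemma simple_function_eq_sum_indicator:
  assumes s: "simple_function \<pi> (s :: 's \<Rightarrow> complex)" and x: "x \<in> space \<pi>"
  shows "s x = (\<Sum>y\<in>s ` space \<pi>. y * indicator (s -` {y} \<inter> space \<pi>) x)"
proof -
  have "(\<Sum>y\<in>s ` space \<pi>. y * indicator (s -` {y} \<inter> space \<pi>) x) = (\<Sum>y\<in>s ` space \<pi>. if y = s x then y else 0)"
    using x by (intro sum.cong) (auto simp: indicator_def)
  also have "\<dots> = s x"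
    using simple_functionD(1)[OF s] x by simp
  finally show ?thesis ..
qed

context stationary_markov_process
begin

lemma transition_op_contraction:
  assumes f: "f \<in> L2 \<pi>" and t: "0 \<le> t"
  shows "L2_norm \<pi> (T t f) \<le> L2_norm \<pi> f"
proof -
  note TL2 = transition_op_L2[OF f t]
  have "(L2_norm \<pi> (T t f))\<^sup>2 = cmod (L2_inner \<pi> (T t f) (T t f))"
    unfolding L2_inner_self norm_of_real by simp
  also have "L2_inner \<pi> (T t f) (T t f) = L2_inner M (\<lambda>\<omega>. f (\<xi> t \<omega>)) (\<lambda>\<omega>. T t f (\<xi> 0 \<omega>))"
    by (rule inner_transition_op[OF f TL2 t])
  also have "cmod \<dots> \<le> L2_norm M (\<lambda>\<omega>. f (\<xi> t \<omega>)) * L2_norm M (\<lambda>\<omega>. T t f (\<xi> 0 \<omega>))"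
    by (intro L2_Cauchy_Schwarz L2_comp f TL2 t order_refl)
  also have "\<dots> = L2_norm \<pi> f * L2_norm \<pi> (T t f)"
    by (simp only: L2_norm_comp[OF f t] L2_norm_comp[OF TL2 order_refl])
  finally have "L2_norm \<pi> (T t f) * L2_norm \<pi> (T t f) \<le> L2_norm \<pi> f * L2_norm \<pi> (T t f)"
    by (simp add: power2_eq_square)
  moreover have "L2_norm \<pi> (T t f) = 0 \<or> 0 < L2_norm \<pi> (T t f)"
    using L2_norm_nonneg[of \<pi> "T t f"] by linarith
  ultimately show ?thesis
    by (auto simp: mult_le_cancel_right_pos)
qed

text \<open>
  The transition operator is defined at time \<open>0\<close>. By stationarity, \<open>T\<^sub>t 1\<^sub>A (\<xi>\<^sub>s)\<close> is also the conditional
  expectation given \<open>\<xi>\<^sub>s\<close> at any other time \<open>s\<close>, and the Markov property replaces \<open>\<xi>\<^sub>s\<close> by the past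
  up to \<open>s\<close>. The transition operator is complex valued, so its imaginary part is identified as well.
\<close>

lemma transition_op_indicator:
  assumes A: "A \<in> sets \<pi>" and s: "0 \<le> s" and t: "0 \<le> t"
  shows "AE \<omega> in M. complex_of_real (real_cond_exp M (F s) (\<lambda>\<omega>'. indicator A (\<xi> (s + t) \<omega>')) \<omega>)
     = T t (indicator A) (\<xi> s \<omega>)"
proof -
  define f where "f = (indicator A :: 's \<Rightarrow> complex)"
  have st: "0 \<le> s + t" using s t by simp
  interpret \<pi>: prob_space \<pi> using prob_space_distr[OF measurable_\<xi>[of 0]] law by simp
  note [measurable] = measurable_\<xi>[OF s] measurable_\<xi>[OF st] A
  have fL2: "f \<in> L2 \<pi>"
    unfolding L2_def f_def using A by (auto intro!: \<pi>.integrable_const_bound[where B=1] simp: indicator_def)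
  define u where "u = T t f"
  have uL2: "u \<in> L2 \<pi>" unfolding u_def by (rule transition_op_L2[OF fL2 t])
  note [measurable] = L2_measurable[OF uL2]
  have ind: "L2_inner M (\<lambda>\<omega>. f (\<xi> (s + t) \<omega>)) (\<lambda>\<omega>. indicator B (\<xi> s \<omega>)) = L2_inner M (\<lambda>\<omega>. u (\<xi> s \<omega>)) (\<lambda>\<omega>. indicator B (\<xi> s \<omega>))"
    if B: "B \<in> sets \<pi>" for B
  proof -
    have bL2: "(indicator B :: 's \<Rightarrow> complex) \<in> L2 \<pi>"
      unfolding L2_def using B by (auto intro!: \<pi>.integrable_const_bound[where B=1] simp: indicator_def)
    show ?thesis
      using L2_inner_stationary[OF fL2 bL2 s t] inner_transition_op[OF fL2 bL2 t] L2_inner_comp[OF uL2 bL2 s]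
      by (simp add: u_def)
  qed
  interpret S: finite_measure_subalgebra M "sigma_\<xi> s" by standard (rule subalgebra_sigma_\<xi>[OF s])
  have us: "integrable M (\<lambda>\<omega>. u (\<xi> s \<omega>))"
  proof -
    have "integrable M (\<lambda>\<omega>. u (\<xi> s \<omega>) * cnj 1)"
      by (rule L2_mult_integrable[OF L2_comp[OF uL2 s]]) (simp add: L2_def)
    then show ?thesis by simp
  qed
  have int_f: "integrable M (\<lambda>\<omega>. f (\<xi> (s + t) \<omega>))"
    unfolding f_def by (intro integrable_const_bound[where B=1]) (auto simp: indicator_def)
  have char: "(\<integral>\<omega>\<in>C. f (\<xi> (s + t) \<omega>) \<partial>M) = (\<integral>\<omega>\<in>C. u (\<xi> s \<omega>) \<partial>M)" if C: "C \<in> sets (sigma_\<xi> s)" for C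
  proof -
    have "\<xi> s \<in> space M \<rightarrow> space \<pi>" using measurable_space[OF measurable_\<xi>[OF s]] by auto
    then obtain B where B: "B \<in> sets \<pi>" "C = \<xi> s -` B \<inter> space M"
      using C unfolding sigma_\<xi>_def by (auto simp: sets_vimage_algebra2)
    have "(\<integral>\<omega>\<in>C. k \<omega> \<partial>M) = L2_inner M k (\<lambda>\<omega>. indicator B (\<xi> s \<omega>))" for k
      unfolding set_lebesgue_integral_def L2_inner_def
      by (intro Bochner_Integration.integral_cong refl) (auto simp: B(2) indicator_def)
    then show ?thesis using ind[OF B(1)] by simp
  qed
  have Re: "AE \<omega> in M. real_cond_exp M (sigma_\<xi> s) (\<lambda>\<omega>. indicator A (\<xi> (s + t) \<omega>)) \<omega> = Re (u (\<xi> s \<omega>))"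
  proof (rule S.real_cond_exp_charact)
    fix C assume C: "C \<in> sets (sigma_\<xi> s)"
    then have CM: "C \<in> sets M" using subalgebra_sigma_\<xi>[OF s] by (auto simp: subalgebra_def)
    have "Re (\<integral>\<omega>\<in>C. f (\<xi> (s + t) \<omega>) \<partial>M) = (\<integral>\<omega>\<in>C. indicator A (\<xi> (s + t) \<omega>) \<partial>M)"
      unfolding set_lebesgue_integral_def using integrable_mult_indicator[OF CM int_f]
      by (subst integral_Re[symmetric]) (auto intro!: Bochner_Integration.integral_cong simp: f_def indicator_def)
    moreover have "Re (\<integral>\<omega>\<in>C. u (\<xi> s \<omega>) \<partial>M) = (\<integral>\<omega>\<in>C. Re (u (\<xi> s \<omega>)) \<partial>M)"
      unfolding set_lebesgue_integral_def using integrable_mult_indicator[OF CM us]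
      by (subst integral_Re[symmetric]) auto
    ultimately show "(\<integral>\<omega>\<in>C. indicator A (\<xi> (s + t) \<omega>) \<partial>M) = (\<integral>\<omega>\<in>C. Re (u (\<xi> s \<omega>)) \<partial>M)"
      using char[OF C] by simp
  next
    show "integrable M (\<lambda>\<omega>. indicator A (\<xi> (s + t) \<omega>) :: real)"
      by (intro integrable_const_bound[where B=1]) (auto simp: indicator_def)
    show "integrable M (\<lambda>\<omega>. Re (u (\<xi> s \<omega>)))" using us by simp
    show "(\<lambda>\<omega>. Re (u (\<xi> s \<omega>))) \<in> borel_measurable (sigma_\<xi> s)"
      by (rule measurable_sigma_\<xi>[OF s]) simp
  qed
  have im0: "Im (f x) = 0" for x by (simp add: f_def indicator_def)
  have Im: "AE \<omega> in M. real_cond_exp M (sigma_\<xi> s) (\<lambda>\<omega>. 0) \<omega> = Im (u (\<xi> s \<omega>))"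
  proof (rule S.real_cond_exp_charact)
    fix C assume C: "C \<in> sets (sigma_\<xi> s)"
    then have CM: "C \<in> sets M" using subalgebra_sigma_\<xi>[OF s] by (auto simp: subalgebra_def)
    have "Im (\<integral>\<omega>\<in>C. f (\<xi> (s + t) \<omega>) \<partial>M) = (\<integral>\<omega>\<in>C. 0 \<partial>M)"
      unfolding set_lebesgue_integral_def using integrable_mult_indicator[OF CM int_f]
      by (subst integral_Im[symmetric]) (auto simp: im0)
    moreover have "Im (\<integral>\<omega>\<in>C. u (\<xi> s \<omega>) \<partial>M) = (\<integral>\<omega>\<in>C. Im (u (\<xi> s \<omega>)) \<partial>M)"
      unfolding set_lebesgue_integral_def using integrable_mult_indicator[OF CM us]
      by (subst integral_Im[symmetric]) auto
    ultimately show "(\<integral>\<omega>\<in>C. 0 \<partial>M) = (\<integral>\<omega>\<in>C. Im (u (\<xi> s \<omega>)) \<partial>M)"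
      using char[OF C] by simp
  next
    show "integrable M (\<lambda>\<omega>. Im (u (\<xi> s \<omega>)))" using us by simp
    show "(\<lambda>\<omega>. Im (u (\<xi> s \<omega>))) \<in> borel_measurable (sigma_\<xi> s)"
      by (rule measurable_sigma_\<xi>[OF s]) simp
  qed simp
  have "AE \<omega> in M. real_cond_exp M (sigma_\<xi> s) (\<lambda>\<omega>. 0) \<omega> = 0"
    by (rule S.real_cond_exp_F_meas) auto
  with Re Im markov[OF s t A] show ?thesis
    unfolding sigma_\<xi>_def f_def[symmetric] u_def[symmetric]
    by eventually_elim (simp add: complex_eq_iff)
qed

lemma markov_inner_indicator:
  assumes A: "A \<in> sets \<pi>" and h: "h \<in> L2 \<pi>" and s: "0 \<le> s" and t: "0 \<le> t"
  shows "L2_inner M (\<lambda>\<omega>. indicator A (\<xi> (s + t) \<omega>)) (\<lambda>\<omega>. h (\<xi> 0 \<omega>)) = L2_inner M (\<lambda>\<omega>. T t (indicator A) (\<xi> s \<omega>)) (\<lambda>\<omega>. h (\<xi> 0 \<omega>))"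
proof -
  have st: "0 \<le> s + t" using s t by simp
  interpret \<pi>: prob_space \<pi> using prob_space_distr[OF measurable_\<xi>[of 0]] law by simp
  note [measurable] = measurable_\<xi>[OF s] measurable_\<xi>[OF st] A
  have fL2: "(indicator A :: 's \<Rightarrow> complex) \<in> L2 \<pi>"
    unfolding L2_def using A by (auto intro!: \<pi>.integrable_const_bound[where B=1] simp: indicator_def)
  interpret Fs: finite_measure_subalgebra M "F s" by standard (rule subalgebra_F[OF s])
  have hF: "(\<lambda>\<omega>. h (\<xi> 0 \<omega>)) \<in> borel_measurable (F s)"
  proof -
    have "subalgebra (F s) (F 0)"
      using subalgebra_F[OF s] subalgebra_F[of 0] F_mono[OF order_refl s] by (simp add: subalgebra_def)
    then have "\<xi> 0 \<in> F s \<rightarrow>\<^sub>M \<pi>"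
      by (rule measurable_from_subalg) (rule \<xi>_adapted[OF order_refl])
    then show ?thesis by (rule measurable_compose[OF _ L2_measurable[OF h]])
  qed
  have "AE \<omega> in M. real_cond_exp M (F s) (\<lambda>\<omega>. 0) \<omega> = 0"
    by (rule Fs.real_cond_exp_F_meas) auto
  with transition_op_indicator[OF A s t]
  have "AE \<omega> in M. T t (indicator A) (\<xi> s \<omega>) = complex_cond_exp M (F s) (\<lambda>\<omega>'. indicator A (\<xi> (s + t) \<omega>')) \<omega>"
  proof eventually_elim
    case (elim \<omega>)
    have "(\<lambda>\<omega>'. Re (indicator A (\<xi> (s + t) \<omega>'))) = indicator A \<circ> \<xi> (s + t)" "(\<lambda>\<omega>'. Im (indicator A (\<xi> (s + t) \<omega>'))) = (\<lambda>_. 0)"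
      by (auto simp: indicator_def)
    then show ?case using elim by (simp add: complex_cond_exp_def complex_eq_iff o_def)
  qed
  then show ?thesis
    by (intro inner_complex_cond_exp[OF subalgebra_F[OF s] L2_comp[OF fL2 st] L2_comp[OF h order_refl] hF, symmetric]
        L2_measurable[OF L2_comp[OF transition_op_L2[OF fL2 t] s]])
qed

lemma L2_inner_comp_weak_eq:
  assumes "weak_eq \<pi> u u'" and s: "0 \<le> s" and k: "k \<in> L2 M"
  shows "L2_inner M (\<lambda>\<omega>. u (\<xi> s \<omega>)) k = L2_inner M (\<lambda>\<omega>. u' (\<xi> s \<omega>)) k"
proof -
  have L2: "u \<in> L2 \<pi>" "u' \<in> L2 \<pi>" using assms by (auto dest: weak_eq_L2)
  have "(L2_norm \<pi> (\<lambda>x. u x - u' x))\<^sup>2 = 0"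
    unfolding L2_norm_square using assms L2 by (simp add: weak_eqD)
  then have "L2_norm M (\<lambda>\<omega>. u (\<xi> s \<omega>) - u' (\<xi> s \<omega>)) \<le> 0"
    using L2_norm_comp[of "\<lambda>x. u x - u' x" s] L2 s by simp
  from L2_inner_diff_small[OF L2_comp[OF L2(1) s] L2_comp[OF L2(2) s] k this]
  show ?thesis by simp
qed

lemma transition_op_add:
  assumes t: "0 \<le> t" and f: "f \<in> L2 \<pi>" and h: "h \<in> L2 \<pi>"
  shows "weak_eq \<pi> (T t (\<lambda>x. f x + h x)) (\<lambda>x. T t f x + T t h x)"
  using assms transition_op_L2[OF f t] transition_op_L2[OF h t]
  by (simp add: weak_eq_def transition_op_L2 inner_transition_op L2_comp)

lemma transition_op_cmult:
  assumes t: "0 \<le> t" and f: "f \<in> L2 \<pi>"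
  shows "weak_eq \<pi> (T t (\<lambda>x. c * f x)) (\<lambda>x. c * T t f x)"
  using assms transition_op_L2[OF f t]
  by (simp add: weak_eq_def transition_op_L2 inner_transition_op L2_comp)

lemma transition_op_sum_indicator:
  assumes "finite I" "\<And>y. y \<in> I \<Longrightarrow> A y \<in> sets \<pi>" "0 \<le> t"
  shows "(\<lambda>x. \<Sum>y\<in>I. c y * indicator (A y) x) \<in> L2 \<pi> \<and>
    weak_eq \<pi> (T t (\<lambda>x. \<Sum>y\<in>I. c y * indicator (A y) x)) (\<lambda>x. \<Sum>y\<in>I. c y * T t (indicator (A y)) x)"
proof -
  interpret \<pi>: prob_space \<pi> using prob_space_distr[OF measurable_\<xi>[of 0]] law by simp
  have ind: "(indicator B :: 's \<Rightarrow> complex) \<in> L2 \<pi>" if "B \<in> sets \<pi>" for B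
    unfolding L2_def using that by (auto intro!: \<pi>.integrable_const_bound[where B=1] simp: indicator_def)
  show ?thesis
    using assms(1,2)
  proof (induction I rule: finite_induct)
    case empty
    have "weak_eq \<pi> (T t (\<lambda>x. 0 * 0)) (\<lambda>x. 0 * T t (\<lambda>_. 0) x)"
      using assms(3) by (intro transition_op_cmult) auto
    then show ?case by simp
  next
    case (insert y I)
    have y: "indicator (A y) \<in> L2 \<pi>" using insert.prems by (intro ind) auto
    have IH: "(\<lambda>x. \<Sum>y\<in>I. c y * indicator (A y) x) \<in> L2 \<pi>"
      "weak_eq \<pi> (T t (\<lambda>x. \<Sum>y\<in>I. c y * indicator (A y) x)) (\<lambda>x. \<Sum>y\<in>I. c y * T t (indicator (A y)) x)"
      using insert by auto
    have "weak_eq \<pi> (T t (\<lambda>x. c y * indicator (A y) x + (\<Sum>y\<in>I. c y * indicator (A y) x)))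
        (\<lambda>x. c y * T t (indicator (A y)) x + (\<Sum>y\<in>I. c y * T t (indicator (A y)) x))"
      using transition_op_add[OF assms(3) L2_cmult[OF y] IH(1), of "c y"]
        transition_op_cmult[OF assms(3) y, of "c y"] IH(2) transition_op_L2[OF y assms(3)]
      by (auto simp: weak_eq_def)
    then show ?case
      unfolding sum.insert[OF insert.hyps] using L2_add[OF L2_cmult[OF y] IH(1)] by blast
  qed
qed

text \<open>
  The Markov property is given for indicator functions. It extends to \<open>L\<^sup>2\<close> by density of the simple
  functions, because both sides are continuous in \<open>f\<close>. Read through \<open>inner_transition_op\<close>, this
  identity is the semigroup law.
\<close>

lemma markov_inner:
  assumes f: "f \<in> L2 \<pi>" and h: "h \<in> L2 \<pi>" and s: "0 \<le> s" and t: "0 \<le> t"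
  shows "L2_inner M (\<lambda>\<omega>. f (\<xi> (s + t) \<omega>)) (\<lambda>\<omega>. h (\<xi> 0 \<omega>)) = L2_inner M (\<lambda>\<omega>. T t f (\<xi> s \<omega>)) (\<lambda>\<omega>. h (\<xi> 0 \<omega>))"
proof -
  have st: "0 \<le> s + t" using s t by simp
  interpret \<pi>: prob_space \<pi> using prob_space_distr[OF measurable_\<xi>[of 0]] law by simp
  have hL2: "(\<lambda>\<omega>. h (\<xi> 0 \<omega>)) \<in> L2 M" by (rule L2_comp[OF h order_refl])
  let ?D = "\<lambda>f. L2_inner M (\<lambda>\<omega>. f (\<xi> (s + t) \<omega>)) (\<lambda>\<omega>. h (\<xi> 0 \<omega>)) - L2_inner M (\<lambda>\<omega>. T t f (\<xi> s \<omega>)) (\<lambda>\<omega>. h (\<xi> 0 \<omega>))"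
  \<comment> \<open>\<open>?D f\<close> is the defect of the identity; it vanishes for simple functions and is small near them\<close>
  have D_sum: "?D (\<lambda>x. \<Sum>y\<in>I. c y * indicator (A y) x) = 0"
    if I: "finite I" "\<And>y. y \<in> I \<Longrightarrow> A y \<in> sets \<pi>" for I and c :: "complex \<Rightarrow> complex" and A
  proof -
    have ind: "(indicator (A y) :: 's \<Rightarrow> complex) \<in> L2 \<pi>" if "y \<in> I" for y
      unfolding L2_def using I that by (auto intro!: \<pi>.integrable_const_bound[where B=1] simp: indicator_def)
    have w: "weak_eq \<pi> (T t (\<lambda>x. \<Sum>y\<in>I. c y * indicator (A y) x)) (\<lambda>x. \<Sum>y\<in>I. c y * T t (indicator (A y)) x)"
      using transition_op_sum_indicator[of I A t c] I t by blast
    have "L2_inner M (\<lambda>\<omega>. T t (\<lambda>x. \<Sum>y\<in>I. c y * indicator (A y) x) (\<xi> s \<omega>)) (\<lambda>\<omega>. h (\<xi> 0 \<omega>))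
      = L2_inner M (\<lambda>\<omega>. \<Sum>y\<in>I. c y * T t (indicator (A y)) (\<xi> s \<omega>)) (\<lambda>\<omega>. h (\<xi> 0 \<omega>))"
      by (rule L2_inner_comp_weak_eq[OF w s hL2])
    also have "\<dots> = (\<Sum>y\<in>I. c y * L2_inner M (\<lambda>\<omega>. T t (indicator (A y)) (\<xi> s \<omega>)) (\<lambda>\<omega>. h (\<xi> 0 \<omega>)))"
      using I hL2 s t by (simp add: L2_inner_sum_left L2_comp transition_op_L2 ind)
    also have "\<dots> = (\<Sum>y\<in>I. c y * L2_inner M (\<lambda>\<omega>. indicator (A y) (\<xi> (s + t) \<omega>)) (\<lambda>\<omega>. h (\<xi> 0 \<omega>)))"
      using I by (intro sum.cong refl arg_cong2[where f="(*)"] markov_inner_indicator[symmetric] h s t) auto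
    also have "\<dots> = L2_inner M (\<lambda>\<omega>. \<Sum>y\<in>I. c y * indicator (A y) (\<xi> (s + t) \<omega>)) (\<lambda>\<omega>. h (\<xi> 0 \<omega>))"
      by (subst L2_inner_sum_left) (auto intro!: I hL2 L2_cmult L2_comp[OF ind st])
    finally show ?thesis by simp
  qed
  have bound: "cmod (?D f) \<le> 2 * e * L2_norm \<pi> h" if e: "e > 0" for e
  proof -
    obtain g where g: "simple_function \<pi> g" "g \<in> L2 \<pi>" "L2_norm \<pi> (\<lambda>x. f x - g x) < e"
      using L2_simple_approximation[OF f e] by blast
    define g' where "g' x = (\<Sum>y\<in>g ` space \<pi>. y * indicator (g -` {y} \<inter> space \<pi>) x)" for x
    have eq: "g x = g' x" if "x \<in> space \<pi>" for x
      unfolding g'_def by (rule simple_function_eq_sum_indicator[OF g(1) that])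
    have fin: "finite (g ` space \<pi>)" and meas: "\<And>y. g -` {y} \<inter> space \<pi> \<in> sets \<pi>"
      using simple_functionD[OF g(1)] by auto
    have g'L2: "g' \<in> L2 \<pi>"
      using transition_op_sum_indicator[OF fin meas t, of "\<lambda>y. y"] unfolding g'_def by simp
    have "L2_norm \<pi> (\<lambda>x. f x - g' x) = L2_norm \<pi> (\<lambda>x. f x - g x)"
      unfolding L2_norm_def by (simp add: eq cong: Bochner_Integration.integral_cong)
    then have e': "L2_norm \<pi> (\<lambda>x. f x - g' x) < e" using g(3) by simp
    have D0: "?D g' = 0"
      using D_sum[OF fin meas, of "\<lambda>y. y"] by (simp only: g'_def[abs_def])
    have "L2_norm M (\<lambda>\<omega>. f (\<xi> (s + t) \<omega>) - g' (\<xi> (s + t) \<omega>)) \<le> e"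
      using e' L2_norm_comp[OF L2_diff[OF f g'L2] st] by simp
    from L2_inner_diff_small[OF L2_comp[OF f st] L2_comp[OF g'L2 st] hL2 this]
    have 1: "cmod (L2_inner M (\<lambda>\<omega>. f (\<xi> (s + t) \<omega>)) (\<lambda>\<omega>. h (\<xi> 0 \<omega>)) - L2_inner M (\<lambda>\<omega>. g' (\<xi> (s + t) \<omega>)) (\<lambda>\<omega>. h (\<xi> 0 \<omega>)))
        \<le> e * L2_norm \<pi> h"
      by (simp only: L2_norm_comp[OF h order_refl])
    have "weak_eq \<pi> (T t (\<lambda>x. f x - g' x)) (\<lambda>x. T t f x - T t g' x)"
      using f g'L2 t by (simp add: weak_eq_def transition_op_L2 inner_transition_op L2_comp)
    then have "L2_norm \<pi> (\<lambda>x. T t f x - T t g' x) = L2_norm \<pi> (T t (\<lambda>x. f x - g' x))"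
      by (rule weak_eq_norm[symmetric])
    also have "\<dots> \<le> e"
      using transition_op_contraction[OF L2_diff[OF f g'L2] t] e' by simp
    finally have "L2_norm M (\<lambda>\<omega>. T t f (\<xi> s \<omega>) - T t g' (\<xi> s \<omega>)) \<le> e"
      using L2_norm_comp[OF L2_diff[OF transition_op_L2[OF f t] transition_op_L2[OF g'L2 t]] s] by simp
    from L2_inner_diff_small[OF L2_comp[OF transition_op_L2[OF f t] s] L2_comp[OF transition_op_L2[OF g'L2 t] s] hL2 this]
    have 2: "cmod (L2_inner M (\<lambda>\<omega>. T t f (\<xi> s \<omega>)) (\<lambda>\<omega>. h (\<xi> 0 \<omega>)) - L2_inner M (\<lambda>\<omega>. T t g' (\<xi> s \<omega>)) (\<lambda>\<omega>. h (\<xi> 0 \<omega>)))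
        \<le> e * L2_norm \<pi> h"
      by (simp only: L2_norm_comp[OF h order_refl])
    have alg: "cmod (a - b) \<le> 2 * r" if "a' - b' = 0" "cmod (a - a') \<le> r" "cmod (b - b') \<le> r" for a b a' b' :: complex and r
    proof -
      have "a - b = (a - a') - (b - b')" using that(1) by simp
      then show ?thesis using norm_triangle_ineq4[of "a - a'" "b - b'"] that by simp
    qed
    show ?thesis using alg[OF D0 1 2] by simp
  qed
  have "cmod (?D f) \<le> 0"
  proof (rule tendsto_lowerbound)
    show "((\<lambda>e. 2 * e * L2_norm \<pi> h) \<longlongrightarrow> 0) (at_right 0)"
      by (auto intro!: tendsto_eq_intros)
    show "\<forall>\<^sub>F e in at_right 0. cmod (?D f) \<le> 2 * e * L2_norm \<pi> h"
      using eventually_at_right_less[of 0] by eventually_elim (rule bound)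
  qed simp
  then show ?thesis by simp
qed

lemma contraction_semigroup_transition_op:
  assumes "strongly_continuous \<pi> T"
  shows "contraction_semigroup \<pi> T"
proof
  show "weak_eq \<pi> (T (s + t) f) (T s (T t f))" if "0 \<le> s" "0 \<le> t" "f \<in> L2 \<pi>" for s t f
    using that by (simp add: weak_eq_def transition_op_L2 inner_transition_op markov_inner)
  show "weak_eq \<pi> (T 0 f) f" if "f \<in> L2 \<pi>" for f
    using that by (simp add: weak_eq_def transition_op_L2 inner_transition_op L2_inner_comp)
qed (use assms in \<open>auto intro: transition_op_L2 transition_op_add transition_op_cmult transition_op_contraction\<close>)

end

section \<open>The variance of the integrated process as a spectral integral\<close>

text \<open>
  Fubini's theorem, first for the mean and then for the second moment.
\<close>

lemma (in prob_space) variance_of_integral: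
  fixes G :: "'b \<Rightarrow> 'a \<Rightarrow> real" and \<Lambda> :: "'b measure"
  assumes \<Lambda>: "finite_measure \<Lambda>"
    and meas [measurable]: "(\<lambda>(s, \<omega>). G s \<omega>) \<in> borel_measurable (\<Lambda> \<Otimes>\<^sub>M M)"
    and sq: "\<And>s. s \<in> space \<Lambda> \<Longrightarrow> integrable M (\<lambda>\<omega>. (G s \<omega>)\<^sup>2)"
    and bound: "\<And>s. s \<in> space \<Lambda> \<Longrightarrow> (\<integral>\<omega>. (G s \<omega>)\<^sup>2 \<partial>M) \<le> B"
    and mean: "\<And>s. s \<in> space \<Lambda> \<Longrightarrow> (\<integral>\<omega>. G s \<omega> \<partial>M) = 0"
  shows "variance (\<lambda>\<omega>. \<integral>s. G s \<omega> \<partial>\<Lambda>) = (\<integral>p. (\<integral>\<omega>. G (fst p) \<omega> * G (snd p) \<omega> \<partial>M) \<partial>(\<Lambda> \<Otimes>\<^sub>M \<Lambda>))"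
proof -
  interpret L: finite_measure \<Lambda> by fact
  interpret LL: finite_measure "\<Lambda> \<Otimes>\<^sub>M \<Lambda>"
    by (rule finite_measure_pair_measure) fact+
  interpret LM: pair_sigma_finite \<Lambda> M ..
  interpret PL: pair_sigma_finite \<Lambda> \<Lambda> ..
  interpret PM: pair_sigma_finite "\<Lambda> \<Otimes>\<^sub>M \<Lambda>" M ..
  have Gs [measurable]: "G s \<in> borel_measurable M" if "s \<in> space \<Lambda>" for s
    using measurable_Pair2[OF meas that] by simp
  have int: "integrable M (G s)" if "s \<in> space \<Lambda>" for s
    by (rule square_integrable_imp_integrable[OF Gs sq]) (fact that)+
  have B0: "0 \<le> B" if "s \<in> space \<Lambda>" for s
    using bound[OF that] by (rule order_trans[rotated]) (intro integral_nonneg_AE, simp)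
  have abs_bound: "(\<integral>\<omega>. \<bar>G s \<omega>\<bar> \<partial>M) \<le> 1 + B" if s: "s \<in> space \<Lambda>" for s
  proof -
    have "\<bar>x\<bar> \<le> 1 + x\<^sup>2" for x :: real
    proof -
      have "2 * \<bar>x\<bar> \<le> 1 + x\<^sup>2" using sum_squares_bound[of 1 "\<bar>x\<bar>"] by simp
      then show ?thesis using abs_ge_zero[of x] by linarith
    qed
    then have "(\<integral>\<omega>. \<bar>G s \<omega>\<bar> \<partial>M) \<le> (\<integral>\<omega>. 1 + (G s \<omega>)\<^sup>2 \<partial>M)"
      using int[OF s] sq[OF s] by (intro integral_mono) auto
    also have "\<dots> \<le> 1 + B" using sq[OF s] bound[OF s] by (simp add: prob_space)
    finally show ?thesis .
  qed
  have LM_int: "integrable (\<Lambda> \<Otimes>\<^sub>M M) (\<lambda>(s, \<omega>). G s \<omega>)"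
  proof (rule LM.Fubini_integrable[OF meas])
    show "integrable \<Lambda> (\<lambda>s. \<integral>\<omega>. norm (case (s, \<omega>) of (s, \<omega>) \<Rightarrow> G s \<omega>) \<partial>M)"
    proof (rule L.integrable_const_bound[where B="1 + B"])
      show "AE s in \<Lambda>. norm (\<integral>\<omega>. norm (case (s, \<omega>) of (s, \<omega>) \<Rightarrow> G s \<omega>) \<partial>M) \<le> 1 + B"
        using abs_bound by (intro AE_I2) (simp add: integral_nonneg_AE)
    qed measurable
  qed (use int in auto)
  have "expectation (\<lambda>\<omega>. \<integral>s. G s \<omega> \<partial>\<Lambda>) = (\<integral>s. (\<integral>\<omega>. G s \<omega> \<partial>M) \<partial>\<Lambda>)"
    by (rule LM.Fubini_integral[OF LM_int])
  also have "\<dots> = 0"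
    using mean by (simp cong: Bochner_Integration.integral_cong)
  finally have E0: "expectation (\<lambda>\<omega>. \<integral>s. G s \<omega> \<partial>\<Lambda>) = 0" .
  let ?H = "\<lambda>p \<omega>. G (fst p) \<omega> * G (snd p) \<omega>"
  have meas_prod: "(\<lambda>(p, \<omega>). ?H p \<omega>) \<in> borel_measurable ((\<Lambda> \<Otimes>\<^sub>M \<Lambda>) \<Otimes>\<^sub>M M)"
  proof -
    have 1: "(\<lambda>q. (fst (fst q), snd q)) \<in> (\<Lambda> \<Otimes>\<^sub>M \<Lambda>) \<Otimes>\<^sub>M M \<rightarrow>\<^sub>M \<Lambda> \<Otimes>\<^sub>M M"
      and 2: "(\<lambda>q. (snd (fst q), snd q)) \<in> (\<Lambda> \<Otimes>\<^sub>M \<Lambda>) \<Otimes>\<^sub>M M \<rightarrow>\<^sub>M \<Lambda> \<Otimes>\<^sub>M M"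
      by measurable
    from measurable_compose[OF 1 meas] measurable_compose[OF 2 meas]
    show ?thesis by (simp add: case_prod_beta')
  qed
  have prod_bound: "(\<integral>\<omega>. \<bar>G s \<omega> * G u \<omega>\<bar> \<partial>M) \<le> B" "integrable M (\<lambda>\<omega>. G s \<omega> * G u \<omega>)"
    if s: "s \<in> space \<Lambda>" and u: "u \<in> space \<Lambda>" for s u
  proof -
    have le: "\<bar>x * y\<bar> \<le> (x\<^sup>2 + y\<^sup>2) / 2" for x y :: real
      using sum_squares_bound[of "\<bar>x\<bar>" "\<bar>y\<bar>"] by (simp add: abs_mult)
    show int: "integrable M (\<lambda>\<omega>. G s \<omega> * G u \<omega>)"
      by (rule Bochner_Integration.integrable_bound[of M "\<lambda>\<omega>. ((G s \<omega>)\<^sup>2 + (G u \<omega>)\<^sup>2) / 2"])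
         (use sq s u le Gs in \<open>auto intro!: AE_I2\<close>)
    have "(\<integral>\<omega>. \<bar>G s \<omega> * G u \<omega>\<bar> \<partial>M) \<le> (\<integral>\<omega>. ((G s \<omega>)\<^sup>2 + (G u \<omega>)\<^sup>2) / 2 \<partial>M)"
      using int sq[OF s] sq[OF u] le by (intro integral_mono) auto
    also have "\<dots> \<le> B" using sq[OF s] sq[OF u] bound[OF s] bound[OF u] by simp
    finally show "(\<integral>\<omega>. \<bar>G s \<omega> * G u \<omega>\<bar> \<partial>M) \<le> B" .
  qed
  have PM_int: "integrable ((\<Lambda> \<Otimes>\<^sub>M \<Lambda>) \<Otimes>\<^sub>M M) (\<lambda>(p, \<omega>). ?H p \<omega>)"
  proof (rule PM.Fubini_integrable[OF meas_prod])
    show "integrable (\<Lambda> \<Otimes>\<^sub>M \<Lambda>) (\<lambda>p. \<integral>\<omega>. norm (case (p, \<omega>) of (p, \<omega>) \<Rightarrow> ?H p \<omega>) \<partial>M)"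
    proof (rule LL.integrable_const_bound[where B=B])
      show "AE p in \<Lambda> \<Otimes>\<^sub>M \<Lambda>. norm (\<integral>\<omega>. norm (case (p, \<omega>) of (p, \<omega>) \<Rightarrow> ?H p \<omega>) \<partial>M) \<le> B"
        using prod_bound(1) by (intro AE_I2) (auto simp: integral_nonneg_AE space_pair_measure)
      show "(\<lambda>p. \<integral>\<omega>. norm (case (p, \<omega>) of (p, \<omega>) \<Rightarrow> ?H p \<omega>) \<partial>M) \<in> borel_measurable (\<Lambda> \<Otimes>\<^sub>M \<Lambda>)"
        using meas_prod by measurable
    qed
    show "AE p in \<Lambda> \<Otimes>\<^sub>M \<Lambda>. integrable M (\<lambda>\<omega>. case (p, \<omega>) of (p, \<omega>) \<Rightarrow> ?H p \<omega>)"
      using prod_bound(2) by (intro AE_I2) (auto simp: space_pair_measure)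
  qed
  have sqS: "AE \<omega> in M. (\<integral>s. G s \<omega> \<partial>\<Lambda>)\<^sup>2 = (\<integral>p. ?H p \<omega> \<partial>(\<Lambda> \<Otimes>\<^sub>M \<Lambda>))"
    using PM.AE_integrable_snd[OF PM_int]
  proof eventually_elim
    case (elim \<omega>)
    have "(\<integral>p. ?H p \<omega> \<partial>(\<Lambda> \<Otimes>\<^sub>M \<Lambda>)) = (\<integral>s. (\<integral>u. ?H (s, u) \<omega> \<partial>\<Lambda>) \<partial>\<Lambda>)"
      by (rule PL.integral_fst'[OF elim, symmetric])
    then show ?case by (simp add: power2_eq_square)
  qed
  have "variance (\<lambda>\<omega>. \<integral>s. G s \<omega> \<partial>\<Lambda>) = expectation (\<lambda>\<omega>. (\<integral>s. G s \<omega> \<partial>\<Lambda>)\<^sup>2)"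
    by (simp add: E0)
  also have "\<dots> = (\<integral>\<omega>. (\<integral>p. ?H p \<omega> \<partial>(\<Lambda> \<Otimes>\<^sub>M \<Lambda>)) \<partial>M)"
  proof (rule integral_cong_AE)
    show "(\<lambda>\<omega>. (\<integral>s. G s \<omega> \<partial>\<Lambda>)\<^sup>2) \<in> borel_measurable M"
      using borel_measurable_integrable[OF LM.integrable_snd[OF LM_int]] by measurable
    show "(\<lambda>\<omega>. \<integral>p. ?H p \<omega> \<partial>(\<Lambda> \<Otimes>\<^sub>M \<Lambda>)) \<in> borel_measurable M"
      using borel_measurable_integrable[OF PM.integrable_snd[OF PM_int]] .
  qed (rule sqS)
  also have "\<dots> = (\<integral>p. (\<integral>\<omega>. ?H p \<omega> \<partial>M) \<partial>(\<Lambda> \<Otimes>\<^sub>M \<Lambda>))"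
    by (rule PM.Fubini_integral[OF PM_int])
  finally show ?thesis .
qed

text \<open>
  Restricted Lebesgue measure instead of set integrals, so that Fubini's theorem for finite measures
  applies to \<open>[0, T]\<^sup>2\<close> without indicator functions.
\<close>

definition time_measure :: "real \<Rightarrow> real measure" where
  "time_measure T = restrict_space lborel {0..T}"

lemma space_time_measure [simp]: "space (time_measure T) = {0..T}"
  by (simp add: time_measure_def space_restrict_space)

lemma sets_time_measure [measurable_cong]: "sets (time_measure T) = sets (restrict_space borel {0..T})"
  by (simp add: time_measure_def sets_restrict_space)

lemma finite_measure_time_measure: "finite_measure (time_measure T)"
  by (rule finite_measureI) (simp add: time_measure_def emeasure_restrict_space emeasure_lborel_Icc_eq)

lemma integral_time_measure:
  fixes f :: "real \<Rightarrow> 'b :: {banach, second_countable_topology}"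
  shows "(\<integral>s. f s \<partial>time_measure T) = (\<integral>s. indicator {0..T} s *\<^sub>R f s \<partial>lborel)"
  unfolding time_measure_def by (subst integral_restrict_space) auto

lemma borel_measurable_exp_complex [measurable]: "(exp :: complex \<Rightarrow> complex) \<in> borel_measurable borel"
  by (intro borel_measurable_continuous_onI continuous_intros)

lemma measurable_time_diff [measurable]:
  "(\<lambda>p. \<bar>fst p - snd p\<bar>) \<in> borel_measurable (time_measure T \<Otimes>\<^sub>M time_measure T)"
proof -
  have id: "(\<lambda>s. s) \<in> borel_measurable (time_measure T)"
    unfolding time_measure_def by (rule measurable_restrict_space1) simp
  have "fst \<in> borel_measurable (time_measure T \<Otimes>\<^sub>M time_measure T)" "snd \<in> borel_measurable (time_measure T \<Otimes>\<^sub>M time_measure T)"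
    using measurable_compose[OF measurable_fst id] measurable_compose[OF measurable_snd id] by auto
  then show ?thesis by measurable
qed

definition time_kernel :: "real \<Rightarrow> complex \<Rightarrow> real" where
  "time_kernel T z = (\<integral>p. Re (exp (z * of_real \<bar>fst p - snd p\<bar>)) \<partial>(time_measure T \<Otimes>\<^sub>M time_measure T))"

lemma integral_exp_abs_diff:
  fixes z :: complex
  assumes z: "z \<noteq> 0" and s: "0 \<le> s" "s \<le> T"
  shows "(\<integral>u. exp (z * of_real \<bar>s - u\<bar>) \<partial>time_measure T) = (exp (z * of_real s) + exp (z * of_real (T - s)) - 2) / z"
proof -
  have d1: "((\<lambda>u. - exp (z * (of_real s - of_real u)) / z) has_vector_derivative exp (z * (of_real s - of_real u))) (at u within S)" for u S
    by (rule has_vector_derivative_real_field[where f="\<lambda>w. - exp (z * (of_real s - w)) / z"])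
       (use z in \<open>auto intro!: derivative_eq_intros\<close>)
  have d2: "((\<lambda>u. exp (z * (of_real u - of_real s)) / z) has_vector_derivative exp (z * (of_real u - of_real s))) (at u within S)" for u S
    by (rule has_vector_derivative_real_field[where f="\<lambda>w. exp (z * (w - of_real s)) / z"])
       (use z in \<open>auto intro!: derivative_eq_intros\<close>)
  have c1: "continuous_on {0..s} (\<lambda>u. exp (z * (of_real s - complex_of_real u)))"
    and c2: "continuous_on {s..T} (\<lambda>u. exp (z * (complex_of_real u - of_real s)))"
    by (intro continuous_intros)+
  have i1: "integrable lborel (\<lambda>u. indicator {0..s} u *\<^sub>R exp (z * (of_real s - complex_of_real u)))"
    and i2: "integrable lborel (\<lambda>u. indicator {s..T} u *\<^sub>R exp (z * (complex_of_real u - of_real s)))"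
    using borel_integrable_atLeastAtMost'[OF c1] borel_integrable_atLeastAtMost'[OF c2] by (auto simp: set_integrable_def)
  have "(\<integral>u. exp (z * of_real \<bar>s - u\<bar>) \<partial>time_measure T)
    = (\<integral>u. indicator {0..s} u *\<^sub>R exp (z * (of_real s - of_real u)) + indicator {s..T} u *\<^sub>R exp (z * (of_real u - of_real s)) \<partial>lborel)"
    unfolding integral_time_measure
  proof (rule integral_cong_AE)
    show "AE u in lborel. indicator {0..T} u *\<^sub>R exp (z * of_real \<bar>s - u\<bar>)
      = indicator {0..s} u *\<^sub>R exp (z * (of_real s - of_real u)) + indicator {s..T} u *\<^sub>R exp (z * (of_real u - of_real s))"
      using AE_lborel_singleton[of s] by eventually_elim (use s in \<open>auto simp: indicator_def\<close>)
  qed measurable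
  also have "\<dots> = (\<integral>u. indicator {0..s} u *\<^sub>R exp (z * (of_real s - of_real u)) \<partial>lborel)
      + (\<integral>u. indicator {s..T} u *\<^sub>R exp (z * (of_real u - of_real s)) \<partial>lborel)"
    by (rule Bochner_Integration.integral_add[OF i1 i2])
  also have "(\<integral>u. indicator {0..s} u *\<^sub>R exp (z * (of_real s - of_real u)) \<partial>lborel)
      = - exp (z * (of_real s - of_real s)) / z - - exp (z * (of_real s - of_real 0)) / z"
    by (rule integral_FTC_atLeastAtMost[OF s(1) d1 c1])
  also have "(\<integral>u. indicator {s..T} u *\<^sub>R exp (z * (of_real u - of_real s)) \<partial>lborel)
      = exp (z * (of_real T - of_real s)) / z - exp (z * (of_real s - of_real s)) / z"
    by (rule integral_FTC_atLeastAtMost[OF s(2) d2 c2])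
  finally show ?thesis by (simp add: diff_divide_distrib add_divide_distrib)
qed

lemma integrable_exp_time:
  assumes "Re z \<le> 0"
  shows "integrable (time_measure T \<Otimes>\<^sub>M time_measure T) (\<lambda>p. exp (z * of_real \<bar>fst p - snd p\<bar>))"
proof -
  interpret finite_measure "time_measure T \<Otimes>\<^sub>M time_measure T"
    by (intro finite_measure_pair_measure finite_measure_time_measure)
  show ?thesis
    using assms by (intro integrable_const_bound[where B=1]) (auto intro!: AE_I2 mult_nonpos_nonneg)
qed

lemma time_kernel_eq:
  assumes z: "Re z \<le> 0" and T: "0 \<le> T"
  shows "time_kernel T z = (if z = 0 then T\<^sup>2 else 2 * Re ((exp (z * of_real T) - 1) / z\<^sup>2) - 2 * T * Re (1 / z))"
proof -
  interpret L: finite_measure "time_measure T" by (rule finite_measure_time_measure)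
  interpret pair_sigma_finite "time_measure T" "time_measure T" ..
  have "time_kernel T z = Re (\<integral>p. exp (z * of_real \<bar>fst p - snd p\<bar>) \<partial>(time_measure T \<Otimes>\<^sub>M time_measure T))"
    unfolding time_kernel_def by (rule integral_Re[OF integrable_exp_time[OF z]])
  also have "(\<integral>p. exp (z * of_real \<bar>fst p - snd p\<bar>) \<partial>(time_measure T \<Otimes>\<^sub>M time_measure T))
     = (\<integral>s. (\<integral>u. exp (z * of_real \<bar>s - u\<bar>) \<partial>time_measure T) \<partial>time_measure T)"
    using integral_fst'[OF integrable_exp_time[OF z]] by simp
  also have "\<dots> = (if z = 0 then of_real (T\<^sup>2) else 2 * ((exp (z * of_real T) - 1) / z\<^sup>2) - 2 * of_real T * (1 / z))"
  proof (cases "z = 0")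
    case True
    have "measure (time_measure T) {0..T} = T"
      using T by (simp add: time_measure_def measure_restrict_space)
    then show ?thesis using True T by (simp add: scaleR_conv_of_real power2_eq_square)
  next
    case False
    have d: "((\<lambda>s. (exp (z * of_real s) / z - exp (z * (of_real T - of_real s)) / z - 2 * of_real s) / z) has_vector_derivative
        (exp (z * of_real s) + exp (z * (of_real T - of_real s)) - 2) / z) (at s within S)" for s S
      by (rule has_vector_derivative_real_field[where f="\<lambda>w. (exp (z * w) / z - exp (z * (of_real T - w)) / z - 2 * w) / z"]) (use False in \<open>auto intro!: derivative_eq_intros simp: field_simps\<close>)
    have c: "continuous_on {0..T} (\<lambda>s. (exp (z * complex_of_real s) + exp (z * (of_real T - complex_of_real s)) - 2) / z)"
      using False by (intro continuous_intros) auto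
    have "(\<integral>s. (\<integral>u. exp (z * of_real \<bar>s - u\<bar>) \<partial>time_measure T) \<partial>time_measure T)
      = (\<integral>s. (exp (z * of_real s) + exp (z * (of_real T - of_real s)) - 2) / z \<partial>time_measure T)"
      using False by (intro Bochner_Integration.integral_cong refl) (simp add: integral_exp_abs_diff)
    also have "\<dots> = (exp (z * of_real T) / z - exp (z * (of_real T - of_real T)) / z - 2 * of_real T) / z
        - (exp (z * of_real 0) / z - exp (z * (of_real T - of_real 0)) / z - 2 * of_real 0) / z"
      unfolding integral_time_measure by (rule integral_FTC_atLeastAtMost[OF T d c])
    also have "\<dots> = 2 * ((exp (z * of_real T) - 1) / z\<^sup>2) - 2 * of_real T * (1 / z)"
      using False by (simp add: field_simps power2_eq_square)
    finally show ?thesis using False by simp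
  qed
  finally have eq: "time_kernel T z = Re (if z = 0 then of_real (T\<^sup>2) else 2 * ((exp (z * of_real T) - 1) / z\<^sup>2) - 2 * of_real T * (1 / z))" .
  have "Re (2 * v - 2 * of_real T * w) = 2 * Re v - 2 * T * Re w" for v w by simp
  then show ?thesis using eq
    by (cases "z = 0") (simp, simp only: if_False)
qed

context stationary_markov_process
begin

lemma L2_0_real:
  assumes "g \<in> L2_0 \<pi>"
  shows "g \<in> borel_measurable \<pi>" "integrable \<pi> (\<lambda>x. (g x)\<^sup>2)" "(\<integral>x. g x \<partial>\<pi>) = 0"
    and "(\<lambda>x. complex_of_real (g x)) \<in> L2 \<pi>"
  using assms by (auto simp: L2_0_def L2_def)

lemma covariance_spectral:
  assumes sc: "strongly_continuous \<pi> T"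
    and E: "spectral_resolution \<pi> (generator \<pi> T) E"
    and g: "g \<in> L2_0 \<pi>" and s: "0 \<le> s" and u: "0 \<le> u"
  shows "(\<integral>\<omega>. g (\<xi> s \<omega>) * g (\<xi> u \<omega>) \<partial>M)
    = Re (\<integral>z\<in>left_half_plane. exp (z * of_real \<bar>s - u\<bar>) \<partial>pvm_measure \<pi> E (\<lambda>x. complex_of_real (g x)))"
proof -
  interpret R: resolved_semigroup \<pi> T E
    using contraction_semigroup_transition_op[OF sc] E
    by (auto simp: resolved_semigroup_def resolved_semigroup_axioms_def pvm_def spectral_resolution_def)
  let ?g = "\<lambda>x. complex_of_real (g x)"
  have gL2: "?g \<in> L2 \<pi>" by (rule L2_0_real[OF g])
  have main: "(\<integral>\<omega>. g (\<xi> s \<omega>) * g (\<xi> (s + t) \<omega>) \<partial>M) = Re (\<integral>z\<in>left_half_plane. exp (z * of_real t) \<partial>pvm_measure \<pi> E ?g)"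
    if "0 \<le> s" "0 \<le> t" for s t
  proof -
    have "complex_of_real (\<integral>\<omega>. g (\<xi> s \<omega>) * g (\<xi> (s + t) \<omega>) \<partial>M) = L2_inner M (\<lambda>\<omega>. ?g (\<xi> (s + t) \<omega>)) (\<lambda>\<omega>. ?g (\<xi> s \<omega>))"
      unfolding L2_inner_def by (subst integral_complex_of_real[symmetric]) (simp add: mult.commute)
    also have "\<dots> = L2_inner \<pi> (T t ?g) ?g"
      using L2_inner_stationary[OF gL2 gL2 that] inner_transition_op[OF gL2 gL2 that(2)] by simp
    also have "\<dots> = (\<integral>z\<in>left_half_plane. exp (z * of_real t) \<partial>pvm_measure \<pi> E ?g)"
      by (rule R.inner_T_spectral[OF gL2 that(2)])
    finally show ?thesis by (metis Re_complex_of_real)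
  qed
  show ?thesis
  proof (cases "s \<le> u")
    case True
    then show ?thesis using main[of s "u - s"] s by simp
  next
    case False
    then show ?thesis using main[of u "s - u"] u by (simp add: mult.commute)
  qed
qed

text \<open>
  Inserting the spectral form of the covariance into the double time integral and exchanging
  the order of integration once more.
\<close>

lemma var_S_spectral:
  assumes sc: "strongly_continuous \<pi> T"
    and E: "spectral_resolution \<pi> (generator \<pi> T) E"
    and g: "g \<in> L2_0 \<pi>" and t: "0 \<le> t"
  defines "\<nu> \<equiv> pvm_measure \<pi> E (\<lambda>x. complex_of_real (g x))"
  shows "var_S M \<xi> g t = (\<integral>z\<in>left_half_plane. time_kernel t z \<partial>\<nu>)"
proof -
  interpret R: resolved_semigroup \<pi> T E
    using contraction_semigroup_transition_op[OF sc] E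
    by (auto simp: resolved_semigroup_def resolved_semigroup_axioms_def pvm_def spectral_resolution_def)
  let ?g = "\<lambda>x. complex_of_real (g x)"
  have gL2: "?g \<in> L2 \<pi>" by (rule L2_0_real[OF g])
  note g' = L2_0_real(1-3)[OF g]
  interpret N: finite_measure \<nu> unfolding \<nu>_def by (rule R.finite_measure_pvm[OF gL2])
  have sets_\<nu>[measurable_cong]: "sets \<nu> = sets borel" unfolding \<nu>_def by simp
  let ?L = "time_measure t"
  interpret L: finite_measure ?L by (rule finite_measure_time_measure)
  interpret LL: finite_measure "?L \<Otimes>\<^sub>M ?L"
    by (intro finite_measure_pair_measure finite_measure_time_measure)
  interpret P: pair_sigma_finite "?L \<Otimes>\<^sub>M ?L" \<nu> ..
  have "var_S M \<xi> g t = variance (\<lambda>\<omega>. \<integral>s. g (\<xi> s \<omega>) \<partial>?L)"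
    unfolding var_S_def integrated_process_def integral_time_measure set_lebesgue_integral_def ..
  also have "\<dots> = (\<integral>p. (\<integral>\<omega>. g (\<xi> (fst p) \<omega>) * g (\<xi> (snd p) \<omega>) \<partial>M) \<partial>(?L \<Otimes>\<^sub>M ?L))"
  proof (rule variance_of_integral[OF finite_measure_time_measure, where B="\<integral>x. (g x)\<^sup>2 \<partial>\<pi>"])
    have "(\<lambda>(s, \<omega>). \<xi> s \<omega>) \<in> ?L \<Otimes>\<^sub>M M \<rightarrow>\<^sub>M \<pi>"
      using measurable_pair_\<xi>[OF t]
      by (simp add: measurable_def space_pair_measure space_restrict_space sets_pair_measure_cong[OF sets_time_measure refl])
    from measurable_compose[OF this g'(1)]
    show "(\<lambda>(s, \<omega>). g (\<xi> s \<omega>)) \<in> borel_measurable (?L \<Otimes>\<^sub>M M)"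
      by (simp add: case_prod_beta')
    fix s assume "s \<in> space ?L"
    then have s: "0 \<le> s" by simp
    note [measurable] = measurable_\<xi>[OF s] g'(1)
    have "integrable (distr M \<pi> (\<xi> s)) (\<lambda>x. (g x)\<^sup>2)" using g'(2) by (simp add: distr_\<xi>[OF s])
    then show "integrable M (\<lambda>\<omega>. (g (\<xi> s \<omega>))\<^sup>2)" by (simp add: integrable_distr_eq)
    have "(\<integral>x. (g x)\<^sup>2 \<partial>distr M \<pi> (\<xi> s)) = (\<integral>\<omega>. (g (\<xi> s \<omega>))\<^sup>2 \<partial>M)"
      by (subst integral_distr) auto
    then show "(\<integral>\<omega>. (g (\<xi> s \<omega>))\<^sup>2 \<partial>M) \<le> (\<integral>x. (g x)\<^sup>2 \<partial>\<pi>)" by (simp add: distr_\<xi>[OF s])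
    have "(\<integral>x. g x \<partial>distr M \<pi> (\<xi> s)) = (\<integral>\<omega>. g (\<xi> s \<omega>) \<partial>M)"
      by (subst integral_distr) auto
    then show "(\<integral>\<omega>. g (\<xi> s \<omega>) \<partial>M) = 0" using g'(3) by (simp add: distr_\<xi>[OF s])
  qed
  also have "\<dots> = (\<integral>p. (\<integral>z. Re (indicator left_half_plane z *\<^sub>R exp (z * of_real \<bar>fst p - snd p\<bar>)) \<partial>\<nu>) \<partial>(?L \<Otimes>\<^sub>M ?L))"
  proof (intro Bochner_Integration.integral_cong refl)
    fix p assume "p \<in> space (?L \<Otimes>\<^sub>M ?L)"
    then have p: "0 \<le> fst p" "0 \<le> snd p" by (auto simp: space_pair_measure)
    have "integrable \<nu> (\<lambda>z. indicator left_half_plane z *\<^sub>R exp (z * of_real \<bar>fst p - snd p\<bar>))"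
      using R.integrable_exp_left_half_plane[OF gL2, of "\<bar>fst p - snd p\<bar>" left_half_plane]
      by (simp add: set_integrable_def \<nu>_def)
    then show "(\<integral>\<omega>. g (\<xi> (fst p) \<omega>) * g (\<xi> (snd p) \<omega>) \<partial>M)
        = (\<integral>z. Re (indicator left_half_plane z *\<^sub>R exp (z * of_real \<bar>fst p - snd p\<bar>)) \<partial>\<nu>)"
      unfolding covariance_spectral[OF sc E g p] \<nu>_def[symmetric] set_lebesgue_integral_def
      by (rule integral_Re[symmetric])
  qed
  also have "\<dots> = (\<integral>z. (\<integral>p. Re (indicator left_half_plane z *\<^sub>R exp (z * of_real \<bar>fst p - snd p\<bar>)) \<partial>(?L \<Otimes>\<^sub>M ?L)) \<partial>\<nu>)"
  proof (rule P.Fubini_integral[symmetric])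
    interpret PN: finite_measure "(?L \<Otimes>\<^sub>M ?L) \<Otimes>\<^sub>M \<nu>"
      by (intro finite_measure_pair_measure finite_measure_time_measure) (rule N.finite_measure_axioms)
    show "integrable ((?L \<Otimes>\<^sub>M ?L) \<Otimes>\<^sub>M \<nu>) (\<lambda>(p, z). Re (indicator left_half_plane z *\<^sub>R exp (z * of_real \<bar>fst p - snd p\<bar>)))"
    proof (rule PN.integrable_const_bound[where B=1])
      show "AE q in (?L \<Otimes>\<^sub>M ?L) \<Otimes>\<^sub>M \<nu>. norm (case q of (p, z) \<Rightarrow> Re (indicator left_half_plane z *\<^sub>R exp (z * of_real \<bar>fst p - snd p\<bar>))) \<le> 1"
      proof (intro AE_I2)
        fix q :: "(real \<times> real) \<times> complex"
        obtain p z where q: "q = (p, z)" by (cases q)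
        have "cmod (indicator left_half_plane z *\<^sub>R exp (z * of_real \<bar>fst p - snd p\<bar>)) \<le> 1"
          by (auto simp: indicator_def left_half_plane_def mult_nonpos_nonneg)
        then have "\<bar>Re (indicator left_half_plane z *\<^sub>R exp (z * of_real \<bar>fst p - snd p\<bar>))\<bar> \<le> 1"
          by (rule order_trans[OF abs_Re_le_cmod])
        then show "norm (case q of (p, z) \<Rightarrow> Re (indicator left_half_plane z *\<^sub>R exp (z * of_real \<bar>fst p - snd p\<bar>))) \<le> 1"
          unfolding q prod.case real_norm_def .
      qed
    qed measurable
  qed
  also have "\<dots> = (\<integral>z\<in>left_half_plane. time_kernel t z \<partial>\<nu>)"
    unfolding set_lebesgue_integral_def time_kernel_def
    by (intro Bochner_Integration.integral_cong refl) (simp add: indicator_def)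
  finally show ?thesis .
qed

end

section \<open>Equivalence of the asymptotics of the transform and of the mass near zero\<close>

lemma asymp_equiv_iff_ratio:
  fixes f g :: "real \<Rightarrow> real"
  assumes "\<forall>\<^sub>F x in F. 0 < g x"
  shows "f \<sim>[F] g \<longleftrightarrow> ((\<lambda>x. f x / g x) \<longlongrightarrow> 1) F"
proof -
  have "\<forall>\<^sub>F x in F. (if f x = 0 \<and> g x = 0 then 1 else f x / g x) = f x / g x"
    using assms by eventually_elim auto
  then show ?thesis unfolding asymp_equiv_def by (rule tendsto_cong)
qed

text \<open>
  Regular variation is inherited by asymptotically equivalent functions.
\<close>

lemma ratio_regular:
  fixes W p :: "real \<Rightarrow> real"
  assumes s: "0 < s" and Wp: "((\<lambda>T. W T / p T) \<longlongrightarrow> 1) at_top"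
    and p: "((\<lambda>T. p (s * T) / p T) \<longlongrightarrow> l) at_top" and pos: "\<And>T. 0 < T \<Longrightarrow> 0 < p T"
  shows "((\<lambda>T. W (s * T) / W T) \<longlongrightarrow> l) at_top"
proof -
  have "filterlim (\<lambda>T. s * T) at_top at_top"
    using s by (intro filterlim_tendsto_pos_mult_at_top[OF tendsto_const]) (auto simp: filterlim_ident)
  from filterlim_compose[OF Wp this]
  have "((\<lambda>T. W (s * T) / p (s * T) * (p (s * T) / p T) / (W T / p T)) \<longlongrightarrow> 1 * l / 1) at_top"
    by (intro tendsto_divide tendsto_mult p Wp) auto
  moreover have "\<forall>\<^sub>F T in at_top. W (s * T) / p (s * T) * (p (s * T) / p T) / (W T / p T) = W (s * T) / W T"
    using eventually_gt_at_top[of 0]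
  proof eventually_elim
    case (elim T)
    then have "0 < p (s * T)" "0 < p T" using s pos by auto
    then show ?case by simp
  qed
  ultimately have "((\<lambda>T. W (s * T) / W T) \<longlongrightarrow> 1 * l / 1) at_top"
    by (rule Lim_transform_eventually)
  then show ?thesis by simp
qed

text \<open>
  Either asymptotic relation makes its own side regularly varying; the Tauberian or Abelian
  theorem then compares \<open>W(T)\<close> with the mass of \<open>[-1/T, 1/T]\<close>, and the relation passes to the other side.
\<close>

lemma (in finite_borel_measure) fejer_transform_asymp_iff:
  assumes sym: "distr M borel uminus = M" and a: "1 \<le> \<alpha>" "\<alpha> < 2" and h: "slowly_varying h"
  shows "((\<lambda>T. fejer_transform M T / (T powr (\<alpha> - 2) * h T)) \<longlongrightarrow> 1) at_top
    \<longleftrightarrow> ((\<lambda>x. measure M {-x..x} / (C_const \<alpha> * x powr (2 - \<alpha>) * h (1 / x))) \<longlongrightarrow> 1) (at_right 0)"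
proof -
  define p where "p T = T powr (\<alpha> - 2) * h T" for T
  define G where "G T = measure M {-1/T..1/T}" for T
  let ?W = "fejer_transform M" and ?C = "C_const \<alpha>"
  have C: "0 < ?C" using a by (intro C_const_pos) auto
  have hpos: "0 < h T" if "0 < T" for T using h that by (simp add: slowly_varying_def)
  have pos: "0 < p T" if "0 < T" for T using hpos[OF that] that by (simp add: p_def)
  have preg: "((\<lambda>T. p (s * T) / p T) \<longlongrightarrow> s powr (\<alpha> - 2)) at_top" if s: "0 < s" for s
  proof -
    have "((\<lambda>T. s powr (\<alpha> - 2) * (h (s * T) / h T)) \<longlongrightarrow> s powr (\<alpha> - 2) * 1) at_top"
      using h s by (intro tendsto_mult tendsto_const) (simp add: slowly_varying_def)
    moreover have "\<forall>\<^sub>F T in at_top. s powr (\<alpha> - 2) * (h (s * T) / h T) = p (s * T) / p T"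
      using eventually_gt_at_top[of 0] by eventually_elim (use s in \<open>simp add: p_def powr_mult\<close>)
    ultimately show ?thesis by (simp add: tendsto_cong)
  qed
  have right: "((\<lambda>x. measure M {-x..x} / (?C * x powr (2 - \<alpha>) * h (1 / x))) \<longlongrightarrow> 1) (at_right 0)
      \<longleftrightarrow> ((\<lambda>T. G T / (?C * p T)) \<longlongrightarrow> 1) at_top"
  proof -
    have "\<forall>\<^sub>F T in at_top. measure M {-(1/T)..1/T} / (?C * (1/T) powr (2 - \<alpha>) * h (1 / (1 / T))) = G T / (?C * p T)"
      using eventually_gt_at_top[of 0]
    proof eventually_elim
      case (elim T)
      then have "(1/T) powr (2 - \<alpha>) = T powr (\<alpha> - 2)"
        by (simp add: powr_divide powr_minus_divide[symmetric] flip: powr_minus_divide)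
      then show ?case by (simp add: G_def p_def mult.assoc)
    qed
    then show ?thesis unfolding tendsto_at_right_0_inverse by (rule tendsto_cong)
  qed
  show ?thesis
    unfolding right p_def[symmetric]
  proof
    assume W: "((\<lambda>T. ?W T / p T) \<longlongrightarrow> 1) at_top"
    have "((\<lambda>T. G T / ?W T) \<longlongrightarrow> ?C) at_top"
      unfolding G_def using a
      by (intro tauberian_fejer sym ratio_regular[OF _ W preg pos]) auto
    then have "((\<lambda>T. G T / ?W T * (?W T / p T) / ?C) \<longlongrightarrow> ?C * 1 / ?C) at_top"
      using C by (intro tendsto_divide tendsto_mult W tendsto_const) auto
    moreover have "\<forall>\<^sub>F T in at_top. G T / ?W T * (?W T / p T) / ?C = G T / (?C * p T)"
      using order_tendstoD(1)[OF W zero_less_one] by eventually_elim auto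
    ultimately have "((\<lambda>T. G T / (?C * p T)) \<longlongrightarrow> ?C * 1 / ?C) at_top"
      by (rule Lim_transform_eventually)
    then show "((\<lambda>T. G T / (?C * p T)) \<longlongrightarrow> 1) at_top"
      using C by simp
  next
    assume G: "((\<lambda>T. G T / (?C * p T)) \<longlongrightarrow> 1) at_top"
    have "((\<lambda>T. ?C * p (s * T) / (?C * p T)) \<longlongrightarrow> s powr (\<alpha> - 2)) at_top" if "0 < s" for s
      using preg[OF that] C by simp
    from ratio_regular[OF _ G this]
    have Greg: "((\<lambda>T. G (s * T) / G T) \<longlongrightarrow> s powr (\<alpha> - 2)) at_top" if "0 < s" for s
      using that C pos by simp
    have "((\<lambda>x. measure M {- (s * x)..s * x} / measure M {-x..x}) \<longlongrightarrow> s powr (2 - \<alpha>)) (at_right 0)" if s: "0 < s" for s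
    proof -
      have "(1 / s) powr (\<alpha> - 2) = s powr (2 - \<alpha>)"
        using s by (simp add: powr_divide powr_minus_divide[symmetric] flip: powr_minus_divide)
      then have "((\<lambda>T. G (1 / s * T) / G T) \<longlongrightarrow> s powr (2 - \<alpha>)) at_top"
        using Greg[of "1 / s"] s by simp
      then show ?thesis unfolding tendsto_at_right_0_inverse G_def by simp
    qed
    then have "((\<lambda>T. ?W T / G T) \<longlongrightarrow> 1 / ?C) at_top"
      unfolding G_def using a by (intro abelian_fejer) auto
    then have "((\<lambda>T. ?W T / G T * (G T / (?C * p T)) * ?C) \<longlongrightarrow> 1 / ?C * 1 * ?C) at_top"
      by (intro tendsto_mult G tendsto_const)
    moreover have "\<forall>\<^sub>F T in at_top. ?W T / G T * (G T / (?C * p T)) * ?C = ?W T / p T"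
      using order_tendstoD(1)[OF G zero_less_one] by eventually_elim (use C in auto)
    ultimately have "((\<lambda>T. ?W T / p T) \<longlongrightarrow> 1 / ?C * 1 * ?C) at_top"
      by (rule Lim_transform_eventually)
    then show "((\<lambda>T. ?W T / p T) \<longlongrightarrow> 1) at_top"
      using C by simp
  qed
qed

section \<open>Projection of the spectral measure to the imaginary axis\<close>

text \<open>
  The union of all the sets \<open>U x\<close>.
\<close>

definition sector :: "complex set" where
  "sector = {z. 0 \<le> - Re z \<and> - Re z \<le> \<bar>Im z\<bar>}"

lemma sets_sector [measurable]: "sector \<in> sets borel"
  unfolding sector_def by (intro borel_closed closed_Collect_conj closed_Collect_le continuous_intros)

lemma U_eq_sector: "U x = sector \<inter> {z. \<bar>Im z\<bar> \<le> x}"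
  by (auto simp: U_def sector_def)

lemma sector_subset: "sector \<subseteq> left_half_plane"
  by (auto simp: sector_def left_half_plane_def)

text \<open>
  The image of \<open>\<nu>\<close> restricted to the sector under \<open>z \<mapsto> Im z\<close>, symmetrised by a fair coin that chooses the
  sign. Symmetry makes the characteristic functions of the tilted laws real, and does not affect the
  mass of symmetric intervals or the Fejer transform.
\<close>

definition vertical_projection :: "complex measure \<Rightarrow> real measure" where
  "vertical_projection \<nu> = distr (count_space (UNIV :: bool set) \<Otimes>\<^sub>M density \<nu> (\<lambda>z. ennreal (1 / 2) * indicator sector z))
     borel (\<lambda>(b, z). if b then Im z else - Im z)"

lemma nn_integral_vertical_projection:
  assumes \<nu>: "finite_measure \<nu>" and sets [measurable_cong]: "sets \<nu> = sets borel"
    and f [measurable]: "f \<in> borel_measurable borel"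
  shows "(\<integral>\<^sup>+y. f y \<partial>vertical_projection \<nu>) = (\<integral>\<^sup>+z. ennreal (1 / 2) * (f (Im z) + f (- Im z)) * indicator sector z \<partial>\<nu>)"
proof -
  interpret finite_measure \<nu> by fact
  let ?D = "density \<nu> (\<lambda>z. ennreal (1 / 2) * indicator sector z)"
  have "emeasure ?D (space ?D) \<le> emeasure \<nu> (space \<nu>)"
  proof -
    have half: "ennreal (1 / 2) \<le> 1" using ennreal_leI[of "1 / 2" 1] by simp
    have "emeasure ?D (space ?D) = (\<integral>\<^sup>+z. ennreal (1 / 2) * indicator sector z * indicator (space ?D) z \<partial>\<nu>)"
      by (rule emeasure_density) auto
    also have "\<dots> \<le> (\<integral>\<^sup>+z. 1 * 1 * 1 \<partial>\<nu>)"
      by (intro nn_integral_mono mult_mono half) (auto simp: indicator_def)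
    finally have "emeasure ?D (space ?D) \<le> (\<integral>\<^sup>+z. 1 * 1 * 1 \<partial>\<nu>)" .
    then show ?thesis by simp
  qed
  then interpret D: finite_measure ?D
    by (intro finite_measureI) (auto simp: top_unique emeasure_eq_measure)
  have sel: "(\<lambda>(b, z). if b then Im z else - Im z) \<in> borel_measurable (count_space (UNIV :: bool set) \<Otimes>\<^sub>M ?D)"
    by measurable
  have "(\<integral>\<^sup>+y. f y \<partial>vertical_projection \<nu>)
     = (\<integral>\<^sup>+q. f (case q of (b, z) \<Rightarrow> if b then Im z else - Im z) \<partial>(count_space UNIV \<Otimes>\<^sub>M ?D))"
    unfolding vertical_projection_def using sel by (subst nn_integral_distr) auto
  also have "\<dots> = (\<integral>\<^sup>+b. (\<integral>\<^sup>+z. f (if b then Im z else - Im z) \<partial>?D) \<partial>count_space UNIV)"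
    using measurable_compose[OF sel f] by (subst D.nn_integral_fst[symmetric]) auto
  also have "\<dots> = (\<integral>\<^sup>+z. f (Im z) \<partial>?D) + (\<integral>\<^sup>+z. f (- Im z) \<partial>?D)"
    by (simp add: nn_integral_count_space_finite UNIV_bool add.commute)
  also have "\<dots> = (\<integral>\<^sup>+z. f (Im z) + f (- Im z) \<partial>?D)"
    by (subst nn_integral_add) auto
  also have "\<dots> = (\<integral>\<^sup>+z. ennreal (1 / 2) * (f (Im z) + f (- Im z)) * indicator sector z \<partial>\<nu>)"
    by (subst nn_integral_density) (auto simp: mult_ac)
  finally show ?thesis .
qed

lemma half_double_ennreal: "ennreal (1 / 2) * (x + x) = x"
proof -
  have "ennreal (1 / 2) * (x + x) = ennreal (1 / 2) * ennreal 2 * x"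
    by (simp add: mult_2[symmetric] mult.assoc)
  also have "ennreal (1 / 2) * ennreal 2 = 1"
    by (subst ennreal_mult'[symmetric]) auto
  finally show ?thesis by simp
qed

section \<open>Decomposition of the time kernel\<close>

text \<open>
  What remains of the time kernel, divided by \<open>T\<close>, once the contribution to \<open>\<varsigma>\<^sup>2\<close> and the Fejer kernel at the
  projection of \<open>z\<close> to the imaginary axis are removed. At \<open>z = 0\<close> the kernel is exactly the Fejer term.
\<close>

definition kernel_remainder :: "real \<Rightarrow> complex \<Rightarrow> real" where
  "kernel_remainder T z = (if z = 0 then 0 else 2 * Re ((exp (z * of_real T) - 1) / z\<^sup>2) / T - indicator sector z * (T * fejer (Im z * T)))"

lemma time_kernel_decomposition:
  assumes z: "Re z \<le> 0" and T: "0 < T"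
  shows "time_kernel T z / T = kernel_remainder T z - 2 * Re (1 / z) + indicator sector z * (T * fejer (Im z * T))"
proof (cases "z = 0")
  case True
  then show ?thesis
    using time_kernel_eq[of 0 T] T by (simp add: kernel_remainder_def sector_def fejer_def power2_eq_square)
next
  case False
  then show ?thesis
    using time_kernel_eq[OF z, of T] T by (simp add: kernel_remainder_def diff_divide_distrib)
qed

lemma cmod_exp_minus_1_le:
  assumes z: "Re z \<le> 0" and T: "0 \<le> T"
  shows "cmod (exp (z * of_real T) - 1) \<le> 2" "cmod (exp (z * of_real T) - 1) \<le> cmod z * T"
proof -
  have zT: "Re (z * of_real T) \<le> 0" using assms by (simp add: mult_nonpos_nonneg)
  then have "cmod (exp (z * of_real T)) \<le> 1" by simp
  then show "cmod (exp (z * of_real T) - 1) \<le> 2"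
    using norm_triangle_ineq4[of "exp (z * of_real T)" 1] unfolding norm_one by linarith
  have "cmod (exp (z * of_real T) - exp 0) \<le> cmod (z * of_real T - 0)"
    using zT by (intro cmod_exp_diff_le) auto
  then show "cmod (exp (z * of_real T) - 1) \<le> cmod z * T"
    using T by (simp add: norm_mult)
qed

lemma neg_Re_inverse: "- Re (1 / z) = - Re z / (cmod z)\<^sup>2"
  by (simp add: Re_divide cmod_power2)

lemma fejer_as_exp:
  assumes "b \<noteq> 0" "0 < T"
  shows "T * fejer (b * T) = 2 * Re ((exp (\<i> * of_real b * of_real T) - 1) / (\<i> * of_real b)\<^sup>2) / T"
proof -
  have "exp (\<i> * of_real b * of_real T) = cis (b * T)"
    by (simp add: cis_conv_exp mult.assoc)
  moreover have "(\<i> * complex_of_real b)\<^sup>2 = - of_real (b\<^sup>2)"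
    by (simp add: power_mult_distrib)
  ultimately have "Re ((exp (\<i> * of_real b * of_real T) - 1) / (\<i> * of_real b)\<^sup>2) = (1 - cos (b * T)) / b\<^sup>2"
    by (simp add: field_simps flip: of_real_power) (simp add: diff_divide_distrib)
  then show ?thesis
    using assms by (simp add: fejer_def field_simps power2_eq_square)
qed

lemma kernel_remainder_sector:
  assumes z: "z \<in> sector" "z \<noteq> 0" and T: "0 < T"
  shows "Im z \<noteq> 0"
    and "kernel_remainder T z = 2 * Re ((exp (z * of_real T) - 1) / z\<^sup>2 - (exp (\<i> * of_real (Im z) * of_real T) - 1) / (\<i> * of_real (Im z))\<^sup>2) / T"
proof -
  show nz: "Im z \<noteq> 0"
    using z by (auto simp: sector_def complex_eq_iff)
  show "kernel_remainder T z = 2 * Re ((exp (z * of_real T) - 1) / z\<^sup>2 - (exp (\<i> * of_real (Im z) * of_real T) - 1) / (\<i> * of_real (Im z))\<^sup>2) / T"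
    unfolding kernel_remainder_def fejer_as_exp[OF nz T] using z
    by (simp only: if_False indicator_simps mult_1 minus_complex.sel right_diff_distrib diff_divide_distrib)
qed

text \<open>
  The integrand of \<open>\<varsigma>\<^sup>2\<close> dominates the remainder for all \<open>T\<close> at once. Outside the sector \<open>|z|\<close> is at most
  \<open>- 2 Re z\<close>, and \<open>|exp (z T) - 1| \<le> |z| T\<close> suffices. Inside, the function \<open>(exp (w T) - 1) / w\<^sup>2\<close> has
  derivative at most \<open>3 T / (Im w)\<^sup>2\<close>, so moving \<open>z\<close> horizontally by \<open>- Re z\<close> to the imaginary axis
  costs at most \<open>3 T (- Re z) / (Im z)\<^sup>2\<close>.
\<close>

lemma kernel_remainder_bound:
  assumes z: "Re z \<le> 0" and T: "0 < T"
  shows "\<bar>kernel_remainder T z\<bar> \<le> 12 * (- Re (1 / z))"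
proof (cases "z = 0")
  case True
  then show ?thesis by (simp add: kernel_remainder_def)
next
  case False
  then have m: "0 < cmod z" by simp
  show ?thesis
  proof (cases "z \<in> sector")
    case False
    have "cmod z \<le> \<bar>Re z\<bar> + \<bar>Im z\<bar>" by (rule cmod_le)
    \<comment> \<open>outside the sector \<open>|z|\<close> is comparable to \<open>- Re z\<close>\<close>
    then have le: "cmod z \<le> 2 * (- Re z)" using False z by (auto simp: sector_def)
    have "\<bar>kernel_remainder T z\<bar> = 2 * \<bar>Re ((exp (z * of_real T) - 1) / z\<^sup>2)\<bar> / T"
      using False \<open>z \<noteq> 0\<close> T by (simp add: kernel_remainder_def abs_mult)
    also have "\<dots> \<le> 2 * cmod ((exp (z * of_real T) - 1) / z\<^sup>2) / T"
      using T by (intro divide_right_mono mult_left_mono abs_Re_le_cmod) auto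
    also have "\<dots> \<le> 2 * (cmod z * T / (cmod z)\<^sup>2) / T"
      unfolding norm_divide norm_power using T cmod_exp_minus_1_le(2)[OF z, of T]
      by (intro divide_right_mono mult_left_mono) auto
    also have "\<dots> = 2 * cmod z / (cmod z)\<^sup>2" using T by simp
    also have "\<dots> \<le> 12 * (- Re z) / (cmod z)\<^sup>2"
      using le z by (intro divide_right_mono) auto
    finally show ?thesis unfolding neg_Re_inverse by simp
  next
    case True
    define b where "b = Im z"
    note rem = kernel_remainder_sector[OF True \<open>z \<noteq> 0\<close> T, folded b_def]
    let ?f = "\<lambda>w. (exp (w * of_real T) - 1) / w\<^sup>2"
    let ?f' = "\<lambda>w. of_real T * exp (w * of_real T) / w\<^sup>2 - 2 * (exp (w * of_real T) - 1) / w ^ 3"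
    let ?S = "{w. Im w = b \<and> Re w \<le> 0}"
    have b: "b \<noteq> 0" by (rule rem(1))
    \<comment> \<open>mean value inequality along the horizontal segment from \<open>z\<close> to the imaginary axis\<close>
    have "cmod (?f z - ?f (\<i> * of_real b)) \<le> 3 * T / b\<^sup>2 * cmod (z - \<i> * of_real b)"
    proof (rule field_differentiable_bound[where S="?S" and f'="?f'"])
      have "?S = {w. Im w \<le> b} \<inter> {w. Im w \<ge> b} \<inter> {w. Re w \<le> 0}" by auto
      then show "convex ?S"
        by (simp only: convex_Int convex_halfspace_Re_le convex_halfspace_Im_le convex_halfspace_Im_ge)
      fix w assume "w \<in> ?S"
      then have w: "Im w = b" "Re w \<le> 0" by auto
      then have nz: "w \<noteq> 0" using b by auto
      show "(?f has_field_derivative ?f' w) (at w within ?S)"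
        using nz by (auto intro!: derivative_eq_intros simp: field_simps eval_nat_numeral)
      have bw: "\<bar>b\<bar> \<le> cmod w" using abs_Im_le_cmod[of w] w by simp
      have "cmod (exp (w * of_real T)) \<le> 1"
        using w T by (simp add: mult_nonpos_nonneg)
      then have 1: "cmod (of_real T * exp (w * of_real T) / w\<^sup>2) \<le> T / (cmod w)\<^sup>2"
        using T by (simp add: norm_mult norm_divide norm_power divide_right_mono)
      have "cmod (2 * (exp (w * of_real T) - 1) / w ^ 3) \<le> 2 * (cmod w * T) / (cmod w) ^ 3"
        unfolding norm_divide norm_mult norm_power using cmod_exp_minus_1_le(2)[OF w(2), of T] T
        by (intro divide_right_mono mult_mono) auto
      also have "\<dots> = 2 * T / (cmod w)\<^sup>2" using nz by (simp add: field_simps eval_nat_numeral)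
      finally have "cmod (?f' w) \<le> T / (cmod w)\<^sup>2 + 2 * T / (cmod w)\<^sup>2"
        using 1 by (intro order_trans[OF norm_triangle_ineq4] add_mono)
      also have "\<dots> = 3 * T / (cmod w)\<^sup>2" by (simp add: add_divide_distrib[symmetric])
      also have "\<dots> \<le> 3 * T / b\<^sup>2"
        using bw b T by (intro divide_left_mono) (auto simp: power2_le_iff_abs_le mult_pos_pos nz abs_le_square_iff[symmetric])
      finally show "cmod (?f' w) \<le> 3 * T / b\<^sup>2" .
    qed (use z in \<open>auto simp: b_def\<close>)
    moreover have "cmod (z - \<i> * of_real b) = - Re z"
    proof -
      have "z - \<i> * of_real b = of_real (Re z)" by (simp add: complex_eq_iff b_def)
      then show ?thesis using z by simp
    qed
    ultimately have d: "cmod (?f z - ?f (\<i> * of_real b)) \<le> 3 * T / b\<^sup>2 * (- Re z)" by simp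
    have "\<bar>kernel_remainder T z\<bar> = 2 * \<bar>Re (?f z - ?f (\<i> * of_real b))\<bar> / T"
      unfolding rem(2) using T by (simp only: abs_mult abs_divide abs_of_pos abs_numeral)
    also have "\<dots> \<le> 2 * (3 * T / b\<^sup>2 * (- Re z)) / T"
      using T order_trans[OF abs_Re_le_cmod d] by (intro divide_right_mono mult_left_mono) auto
    also have "\<dots> = 6 * (- Re z) / b\<^sup>2" using T by simp
    also have "\<dots> \<le> 12 * (- Re z) / (cmod z)\<^sup>2"
    proof -
      have "\<bar>Re z\<bar> \<le> \<bar>b\<bar>" using True z by (auto simp: sector_def b_def)
      then have "(Re z)\<^sup>2 \<le> b\<^sup>2" by (simp add: abs_le_square_iff)
      then have "(cmod z)\<^sup>2 \<le> 2 * b\<^sup>2" by (simp add: cmod_power2 b_def)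
      then have "6 * (- Re z) * (cmod z)\<^sup>2 \<le> 6 * (- Re z) * (2 * b\<^sup>2)"
        using z by (intro mult_left_mono) auto
      then show ?thesis using b m by (simp add: field_simps)
    qed
    finally show ?thesis unfolding neg_Re_inverse by simp
  qed
qed

lemma kernel_remainder_tendsto:
  assumes z: "Re z \<le> 0"
  shows "((\<lambda>T. kernel_remainder T z) \<longlongrightarrow> 0) at_top"
proof -
  consider "z = 0" | "z \<noteq> 0" "z \<notin> sector" | "z \<noteq> 0" "z \<in> sector" by blast
  then show ?thesis
  proof cases
    case 1
    then show ?thesis by (simp add: kernel_remainder_def)
  next
    case 2
    show ?thesis
    proof (rule Lim_null_comparison[where g="\<lambda>T. 2 * (2 / (cmod z)\<^sup>2) / T"])
      show "((\<lambda>T. 2 * (2 / (cmod z)\<^sup>2) / T) \<longlongrightarrow> 0) at_top"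
        by (intro tendsto_divide_0[OF tendsto_const] filterlim_at_top_imp_at_infinity filterlim_ident)
      show "\<forall>\<^sub>F T in at_top. norm (kernel_remainder T z) \<le> 2 * (2 / (cmod z)\<^sup>2) / T"
        using eventually_gt_at_top[of 0]
      proof eventually_elim
        case (elim T)
        have "norm (kernel_remainder T z) = 2 * \<bar>Re ((exp (z * of_real T) - 1) / z\<^sup>2)\<bar> / T"
          using 2 elim by (simp add: kernel_remainder_def abs_mult)
        also have "\<dots> \<le> 2 * cmod ((exp (z * of_real T) - 1) / z\<^sup>2) / T"
          using elim by (intro divide_right_mono mult_left_mono abs_Re_le_cmod) auto
        also have "\<dots> \<le> 2 * (2 / (cmod z)\<^sup>2) / T"
          unfolding norm_divide norm_power using elim cmod_exp_minus_1_le(1)[OF z, of T]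
          by (intro divide_right_mono mult_left_mono) auto
        finally show ?case .
      qed
    qed
  next
    case 3
    define b where "b = Im z"
    have b: "b \<noteq> 0" using kernel_remainder_sector(1)[OF 3(2,1), of 1] by (simp add: b_def)
    show ?thesis
    proof (rule Lim_null_comparison[where g="\<lambda>T. 2 * (2 / (cmod z)\<^sup>2 + 2 / b\<^sup>2) / T"])
      show "((\<lambda>T. 2 * (2 / (cmod z)\<^sup>2 + 2 / b\<^sup>2) / T) \<longlongrightarrow> 0) at_top"
        by (intro tendsto_divide_0[OF tendsto_const] filterlim_at_top_imp_at_infinity filterlim_ident)
      show "\<forall>\<^sub>F T in at_top. norm (kernel_remainder T z) \<le> 2 * (2 / (cmod z)\<^sup>2 + 2 / b\<^sup>2) / T"
        using eventually_gt_at_top[of 0]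
      proof eventually_elim
        case (elim T)
        let ?d = "(exp (z * of_real T) - 1) / z\<^sup>2 - (exp (\<i> * of_real b * of_real T) - 1) / (\<i> * of_real b)\<^sup>2"
        have "cmod ((exp (z * of_real T) - 1) / z\<^sup>2) \<le> 2 / (cmod z)\<^sup>2"
          unfolding norm_divide norm_power using elim cmod_exp_minus_1_le(1)[OF z, of T]
          by (intro divide_right_mono) auto
        moreover have "cmod ((exp (\<i> * of_real b * of_real T) - 1) / (\<i> * of_real b)\<^sup>2) \<le> 2 / b\<^sup>2"
          using elim cmod_exp_minus_1_le(1)[of "\<i> * of_real b" T]
          by (simp add: norm_divide norm_power norm_mult divide_right_mono)
        ultimately have d: "cmod ?d \<le> 2 / (cmod z)\<^sup>2 + 2 / b\<^sup>2"
          by (intro order_trans[OF norm_triangle_ineq4] add_mono)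
        have "norm (kernel_remainder T z) = 2 * \<bar>Re ?d\<bar> / T"
          unfolding kernel_remainder_sector(2)[OF 3(2,1) elim, folded b_def] using elim
          by (simp only: real_norm_def abs_mult abs_divide abs_of_pos abs_numeral)
        also have "\<dots> \<le> 2 * (2 / (cmod z)\<^sup>2 + 2 / b\<^sup>2) / T"
          using elim order_trans[OF abs_Re_le_cmod d] by (intro divide_right_mono mult_left_mono) auto
        finally show ?case .
      qed
    qed
  qed
qed

lemma borel_measurable_kernel_remainder [measurable]: "kernel_remainder T \<in> borel_measurable borel"
  unfolding kernel_remainder_def by measurable

context
  fixes \<nu> :: "complex measure"
  assumes \<nu>: "finite_measure \<nu>" and sets_\<nu> [measurable_cong]: "sets \<nu> = sets borel"
begin

lemma emeasure_vertical_projection: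
  assumes A: "A \<in> sets borel"
  shows "emeasure (vertical_projection \<nu>) A = (\<integral>\<^sup>+z. ennreal (1 / 2) * (indicator A (Im z) + indicator A (- Im z)) * indicator sector z \<partial>\<nu>)"
  using nn_integral_vertical_projection[OF \<nu> sets_\<nu>, of "indicator A"] A
  by (simp add: vertical_projection_def)

lemma finite_borel_vertical_projection: "finite_borel_measure (vertical_projection \<nu>)"
proof (intro finite_borel_measure.intro finite_borel_measure_axioms.intro finite_measureI)
  interpret finite_measure \<nu> by (rule \<nu>)
  have "emeasure (vertical_projection \<nu>) UNIV \<le> (\<integral>\<^sup>+z. 1 \<partial>\<nu>)"
    unfolding emeasure_vertical_projection[OF sets.top[of borel, unfolded space_borel]]
    by (intro nn_integral_mono) (simp only: indicator_UNIV half_double_ennreal mult_1, simp add: indicator_def)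
  then show "emeasure (vertical_projection \<nu>) (space (vertical_projection \<nu>)) \<noteq> \<infinity>"
    by (auto simp: vertical_projection_def top_unique emeasure_eq_measure)
qed (simp add: vertical_projection_def)

lemma vertical_projection_symmetric: "distr (vertical_projection \<nu>) borel uminus = vertical_projection \<nu>"
proof (rule measure_eqI)
  fix A assume "A \<in> sets (distr (vertical_projection \<nu>) borel uminus)"
  then have A: "A \<in> sets borel" by simp
  have sp: "space (vertical_projection \<nu>) = UNIV" "sets (vertical_projection \<nu>) = sets borel"
    by (simp_all add: vertical_projection_def)
  have m: "(uminus :: real \<Rightarrow> real) \<in> borel_measurable (vertical_projection \<nu>)"
    by (simp add: measurable_cong_sets[OF sp(2) refl])
  have A': "uminus -` A \<in> sets borel"
    using measurable_sets[OF m, of A] A sp by simp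
  have "emeasure (distr (vertical_projection \<nu>) borel uminus) A = emeasure (vertical_projection \<nu>) (uminus -` A)"
    using A m sp by (subst emeasure_distr) auto
  then show "emeasure (distr (vertical_projection \<nu>) borel uminus) A = emeasure (vertical_projection \<nu>) A"
    unfolding emeasure_vertical_projection[OF A] emeasure_vertical_projection[OF A']
    by (simp add: indicator_def add.commute vimage_def)
qed (simp add: vertical_projection_def)

lemma measure_vertical_projection: "measure (vertical_projection \<nu>) {-x..x} = measure \<nu> (U x)"
proof -
  have "emeasure (vertical_projection \<nu>) {-x..x} = (\<integral>\<^sup>+z. indicator (U x) z \<partial>\<nu>)"
    unfolding emeasure_vertical_projection[OF atLeastAtMost_borel]
  proof (intro nn_integral_cong)
    fix z
    have i: "indicator {-x..x} (Im z) = (indicator {z. \<bar>Im z\<bar> \<le> x} z :: ennreal)" "indicator {-x..x} (- Im z) = (indicator {z. \<bar>Im z\<bar> \<le> x} z :: ennreal)"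
      by (auto simp: indicator_def abs_le_iff)
    show "ennreal (1 / 2) * (indicator {-x..x} (Im z) + indicator {-x..x} (- Im z)) * indicator sector z = indicator (U x) z"
      unfolding i half_double_ennreal U_eq_sector by (simp add: indicator_inter_arith mult.commute)
  qed
  also have "\<dots> = emeasure \<nu> (U x)"
  proof -
    have "U x \<in> sets borel"
      unfolding U_def by (intro borel_closed closed_Collect_conj closed_Collect_le continuous_intros)
    then show ?thesis by (simp add: sets_\<nu>)
  qed
  finally show ?thesis by (simp add: measure_def)
qed

lemma fejer_transform_vertical_projection:
  "fejer_transform (vertical_projection \<nu>) T = (\<integral>z. indicator sector z * fejer (Im z * T) \<partial>\<nu>)"
proof -
  have sp: "sets (vertical_projection \<nu>) = sets borel"
    by (simp add: vertical_projection_def)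
  have "fejer_transform (vertical_projection \<nu>) T = enn2real (\<integral>\<^sup>+b. ennreal (fejer (b * T)) \<partial>vertical_projection \<nu>)"
    unfolding fejer_transform_def
    by (rule integral_eq_nn_integral) (auto simp: measurable_cong_sets[OF sp refl])
  also have "(\<integral>\<^sup>+b. ennreal (fejer (b * T)) \<partial>vertical_projection \<nu>)
     = (\<integral>\<^sup>+z. ennreal (1 / 2) * (ennreal (fejer (Im z * T)) + ennreal (fejer (- Im z * T))) * indicator sector z \<partial>\<nu>)"
    by (rule nn_integral_vertical_projection[OF \<nu> sets_\<nu>]) measurable
  also have "\<dots> = (\<integral>\<^sup>+z. ennreal (indicator sector z * fejer (Im z * T)) \<partial>\<nu>)"
  proof (intro nn_integral_cong)
    fix z
    have "fejer (- Im z * T) = fejer (Im z * T)" by (simp only: mult_minus_left fejer_minus)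
    then show "ennreal (1 / 2) * (ennreal (fejer (Im z * T)) + ennreal (fejer (- Im z * T))) * indicator sector z
      = ennreal (indicator sector z * fejer (Im z * T))"
      by (simp only: half_double_ennreal) (simp add: indicator_def)
  qed
  also have "enn2real \<dots> = (\<integral>z. indicator sector z * fejer (Im z * T) \<partial>\<nu>)"
    by (rule integral_eq_nn_integral[symmetric]) (auto simp: indicator_def)
  finally show ?thesis .
qed

text \<open>
  Dominated convergence applied to the remainder: the variance splits into the constant \<open>\<varsigma>\<^sup>2\<close>, the Fejer
  transform of the vertical projection, and an error that tends to \<open>0\<close>.
\<close>

lemma variance_asymptotics:
  assumes fin: "sigma_sq \<nu> < \<infinity>"
  shows "((\<lambda>T. (\<integral>z\<in>left_half_plane. time_kernel T z \<partial>\<nu>) / T - enn2real (sigma_sq \<nu>)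
      - T * fejer_transform (vertical_projection \<nu>) T) \<longlongrightarrow> 0) at_top"
proof -
  interpret finite_measure \<nu> by (rule \<nu>)
  define S where "S z = indicator left_half_plane z * (- Re (1 / z))" for z :: complex
  define R where "R T z = indicator left_half_plane z * kernel_remainder T z" for T and z :: complex
  have [measurable]: "S \<in> borel_measurable borel" unfolding S_def neg_Re_inverse by measurable
  have [measurable]: "R T \<in> borel_measurable borel" for T unfolding R_def by measurable
  have S0: "0 \<le> S z" for z
    unfolding S_def neg_Re_inverse by (auto simp: indicator_def left_half_plane_def divide_nonpos_nonneg)
  have nn: "sigma_sq \<nu> = 2 * (\<integral>\<^sup>+z. ennreal (S z) \<partial>\<nu>)"
    unfolding sigma_sq_def by (intro arg_cong[where f="\<lambda>x. 2 * x"] nn_integral_cong) (auto simp: S_def indicator_def)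
  have S_int: "integrable \<nu> S"
  proof (rule integrableI_nonneg)
    show "(\<integral>\<^sup>+z. ennreal (S z) \<partial>\<nu>) < \<infinity>"
      using fin unfolding nn by (auto simp: ennreal_mult_less_top)
  qed (use S0 in auto)
  have sig: "enn2real (sigma_sq \<nu>) = 2 * (\<integral>z. S z \<partial>\<nu>)"
    unfolding nn nn_integral_eq_integral[OF S_int AE_I2[OF S0]] numeral_mult_ennreal
    using S0 by (intro enn2real_ennreal) (simp add: integral_nonneg_AE)
  have R_bound: "norm (R T z) \<le> 12 * S z" if "0 < T" for T z
    using kernel_remainder_bound[of z T] that by (auto simp: R_def S_def indicator_def left_half_plane_def)
  have R_int: "integrable \<nu> (R T)" if "0 < T" for T
    by (rule Bochner_Integration.integrable_bound[of \<nu> "\<lambda>z. 12 * S z"])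
       (use S_int R_bound[OF that] S0 in \<open>auto intro!: AE_I2\<close>)
  have f_int: "integrable \<nu> (\<lambda>z. indicator sector z * fejer (Im z * T))" for T
    using fejer_le_1 by (intro integrable_const_bound[where B=1]) (auto simp: indicator_def)
  have eq: "(\<integral>z\<in>left_half_plane. time_kernel T z \<partial>\<nu>) / T - enn2real (sigma_sq \<nu>)
      - T * fejer_transform (vertical_projection \<nu>) T = (\<integral>z. R T z \<partial>\<nu>)" if T: "0 < T" for T
  proof -
    have "(\<integral>z\<in>left_half_plane. time_kernel T z \<partial>\<nu>) / T = (\<integral>z. indicator left_half_plane z * time_kernel T z / T \<partial>\<nu>)"
      by (simp add: set_lebesgue_integral_def)
    also have "\<dots> = (\<integral>z. R T z + 2 * S z + T * (indicator sector z * fejer (Im z * T)) \<partial>\<nu>)"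
    proof (intro Bochner_Integration.integral_cong refl)
      fix z
      show "indicator left_half_plane z * time_kernel T z / T = R T z + 2 * S z + T * (indicator sector z * fejer (Im z * T))"
      proof (cases "z \<in> left_half_plane")
        case True
        then have "time_kernel T z / T = kernel_remainder T z - 2 * Re (1 / z) + indicator sector z * (T * fejer (Im z * T))"
          using T by (intro time_kernel_decomposition) (auto simp: left_half_plane_def)
        then show ?thesis using True by (simp add: R_def S_def)
      next
        case False
        then have "z \<notin> sector" using sector_subset by auto
        then show ?thesis using False by (simp add: R_def S_def)
      qed
    qed
    also have "\<dots> = (\<integral>z. R T z \<partial>\<nu>) + 2 * (\<integral>z. S z \<partial>\<nu>) + T * (\<integral>z. indicator sector z * fejer (Im z * T) \<partial>\<nu>)"
      using R_int[OF T] S_int f_int by simp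
    finally show ?thesis
      unfolding sig fejer_transform_vertical_projection by simp
  qed
  have "((\<lambda>T. \<integral>z. R T z \<partial>\<nu>) \<longlongrightarrow> (\<integral>z. 0 \<partial>\<nu>)) at_top"
  proof (rule integral_dominated_convergence_at_top[where w="\<lambda>z. 12 * S z"])
    show "\<forall>\<^sub>F T in at_top. AE z in \<nu>. norm (R T z) \<le> 12 * S z"
      using eventually_gt_at_top[of 0] by eventually_elim (use R_bound in auto)
    show "AE z in \<nu>. ((\<lambda>T. R T z) \<longlongrightarrow> 0) at_top"
    proof (intro AE_I2)
      fix z
      show "((\<lambda>T. R T z) \<longlongrightarrow> 0) at_top"
        using kernel_remainder_tendsto[of z] by (cases "z \<in> left_half_plane") (auto simp: R_def left_half_plane_def)
    qed
  qed (use S_int in auto)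
  moreover have "\<forall>\<^sub>F T in at_top. (\<integral>z. R T z \<partial>\<nu>) = (\<integral>z\<in>left_half_plane. time_kernel T z \<partial>\<nu>) / T - enn2real (sigma_sq \<nu>)
      - T * fejer_transform (vertical_projection \<nu>) T"
    using eventually_gt_at_top[of 0] by eventually_elim (simp add: eq)
  ultimately show ?thesis by (simp add: tendsto_cong)
qed

lemma spectral_mass_asymp_iff:
  assumes "1 \<le> \<alpha>" "\<alpha> < 2" "slowly_varying h"
  shows "((\<lambda>T. fejer_transform (vertical_projection \<nu>) T / (T powr (\<alpha> - 2) * h T)) \<longlongrightarrow> 1) at_top
    \<longleftrightarrow> ((\<lambda>x. measure \<nu> (U x) / (C_const \<alpha> * x powr (2 - \<alpha>) * h (1 / x))) \<longlongrightarrow> 1) (at_right 0)"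
  using finite_borel_measure.fejer_transform_asymp_iff[OF finite_borel_vertical_projection vertical_projection_symmetric assms]
  by (simp only: measure_vertical_projection)

end

section \<open>Linear and superlinear growth of the variance\<close>

theorem theorem15:
  fixes M :: "'w measure" and F :: "real \<Rightarrow> 'w measure"
    and \<pi> :: "'s measure" and \<xi> :: "real \<Rightarrow> 'w \<Rightarrow> 's"
    and g :: "'s \<Rightarrow> real" and \<nu> :: "complex measure"
  assumes "stationary_markov_process M F \<pi> \<xi>"
    and "strongly_continuous \<pi> (transition_op M \<pi> \<xi>)"
    and "normal_operator \<pi> (generator \<pi> (transition_op M \<pi> \<xi>))"
    and "g \<in> L2_0 \<pi>"
    and "is_spectral_measure \<pi> (generator \<pi> (transition_op M \<pi> \<xi>)) g \<nu>"
  shows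
    "(\<forall>K>0.
        (sigma_sq \<nu> < \<infinity> \<and>
         ((\<lambda>T. var_S M \<xi> g T / T) \<longlongrightarrow> enn2real (sigma_sq \<nu>) + K) at_top)
        \<longleftrightarrow>
        (sigma_sq \<nu> < \<infinity> \<and>
         ((\<lambda>x. measure \<nu> (U x) / x) \<longlongrightarrow> K / pi) (at_right 0)))
     \<and>
     (sigma_sq \<nu> < \<infinity> \<and> Liminf at_top (\<lambda>T. ereal (var_S M \<xi> g T / T)) = \<infinity> \<longrightarrow>
      (\<forall>(\<alpha>::real) h. 1 \<le> \<alpha> \<and> \<alpha> < 2 \<and> slowly_varying h \<longrightarrow>
         (var_S M \<xi> g \<sim>[at_top] (\<lambda>T. T powr \<alpha> * h T))
         \<longleftrightarrow>
         ((\<lambda>x. measure \<nu> (U x)) \<sim>[at_right 0] (\<lambda>x. C_const \<alpha> * x powr (2 - \<alpha>) * h (1 / x)))))"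
proof -
  interpret stationary_markov_process M F \<pi> \<xi> by fact
  obtain E where E: "spectral_resolution \<pi> (generator \<pi> T) E"
    and \<nu>: "\<nu> = pvm_measure \<pi> E (\<lambda>x. complex_of_real (g x))"
    using assms(5) by (auto simp: is_spectral_measure_def)
  interpret E: pvm \<pi> E using E by (simp add: pvm_def spectral_resolution_def)
  have fin: "finite_measure \<nu>" and sets: "sets \<nu> = sets borel"
    unfolding \<nu> using L2_0_real(4)[OF assms(4)] by (auto intro: E.finite_measure_pvm)
  let ?V = "var_S M \<xi> g"
  let ?W = "fejer_transform (vertical_projection \<nu>)"
  let ?s = "enn2real (sigma_sq \<nu>)"
  have decomp: "((\<lambda>T. ?V T / T - ?s - T * ?W T) \<longlongrightarrow> 0) at_top" if "sigma_sq \<nu> < \<infinity>"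
  proof -
    have "\<forall>\<^sub>F T in at_top. (\<integral>z\<in>left_half_plane. time_kernel T z \<partial>\<nu>) / T - ?s - T * ?W T = ?V T / T - ?s - T * ?W T"
      using eventually_ge_at_top[of 0]
      by eventually_elim (simp add: var_S_spectral[OF assms(2) E assms(4)] \<nu>)
    with variance_asymptotics[OF fin sets that] show ?thesis
      by (rule Lim_transform_eventually)
  qed
  note iff = spectral_mass_asymp_iff[OF fin sets]
  have part1: "((\<lambda>T. ?V T / T) \<longlongrightarrow> ?s + K) at_top \<longleftrightarrow> ((\<lambda>x. measure \<nu> (U x) / x) \<longlongrightarrow> K / pi) (at_right 0)"
    if ss: "sigma_sq \<nu> < \<infinity>" and K: "0 < K" for K
  proof -
    have "((\<lambda>T. ?V T / T) \<longlongrightarrow> ?s + K) at_top \<longleftrightarrow> ((\<lambda>T. T * ?W T) \<longlongrightarrow> K) at_top"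
    proof
      assume "((\<lambda>T. ?V T / T) \<longlongrightarrow> ?s + K) at_top"
      from tendsto_diff[OF tendsto_diff[OF this tendsto_const[of ?s]] decomp[OF ss]]
      show "((\<lambda>T. T * ?W T) \<longlongrightarrow> K) at_top" by simp
    next
      assume "((\<lambda>T. T * ?W T) \<longlongrightarrow> K) at_top"
      from tendsto_add[OF tendsto_add[OF this tendsto_const[of ?s]] decomp[OF ss]]
      show "((\<lambda>T. ?V T / T) \<longlongrightarrow> ?s + K) at_top" by (simp add: add.commute)
    qed
    also have "\<dots> \<longleftrightarrow> ((\<lambda>T. T * ?W T / K) \<longlongrightarrow> 1) at_top"
    proof
      assume "((\<lambda>T. T * ?W T) \<longlongrightarrow> K) at_top"
      from tendsto_divide[OF this tendsto_const[of K]] K show "((\<lambda>T. T * ?W T / K) \<longlongrightarrow> 1) at_top" by simp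
    next
      assume "((\<lambda>T. T * ?W T / K) \<longlongrightarrow> 1) at_top"
      from tendsto_mult[OF this tendsto_const[of K]] K show "((\<lambda>T. T * ?W T) \<longlongrightarrow> K) at_top" by simp
    qed
    also have "\<dots> \<longleftrightarrow> ((\<lambda>T. ?W T / (T powr (1 - 2) * K)) \<longlongrightarrow> 1) at_top"
    proof (rule tendsto_cong)
      show "\<forall>\<^sub>F T in at_top. T * ?W T / K = ?W T / (T powr (1 - 2) * K)"
        using eventually_gt_at_top[of 0] by eventually_elim (simp add: powr_minus field_simps)
    qed
    also have "\<dots> \<longleftrightarrow> ((\<lambda>x. measure \<nu> (U x) / (C_const 1 * x powr (2 - 1) * K)) \<longlongrightarrow> 1) (at_right 0)"
      \<comment> \<open>the case \<open>\<alpha> = 1\<close> with the constant slowly varying function \<open>K\<close>\<close>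
      using iff[of 1 "\<lambda>_. K"] K by (simp add: slowly_varying_def)
    also have "\<dots> \<longleftrightarrow> ((\<lambda>x. measure \<nu> (U x) / x / (K / pi)) \<longlongrightarrow> 1) (at_right 0)"
    proof (rule tendsto_cong)
      have "Gamma (2::real) = 1" using Gamma_fact[of 1, where 'a=real] by simp
      then have C1: "C_const 1 = 1 / pi" by (simp add: C_const_def)
      show "\<forall>\<^sub>F x in at_right 0. measure \<nu> (U x) / (C_const 1 * x powr (2 - 1) * K) = measure \<nu> (U x) / x / (K / pi)"
        using eventually_at_right_less[of 0] unfolding C1 by eventually_elim simp
    qed
    also have "\<dots> \<longleftrightarrow> ((\<lambda>x. measure \<nu> (U x) / x) \<longlongrightarrow> K / pi) (at_right 0)"
    proof
      assume "((\<lambda>x. measure \<nu> (U x) / x / (K / pi)) \<longlongrightarrow> 1) (at_right 0)"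
      from tendsto_mult[OF this tendsto_const[of "K / pi"]] K show "((\<lambda>x. measure \<nu> (U x) / x) \<longlongrightarrow> K / pi) (at_right 0)" by simp
    next
      assume "((\<lambda>x. measure \<nu> (U x) / x) \<longlongrightarrow> K / pi) (at_right 0)"
      from tendsto_divide[OF this tendsto_const[of "K / pi"]] K show "((\<lambda>x. measure \<nu> (U x) / x / (K / pi)) \<longlongrightarrow> 1) (at_right 0)" by simp
    qed
    finally show ?thesis .
  qed
  have part2: "(?V \<sim>[at_top] (\<lambda>T. T powr \<alpha> * h T)) \<longleftrightarrow> ((\<lambda>x. measure \<nu> (U x)) \<sim>[at_right 0] (\<lambda>x. C_const \<alpha> * x powr (2 - \<alpha>) * h (1 / x)))"
    if ss: "sigma_sq \<nu> < \<infinity>" and inf: "Liminf at_top (\<lambda>T. ereal (?V T / T)) = \<infinity>"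
      and \<alpha>: "1 \<le> \<alpha>" "\<alpha> < 2" and h: "slowly_varying h" for \<alpha> h
  proof -
    have hpos: "0 < h T" if "0 < T" for T using h that by (simp add: slowly_varying_def)
    have "((\<lambda>T. ereal (?V T / T)) \<longlongrightarrow> \<infinity>) at_top"
      using inf by (simp add: Liminf_PInfty)
    then have top: "filterlim (\<lambda>T. ?V T / T) at_top at_top"
      by (simp add: tendsto_PInfty filterlim_at_top_dense)
    have "((\<lambda>T. ?V T / T - T * ?W T) \<longlongrightarrow> ?s) at_top"
      using tendsto_add[OF decomp[OF ss] tendsto_const[of ?s]] by simp
    \<comment> \<open>\<open>var(S\<^sub>T) / T\<close> diverges, so its bounded part is negligible and \<open>T\<^sup>2 W(T)\<close> is asymptotic to \<open>var(S\<^sub>T)\<close>\<close>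
    then have "((\<lambda>T. (?V T / T - T * ?W T) / (?V T / T)) \<longlongrightarrow> 0) at_top"
      by (rule tendsto_divide_0[OF _ filterlim_at_top_imp_at_infinity[OF top]])
    from tendsto_diff[OF tendsto_const[of 1] this]
    have "((\<lambda>T. 1 - (?V T / T - T * ?W T) / (?V T / T)) \<longlongrightarrow> 1) at_top" by simp
    moreover have "\<forall>\<^sub>F T in at_top. 1 - (?V T / T - T * ?W T) / (?V T / T) = T\<^sup>2 * ?W T / ?V T \<and> 0 < ?V T \<and> 0 < T"
      using filterlim_at_top_dense[THEN iffD1, OF top, rule_format, of 0] eventually_gt_at_top[of 0]
    proof eventually_elim
      case (elim T)
      then have "0 < ?V T" by (simp add: zero_less_divide_iff)
      moreover from this elim have "1 - (v / T - T * w) / (v / T) = T\<^sup>2 * w / v" if "v = ?V T" for v w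
        using that by (simp add: field_simps power2_eq_square)
      ultimately show ?case using elim by simp
    qed
    ultimately have WV: "((\<lambda>T. T\<^sup>2 * ?W T / ?V T) \<longlongrightarrow> 1) at_top"
      and Vpos: "\<forall>\<^sub>F T in at_top. 0 < ?V T \<and> 0 < T"
      by (auto elim!: Lim_transform_eventually eventually_mono)
    have "(?V \<sim>[at_top] (\<lambda>T. T powr \<alpha> * h T)) \<longleftrightarrow> ((\<lambda>T. ?V T / (T powr \<alpha> * h T)) \<longlongrightarrow> 1) at_top"
      by (intro asymp_equiv_iff_ratio eventually_mono[OF eventually_gt_at_top[of 0]] mult_pos_pos hpos) auto
    also have "\<dots> \<longleftrightarrow> ((\<lambda>T. ?W T / (T powr (\<alpha> - 2) * h T)) \<longlongrightarrow> 1) at_top"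
    proof
      assume "((\<lambda>T. ?V T / (T powr \<alpha> * h T)) \<longlongrightarrow> 1) at_top"
      from tendsto_mult[OF WV this]
      have "((\<lambda>T. T\<^sup>2 * ?W T / ?V T * (?V T / (T powr \<alpha> * h T))) \<longlongrightarrow> 1) at_top" by simp
      moreover have "\<forall>\<^sub>F T in at_top. T\<^sup>2 * ?W T / ?V T * (?V T / (T powr \<alpha> * h T)) = ?W T / (T powr (\<alpha> - 2) * h T)"
        using Vpos by eventually_elim (auto simp: powr_diff powr_numeral)
      ultimately show "((\<lambda>T. ?W T / (T powr (\<alpha> - 2) * h T)) \<longlongrightarrow> 1) at_top"
        by (rule Lim_transform_eventually)
    next
      assume "((\<lambda>T. ?W T / (T powr (\<alpha> - 2) * h T)) \<longlongrightarrow> 1) at_top"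
      from tendsto_divide[OF this WV]
      have "((\<lambda>T. ?W T / (T powr (\<alpha> - 2) * h T) / (T\<^sup>2 * ?W T / ?V T)) \<longlongrightarrow> 1) at_top" by simp
      moreover have "\<forall>\<^sub>F T in at_top. ?W T / (T powr (\<alpha> - 2) * h T) / (T\<^sup>2 * ?W T / ?V T) = ?V T / (T powr \<alpha> * h T)"
        using Vpos order_tendstoD(1)[OF WV zero_less_one]
      proof eventually_elim
        case (elim T)
        then have "?W T \<noteq> 0" by auto
        then show ?case using elim hpos[of T] by (simp add: powr_diff powr_numeral)
      qed
      ultimately show "((\<lambda>T. ?V T / (T powr \<alpha> * h T)) \<longlongrightarrow> 1) at_top"
        by (rule Lim_transform_eventually)
    qed
    also have "\<dots> \<longleftrightarrow> ((\<lambda>x. measure \<nu> (U x) / (C_const \<alpha> * x powr (2 - \<alpha>) * h (1 / x))) \<longlongrightarrow> 1) (at_right 0)"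
      by (rule iff[OF \<alpha> h])
    also have "\<dots> \<longleftrightarrow> ((\<lambda>x. measure \<nu> (U x)) \<sim>[at_right 0] (\<lambda>x. C_const \<alpha> * x powr (2 - \<alpha>) * h (1 / x)))"
      using \<alpha> C_const_pos[of \<alpha>]
      by (intro asymp_equiv_iff_ratio[symmetric] eventually_mono[OF eventually_at_right_less[of 0]] mult_pos_pos hpos) auto
    finally show ?thesis .
  qed
  show ?thesis using part1 part2 by blast
qed

end
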